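(* There are matrices $C_{\mathrm{S},k},C_{\mathrm{K},k}\in K^{2\times2}(T)$ (i.e. $2\times 2$ matrices of rational functions over $K$ in a variable $T$) such that \[ \mathbb{E}_{\mathrm{S},m,k}=V_k\,\mathbb{P}_{\mathrm{S},m,k}\,V_k^{-1}\,C_{\mathrm{S},k}(q^{m/2})\qquad\text{for all }m\in\mathbb{N}_0=\{0,1,2,\dots\}, \] \[ \mathbb{E}_{\mathrm{K},m,k}=\mathbb{P}_{\mathrm{K},m,k}\,C_{\mathrm{K},k}(q^{m/2})\qquad\text{for all }m\in\mathbb{N}=\{1,2,\dots\}. \] Furthermore, \[ \mathbb{E}_{\mathrm{K},0,k}=\mathbb{P}_{\mathrm{K},0,k}\begin{pmatrix}1&1\\ x&y\end{pmatrix}\qquad\text{for all }x,y\in K. \]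
   Context: Let $K=\mathbb{Q}(\sqrt{-ab},b,\sqrt{-cd},d,q^{1/2})$ be the field of rational functions in the five indeterminates $\sqrt{-ab},b,\sqrt{-cd},d,q^{1/2}$; put $a=-(\sqrt{-ab})^2/b$, $c=-(\sqrt{-cd})^2/d$. Let $*$ be the field involution of $K$ inverting the five generators. Let $\mathcal{A}=K[z,z^{-1}]$ and $\mathcal{A}_0=\{f\in\mathcal{A}: f(z)=f(z^{-1})\}$. For $f=\sum_n f_nz^n$ put $f^*=\sum_n f_n^*z^{-n}$. Write $(x;q)_\infty=\prod_{j\ge0}(1-xq^j)$ and $(x_1,\dots,x_r;q)_\infty=\prod_i(x_i;q)_\infty$. Let \[ \Delta=\frac{(z^2,qz^{-2};q)_\infty}{(az,bz,cz,dz,aqz^{-1},bqz^{-1},cz^{-1},dz^{-1};q)_\infty}, \] expanded as a power series in $z$ and $q^{1/2}z^{-1}$ with coefficients in $\mathcal{R}=\mathbb{Q}[a^{\pm1},b^{\pm1},(cq^{-1/2})^{\pm1},(dq^{-1/2})^{\pm1}]$, hence regarded as an element of $\mathcal{R}((q^{1/2}))[[z^{\pm1}]]$. With $\mathrm{ct}$ denoting the coefficient of $z^0$, put $(f,g)=\mathrm{ct}(fg^*\Delta)\in K\otimes_{\mathcal{R}[q^{\pm1/2}]}\mathcal{R}((q^{1/2}))$. Symmetric Askey--Wilson polynomials: $P_n=P_{n,k}\in\mathcal{A}_0$ ($n\in\mathbb{N}_0$) is the unique element with $P_0=1$ and, for $n\ge1$, $P_n=z^n+z^{-n}+$ (a $K$-linear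 combination of $z^j+z^{-j}$, $0\le j<n$), such that $(P_n,z^m+z^{-m})=0$ for $0\le m<n$. Non-symmetric Askey--Wilson polynomials: order monomials by $1<z<z^{-1}<z^2<z^{-2}<\cdots$; $E_n=E_{n,k}\in\mathcal{A}$ ($n\in\mathbb{Z}$) is the unique element of the form $z^n+$ (lower-order terms) with $(E_n,z^m)=0$ whenever $z^m<z^n$. Here $k$ is a formal label for $(a,b,c,d)$; for $h\in\mathbb{Q}^4$ the subscript $k+h$ means that $(a,b,c,d)$ is replaced by $(aq^{h_1},bq^{h_2},cq^{h_3},dq^{h_4})$. $\epsilon_1,\dots,\epsilon_4$ is the standard basis of $\mathbb{Q}^4$. Put $P_{n}=0$ for $n<0$. The maps $\mathcal{B}_{\mathrm{S}},\mathcal{B}_{\mathrm{K},k}:\mathcal{A}_0^2\to\mathcal{A}$, \[ \mathcal{B}_{\mathrm{S}}\begin{pmatrix}f_1\\ f_2\end{pmatrix}=f_1+zf_2,\qquad \mathcal{B}_{\mathrm{K},k}\begin{pmatrix}f_1\\ f_2\end{pmatrix}=f_1+z^{-1}(1-az)(1-bz)f_2, \] are $\mathcal{A}_0$-linear isomorphisms (Steinberg and Koornwinder bases). For $m\in\mathbb{N}_0$ define the $2\times2$ matrices over $\mathcal{A}_0$ (given by columns, resp. entries) \[ \mathbb{E}_{\mathrm{S},m,k}=\begin{pmatrix}\mathcal{B}_{\mathrm{S}}^{-1}E_{-m,k}&\mathcal{B}_{\mathrm{S}}^{-1}E_{m+1,k}\end{pmatrix},\qquad \mathbb{E}_{\mathrm{K},m,k}=\begin{pmatrix}\mathcal{B}_{\mathrm{K},k}^{-1}E_{-m,k}&\mathcal{B}_{\mathrm{K},k}^{-1}E_{m,k}\end{pmatrix},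 \] \[ \mathbb{P}_{\mathrm{S},m,k}=\begin{pmatrix}P_{m,k+\epsilon_1}&0\\0&P_{m,k+\epsilon_2}\end{pmatrix},\qquad \mathbb{P}_{\mathrm{K},m,k}=\begin{pmatrix}P_{m,k}&0\\0&P_{m-1,k+\epsilon_1+\epsilon_2}\end{pmatrix}, \] and \[ V_k=\begin{pmatrix}-a^{-1}&-b^{-1}\\1&1\end{pmatrix}. \] *)

theory Defs
  imports
    "HOL-Analysis.Analysis"
    "HOL-Computational_Algebra.Computational_Algebra"
    "HOL-Library.Poly_Mapping"
begin

section \<open>Rational functions\<close>

instance fract :: ("{idom,ring_char_0}") semiring_char_0
proof
  show "inj (of_nat :: nat \<Rightarrow> 'a fract)"
    by (rule injI) (simp add: of_nat_fract eq_fract)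
qed

instance fract :: ("{idom,ring_char_0}") field_char_0 ..

text \<open>
  For a ring homomorphism \<open>\<phi>\<close>, a rational function is regular at \<open>y\<close> if it can be written with
  a denominator whose image under \<open>\<phi>\<close> does not vanish at \<open>y\<close>; its value there is the
  quotient of the values of numerator and denominator in any such representation.
\<close>

definition rf_regular :: "('a::field \<Rightarrow> 'b::field) \<Rightarrow> 'b \<Rightarrow> 'a poly fract \<Rightarrow> bool" where
  "rf_regular \<phi> y r \<longleftrightarrow> (\<exists>f g. r = Fract f g \<and> poly (map_poly \<phi> g) y \<noteq> 0)"

definition rf_eval :: "('a::field \<Rightarrow> 'b::field) \<Rightarrow> 'b \<Rightarrow> 'a poly fract \<Rightarrow> 'b" where
  "rf_eval \<phi> y r = (THE v. \<exists>f g. r = Fract f g \<and> poly (map_poly \<phi> g) y \<noteq> 0 \<and>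
     v = poly (map_poly \<phi> f) y / poly (map_poly \<phi> g) y)"

definition rf_const :: "'a::field \<Rightarrow> 'a poly fract" where
  "rf_const c = Fract [:c:] 1"

definition rf_var :: "'a::field poly fract" where
  "rf_var = Fract [:0, 1:] 1"


section \<open>The fields\<close>

type_synonym rat_fun4 = "rat poly fract poly fract poly fract poly fract"

text \<open>
  \<open>K = \<rat>(\<surd>(-ab), b, \<surd>(-cd), d, q\<^sup>1\<^sup>/\<^sup>2)\<close>, the indeterminates being adjoined one after the other
  in this order.
\<close>

type_synonym K = "rat_fun4 poly fract"

definition K_sab :: K where "K_sab = rf_const (rf_const (rf_const (rf_const rf_var)))"
definition K_b :: K where "K_b = rf_const (rf_const (rf_const rf_var))"
definition K_scd :: K where "K_scd = rf_const (rf_const rf_var)"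
definition K_d :: K where "K_d = rf_const rf_var"
definition K_sq :: K where "K_sq = rf_var"

definition K_a :: K where "K_a = - (K_sab\<^sup>2) / K_b"

text \<open>Substitution of values for the five generators of \<open>K\<close>.\<close>

definition K_subst :: "'b::field_char_0 \<Rightarrow> 'b \<Rightarrow> 'b \<Rightarrow> 'b \<Rightarrow> 'b \<Rightarrow> K \<Rightarrow> 'b" where
  "K_subst x1 x2 x3 x4 x5 =
     rf_eval (rf_eval (rf_eval (rf_eval (rf_eval of_rat x1) x2) x3) x4) x5"

definition K_star :: "K \<Rightarrow> K" where
  "K_star = K_subst (inverse K_sab) (inverse K_b) (inverse K_scd) (inverse K_d) (inverse K_sq)"

text \<open>
  The coefficient field \<open>F = \<rat>(\<surd>(-ab), b, \<surd>(-\<gamma>\<delta>), \<delta>)\<close> with \<open>\<gamma> = c q\<^sup>-\<^sup>1\<^sup>/\<^sup>2\<close> and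
  \<open>\<delta> = d q\<^sup>-\<^sup>1\<^sup>/\<^sup>2\<close>; it contains \<open>R = \<rat>[a\<^sup>\<plusminus>\<^sup>1, b\<^sup>\<plusminus>\<^sup>1, \<gamma>\<^sup>\<plusminus>\<^sup>1, \<delta>\<^sup>\<plusminus>\<^sup>1]\<close>. The tensor product
  of \<open>K\<close> and \<open>R((q\<^sup>1\<^sup>/\<^sup>2))\<close> over \<open>R[q\<^sup>\<plusminus>\<^sup>1\<^sup>/\<^sup>2]\<close> embeds into the field \<open>F((q\<^sup>1\<^sup>/\<^sup>2))\<close>:
  \<open>K\<close> is a localization of \<open>A = R[\<surd>(-ab), \<surd>(-\<gamma>\<delta>), q\<^sup>\<plusminus>\<^sup>1\<^sup>/\<^sup>2]\<close>, which is free of rank 4 over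
  \<open>R[q\<^sup>\<plusminus>\<^sup>1\<^sup>/\<^sup>2]\<close>, by nonzero elements of \<open>R[q\<^sup>\<plusminus>\<^sup>1\<^sup>/\<^sup>2]\<close>. The pairing below takes its values in
  \<open>F((q\<^sup>1\<^sup>/\<^sup>2))\<close>, realised as Laurent series whose variable \<open>fls_X\<close> is \<open>q\<^sup>1\<^sup>/\<^sup>2\<close>.
\<close>

type_synonym F = rat_fun4

definition F_sab :: F where "F_sab = rf_const (rf_const (rf_const rf_var))"
definition F_b :: F where "F_b = rf_const (rf_const rf_var)"
definition F_sgd :: F where "F_sgd = rf_const rf_var"
definition F_delta :: F where "F_delta = rf_var"

definition F_a :: F where "F_a = - (F_sab\<^sup>2) / F_b"
definition F_gamma :: F where "F_gamma = - (F_sgd\<^sup>2) / F_delta"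

definition K_emb :: "K \<Rightarrow> F fls" where
  "K_emb = K_subst (fls_const F_sab) (fls_const F_b) (fls_const F_sgd * fls_X)
             (fls_const F_delta * fls_X) fls_X"


section \<open>Laurent polynomials\<close>

type_synonym laurent = "int \<Rightarrow>\<^sub>0 K"

definition zpow :: "int \<Rightarrow> laurent" where
  "zpow n = Poly_Mapping.single n 1"

definition lconst :: "K \<Rightarrow> laurent" where
  "lconst c = Poly_Mapping.single 0 c"

definition laurent_sym :: "laurent set" where
  "laurent_sym = {f. \<forall>n. Poly_Mapping.lookup f (- n) = Poly_Mapping.lookup f n}"

definition laurent_star :: "laurent \<Rightarrow> laurent" where
  "laurent_star f =
     (\<Sum>n\<in>Poly_Mapping.keys f. Poly_Mapping.single (- n) (K_star (Poly_Mapping.lookup f n)))"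


section \<open>The weight and the pairing\<close>

text \<open>
  Power series in \<open>u = z\<close> and \<open>v = q\<^sup>1\<^sup>/\<^sup>2 z\<^sup>-\<^sup>1\<close> over \<open>F\<close>: the outer variable is \<open>v\<close>, the inner
  one is \<open>u\<close>. Since \<open>q\<^sup>1\<^sup>/\<^sup>2 = u v\<close>, the arguments of the \<open>q\<close>-shifted factorials are
  \<open>z\<^sup>2 = u\<^sup>2\<close>, \<open>q z\<^sup>-\<^sup>2 = v\<^sup>2\<close>, \<open>a z = a u\<close>, \<open>a q z\<^sup>-\<^sup>1 = a (u v) v\<close>, \<open>c z = \<gamma> (u v) u\<close>,
  \<open>c z\<^sup>-\<^sup>1 = \<gamma> v\<close>, and likewise for \<open>b\<close> and \<open>d\<close>. The infinite products converge in the \<open>v\<close>-adic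
  topology.
\<close>

type_synonym uv_series = "F fps fps"

definition uv_const :: "F \<Rightarrow> uv_series" where "uv_const c = fps_const (fps_const c)"
definition uv_u :: uv_series where "uv_u = fps_const fps_X"
definition uv_v :: uv_series where "uv_v = fps_X"
definition uv_sq :: uv_series where "uv_sq = uv_u * uv_v"
definition uv_q :: uv_series where "uv_q = uv_sq\<^sup>2"

definition qpoch_inf :: "uv_series \<Rightarrow> uv_series" where
  "qpoch_inf x = prodinf (\<lambda>j. 1 - x * uv_q ^ j)"

text \<open>
  The label \<open>k + h\<close> is represented by the shift \<open>h\<close>, and \<open>k\<close> itself by \<open>h = 0\<close>; only shifts
  with natural-number entries are needed.
\<close>

definition weight_uv :: "nat ^ 4 \<Rightarrow> uv_series" where
  "weight_uv h =
    (let a = uv_const F_a * uv_q ^ (h $ 1);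
         b = uv_const F_b * uv_q ^ (h $ 2);
         \<gamma> = uv_const F_gamma * uv_q ^ (h $ 3);
         \<delta> = uv_const F_delta * uv_q ^ (h $ 4)
     in qpoch_inf (uv_u\<^sup>2) * qpoch_inf (uv_v\<^sup>2) *
        inverse (qpoch_inf (a * uv_u) * qpoch_inf (b * uv_u) *
                 qpoch_inf (\<gamma> * uv_sq * uv_u) * qpoch_inf (\<delta> * uv_sq * uv_u) *
                 qpoch_inf (a * uv_sq * uv_v) * qpoch_inf (b * uv_sq * uv_v) *
                 qpoch_inf (\<gamma> * uv_v) * qpoch_inf (\<delta> * uv_v)))"

text \<open>The coefficient of \<open>z\<^sup>n\<close>: the monomial \<open>u\<^sup>i v\<^sup>j\<close> equals \<open>q\<^sup>j\<^sup>/\<^sup>2 z\<^sup>i\<^sup>-\<^sup>j\<close>.\<close>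

definition weight_coeff :: "nat ^ 4 \<Rightarrow> int \<Rightarrow> F fls" where
  "weight_coeff h n = fps_to_fls (Abs_fps (\<lambda>j.
     if 0 \<le> n + int j then fps_nth (fps_nth (weight_uv h) j) (nat (n + int j)) else 0))"

definition ct_weight :: "nat ^ 4 \<Rightarrow> laurent \<Rightarrow> F fls" where
  "ct_weight h f =
     (\<Sum>n\<in>Poly_Mapping.keys f. K_emb (Poly_Mapping.lookup f n) * weight_coeff h (- n))"

definition pairing :: "nat ^ 4 \<Rightarrow> laurent \<Rightarrow> laurent \<Rightarrow> F fls" where
  "pairing h f g = ct_weight h (f * laurent_star g)"


section \<open>Askey--Wilson polynomials\<close>

definition zsym :: "int \<Rightarrow> laurent" where
  "zsym n = zpow n + zpow (- n)"

definition AW_P :: "nat ^ 4 \<Rightarrow> int \<Rightarrow> laurent" where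
  "AW_P h n =
     (if n < 0 then 0 else if n = 0 then 1 else
       (THE P. P \<in> laurent_sym \<and>
          (\<exists>c. P = zsym n + (\<Sum>j\<in>{0..<n}. lconst (c j) * zsym j)) \<and>
          (\<forall>m\<in>{0..<n}. pairing h P (zsym m) = 0)))"

text \<open>The position of \<open>z\<^sup>n\<close> in the order \<open>1 < z < z\<^sup>-\<^sup>1 < z\<^sup>2 < z\<^sup>-\<^sup>2 < \<dots>\<close>.\<close>

definition mono_pos :: "int \<Rightarrow> int" where
  "mono_pos n = (if n > 0 then 2 * n - 1 else - 2 * n)"

definition mono_less :: "int \<Rightarrow> int \<Rightarrow> bool" where
  "mono_less m n \<longleftrightarrow> mono_pos m < mono_pos n"

definition AW_E :: "int \<Rightarrow> laurent" where
  "AW_E n =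
     (THE E. (\<exists>c. E = zpow n + (\<Sum>m | mono_less m n. lconst (c m) * zpow m)) \<and>
        (\<forall>m. mono_less m n \<longrightarrow> pairing 0 E (zpow m) = 0))"


section \<open>Steinberg and Koornwinder bases\<close>

definition sym_pairs :: "(laurent ^ 2) set" where
  "sym_pairs = {f. f $ 1 \<in> laurent_sym \<and> f $ 2 \<in> laurent_sym}"

definition B_S :: "laurent ^ 2 \<Rightarrow> laurent" where
  "B_S f = f $ 1 + zpow 1 * f $ 2"

definition B_K :: "laurent ^ 2 \<Rightarrow> laurent" where
  "B_K f = f $ 1 + zpow (- 1) * (1 - lconst K_a * zpow 1) * (1 - lconst K_b * zpow 1) * f $ 2"

definition mat_of_cols :: "'a ^ 2 \<Rightarrow> 'a ^ 2 \<Rightarrow> 'a::zero ^ 2 ^ 2" where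
  "mat_of_cols x y = transpose (vector [x, y])"

definition diag2 :: "'a \<Rightarrow> 'a \<Rightarrow> 'a::zero ^ 2 ^ 2" where
  "diag2 x y = vector [vector [x, 0], vector [0, y]]"

definition EE_S :: "nat \<Rightarrow> laurent ^ 2 ^ 2" where
  "EE_S m = mat_of_cols (inv_into sym_pairs B_S (AW_E (- int m)))
                        (inv_into sym_pairs B_S (AW_E (int m + 1)))"

definition EE_K :: "nat \<Rightarrow> laurent ^ 2 ^ 2" where
  "EE_K m = mat_of_cols (inv_into sym_pairs B_K (AW_E (- int m)))
                        (inv_into sym_pairs B_K (AW_E (int m)))"

definition PP_S :: "nat \<Rightarrow> laurent ^ 2 ^ 2" where
  "PP_S m = diag2 (AW_P (axis 1 1) (int m)) (AW_P (axis 2 1) (int m))"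

definition PP_K :: "nat \<Rightarrow> laurent ^ 2 ^ 2" where
  "PP_K m = diag2 (AW_P 0 (int m)) (AW_P (axis 1 1 + axis 2 1) (int m - 1))"

definition V_mat :: "K ^ 2 ^ 2" where
  "V_mat = vector [vector [- inverse K_a, - inverse K_b], vector [1, 1]]"

definition mat_const :: "K ^ 2 ^ 2 \<Rightarrow> laurent ^ 2 ^ 2" where
  "mat_const M = map_matrix lconst M"

definition mat_regular :: "K \<Rightarrow> K poly fract ^ 2 ^ 2 \<Rightarrow> bool" where
  "mat_regular t C \<longleftrightarrow> (\<forall>i j. rf_regular (\<lambda>x. x) t (C $ i $ j))"

definition mat_eval :: "K \<Rightarrow> K poly fract ^ 2 ^ 2 \<Rightarrow> K ^ 2 ^ 2" where
  "mat_eval t C = map_matrix (rf_eval (\<lambda>x. x) t) C"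

end

theory Submission
  imports Defs
begin

text \<open>
  For \<open>f, g\<close> symmetric under \<open>z \<mapsto> 1/z\<close>, the factor \<open>S = (1 - a z) (1 - b z) \<Delta> / (1 - z\<^sup>2)\<close> of the
  weight is invariant under \<open>z \<mapsto> 1/z\<close>. Hence \<open>z\<^sup>-\<^sup>1\<close> acts as the scalar \<open>b\<close> on
  \<open>f \<mapsto> ct ((1 - a z) f \<Delta>)\<close>, this functional is proportional to the one of the parameters
  \<open>k + \<epsilon>\<^sub>1\<close>, and \<open>(1 - a z) P\<^bsub>m,k+\<epsilon>1\<^esub>\<close> and \<open>(1 - b z) P\<^bsub>m,k+\<epsilon>2\<^esub>\<close> are orthogonal to
  \<open>z\<^sup>j\<close> for \<open>- m < j \<le> m\<close>. The polynomials in the span of \<open>z\<^sup>j\<close> with \<open>- m \<le> j \<le> m + 1\<close> having this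
  property form a two-dimensional space, which also contains \<open>E\<^bsub>-m\<^esub>\<close> and \<open>E\<^bsub>m+1\<^esub>\<close>. The Koornwinder
  case is the same with \<open>P\<^bsub>m,k\<^esub>\<close> and \<open>z\<^sup>-\<^sup>1 (1 - a z) (1 - b z) P\<^bsub>m-1,k+\<epsilon>1+\<epsilon>2\<^esub>\<close> inside the span
  of \<open>z\<^sup>j\<close> with \<open>\<bar>j\<bar> \<le> m\<close>.

  What remains is the ratio of two norms. The substitution \<open>z \<mapsto> q\<^sup>1\<^sup>/\<^sup>2 / z\<close> exchanges \<open>(a, b)\<close> with
  \<open>(c q\<^sup>-\<^sup>1\<^sup>/\<^sup>2, d q\<^sup>-\<^sup>1\<^sup>/\<^sup>2)\<close>, so the dual polynomials give further elements of the same two-dimensional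
  space. Expanding one of them in the first basis and comparing its extreme coefficients and
  pairings yields the ratio as a rational function of \<open>q\<^sup>m\<close>.

  Modulo \<open>q\<^sup>1\<^sup>/\<^sup>2\<close> the Gram matrix of consecutive monomials is unitriangular, so all pairings involved
  are nondegenerate; and the two reflections together express every moment of the weight as an
  element of \<open>K\<close> times the zeroth one.
\<close>

unbundle no Formal_Power_Series.fps_syntax

section \<open>Derivations and substitution homomorphisms\<close>

text \<open>The pairing takes values in \<open>F fls\<close>, while the polynomials have
  coefficients in \<open>K\<close>, so their Gram systems must be solved over \<open>K\<close>. This
  is why the rationality of the moments matters: dividing by \<open>wmoment 0\<close> turns the
  weight into a \<open>K\<close>-valued functional with the same orthogonality relations, and the
  rest is linear algebra over \<open>K\<close>. As z^n enters the second argument as z^-n, the Gram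
  matrix of the monomials is a Toeplitz matrix of moments. In each two-dimensional space, one E is
  singled out by the vanishing of an extreme coefficient, which the known end coefficients of the
  basis settle. The other is singled out by one further pairing, and only there the norm ratio
  enters. The dual polynomial brings in its own unknown norm, but both extreme pairings are
  multiples of it, so it can be eliminated. \<open>K_star\<close> and \<open>K_emb\<close> are
  iterated evaluations given by a definite description, so even their additivity rests on the
  algebraic independence of the substituted values; derivations supply it.\<close>

definition field_hom :: "('a::field \<Rightarrow> 'b::field) \<Rightarrow> bool" where
  "field_hom \<phi> \<longleftrightarrow> \<phi> 1 = 1 \<and> (\<forall>x y. \<phi> (x + y) = \<phi> x + \<phi> y) \<and> (\<forall>x y. \<phi> (x * y) = \<phi> x * \<phi> y)"

lemma field_hom_1: "field_hom \<phi> \<Longrightarrow> \<phi> 1 = 1"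
  and field_hom_add: "field_hom \<phi> \<Longrightarrow> \<phi> (x + y) = \<phi> x + \<phi> y"
  and field_hom_mult: "field_hom \<phi> \<Longrightarrow> \<phi> (x * y) = \<phi> x * \<phi> y"
  by (auto simp: field_hom_def)

lemma field_hom_0: "field_hom \<phi> \<Longrightarrow> \<phi> 0 = 0"
  by (metis add.right_neutral add_cancel_right_right field_hom_add)

lemma field_hom_uminus: "field_hom \<phi> \<Longrightarrow> \<phi> (- x) = - \<phi> x"
  using field_hom_add[of \<phi> x "- x"] by (simp add: field_hom_0 eq_neg_iff_add_eq_0 add.commute)

lemma field_hom_diff: "field_hom \<phi> \<Longrightarrow> \<phi> (x - y) = \<phi> x - \<phi> y"
  using field_hom_add[of \<phi> x "- y"] by (simp add: field_hom_uminus)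

lemma field_hom_sum: "field_hom \<phi> \<Longrightarrow> \<phi> (sum f A) = (\<Sum>x\<in>A. \<phi> (f x))"
  by (induction A rule: infinite_finite_induct) (auto simp: field_hom_0 field_hom_add)

lemma field_hom_power: "field_hom \<phi> \<Longrightarrow> \<phi> (x ^ n) = \<phi> x ^ n"
  by (induction n) (auto simp: field_hom_1 field_hom_mult)

lemma field_hom_eq_0: "field_hom \<phi> \<Longrightarrow> \<phi> x = 0 \<longleftrightarrow> x = 0"
  by (metis field_hom_0 field_hom_1 field_hom_mult mult_zero_left right_inverse zero_neq_one)

lemma field_hom_inverse: "field_hom \<phi> \<Longrightarrow> \<phi> (inverse x) = inverse (\<phi> x)"
  by (cases "x = 0")
     (auto simp: field_hom_0 field_hom_1 intro!: inverse_unique[symmetric] simp flip: field_hom_mult)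

lemma field_hom_divide: "field_hom \<phi> \<Longrightarrow> \<phi> (x / y) = \<phi> x / \<phi> y"
  by (simp add: divide_inverse field_hom_mult field_hom_inverse)

lemma field_hom_of_rat: "field_hom (of_rat :: rat \<Rightarrow> 'a::field_char_0)"
  by (simp add: field_hom_def of_rat_add of_rat_mult)

lemma map_poly_hom_add:
  "field_hom \<phi> \<Longrightarrow> map_poly \<phi> (p + q) = map_poly \<phi> p + map_poly \<phi> q"
  by (intro poly_eqI) (simp add: coeff_map_poly field_hom_0 field_hom_add)

lemma map_poly_hom_mult:
  "field_hom \<phi> \<Longrightarrow> map_poly \<phi> (p * q) = map_poly \<phi> p * map_poly \<phi> q"
  by (intro poly_eqI) (simp add: coeff_map_poly coeff_mult field_hom_0 field_hom_sum field_hom_mult)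

section \<open>Evaluation of rational functions at a transcendental value\<close>

lemma rf_eval_Fract:
  assumes "field_hom \<phi>" "poly (map_poly \<phi> g) y \<noteq> 0"
  shows "rf_eval \<phi> y (Fract f g) = poly (map_poly \<phi> f) y / poly (map_poly \<phi> g) y"
  unfolding rf_eval_def
proof (rule the_equality)
  fix v
  assume "\<exists>f' g'. Fract f g = Fract f' g' \<and> poly (map_poly \<phi> g') y \<noteq> 0 \<and>
     v = poly (map_poly \<phi> f') y / poly (map_poly \<phi> g') y"
  then obtain f' g' where *: "Fract f g = Fract f' g'" "poly (map_poly \<phi> g') y \<noteq> 0"
    "v = poly (map_poly \<phi> f') y / poly (map_poly \<phi> g') y" by blast
  then have "g \<noteq> 0" "g' \<noteq> 0" using assms by auto
  with * have "f * g' = f' * g" by (simp add: eq_fract)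
  then have "poly (map_poly \<phi> (f * g')) y = poly (map_poly \<phi> (f' * g)) y" by simp
  then show "v = poly (map_poly \<phi> f) y / poly (map_poly \<phi> g) y"
    unfolding *(3) using *(2) assms by (simp add: map_poly_hom_mult frac_eq_eq)
qed (use assms in blast)

text \<open>Transcendence of \<open>y\<close> over the image of \<open>\<phi>\<close>. It makes
  every rational function regular at \<open>y\<close>, so that \<open>rf_eval\<close> is a
  homomorphism on the whole field.\<close>

definition transc :: "('a::field \<Rightarrow> 'b::field) \<Rightarrow> 'b \<Rightarrow> bool" where
  "transc \<phi> y \<longleftrightarrow> (\<forall>g. g \<noteq> 0 \<longrightarrow> poly (map_poly \<phi> g) y \<noteq> 0)"

lemma rf_eval_field_hom:
  assumes h: "field_hom \<phi>" and t: "transc \<phi> y"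
  shows "field_hom (rf_eval \<phi> y)"
  unfolding field_hom_def
proof (intro conjI allI)
  have ev: "rf_eval \<phi> y (Fract f g) = poly (map_poly \<phi> f) y / poly (map_poly \<phi> g) y"
    if "g \<noteq> 0" for f g using rf_eval_Fract[OF h] t that by (auto simp: transc_def)
  have nz: "poly (map_poly \<phi> g) y \<noteq> 0" if "g \<noteq> 0" for g using t that by (auto simp: transc_def)
  show "rf_eval \<phi> y 1 = 1"
    using h by (simp add: One_fract_def ev map_poly_1 field_hom_1 field_hom_0)
  fix r r' :: "'a poly fract"
  obtain f g where r: "r = Fract f g" "g \<noteq> 0" by (cases r)
  obtain f' g' where r': "r' = Fract f' g'" "g' \<noteq> 0" by (cases r')
  show "rf_eval \<phi> y (r + r') = rf_eval \<phi> y r + rf_eval \<phi> y r'"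
    using r r' nz[of g] nz[of g']
    by (simp add: ev map_poly_hom_add[OF h] map_poly_hom_mult[OF h] field_simps)
  show "rf_eval \<phi> y (r * r') = rf_eval \<phi> y r * rf_eval \<phi> y r'"
    using r r' nz[of g] nz[of g']
    by (simp add: ev map_poly_hom_mult[OF h])
qed

lemma rf_eval_const: "field_hom \<phi> \<Longrightarrow> rf_eval \<phi> y (rf_const c) = \<phi> c"
  unfolding rf_const_def
  by (subst rf_eval_Fract) (auto simp: map_poly_pCons field_hom_0 field_hom_1)

lemma rf_eval_var: "field_hom \<phi> \<Longrightarrow> rf_eval \<phi> y rf_var = y"
  unfolding rf_var_def
  by (subst rf_eval_Fract) (auto simp: map_poly_pCons field_hom_0 field_hom_1)

section \<open>Derivations as a criterion for transcendence\<close>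

definition derivation :: "('a::comm_ring_1 \<Rightarrow> 'a) \<Rightarrow> bool" where
  "derivation D \<longleftrightarrow> (\<forall>x y. D (x + y) = D x + D y) \<and> (\<forall>x y. D (x * y) = D x * y + x * D y)"

lemma derivation_add: "derivation D \<Longrightarrow> D (x + y) = D x + D y"
  and derivation_mult: "derivation D \<Longrightarrow> D (x * y) = D x * y + x * D y"
  by (auto simp: derivation_def)

lemma derivation_0: "derivation D \<Longrightarrow> D 0 = 0"
  using derivation_add[of D 0 0] by simp

lemma derivation_1: "derivation D \<Longrightarrow> D 1 = 0"
  using derivation_mult[of D 1 1] by simp

lemma derivation_uminus: "derivation D \<Longrightarrow> D (- x) = - D x"
  using derivation_add[of D x "- x"] by (simp add: derivation_0 eq_neg_iff_add_eq_0 add.commute)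

lemma derivation_diff: "derivation D \<Longrightarrow> D (x - y) = D x - D y"
  using derivation_add[of D x "- y"] by (simp add: derivation_uminus)

lemma derivation_sum: "derivation D \<Longrightarrow> D (sum f A) = (\<Sum>x\<in>A. D (f x))"
  by (induction A rule: infinite_finite_induct) (auto simp: derivation_0 derivation_add)

lemma derivation_inverse:
  fixes x :: "'a::field"
  assumes "derivation D" "x \<noteq> 0"
  shows "D (inverse x) = - D x / x\<^sup>2"
proof -
  have "D (x * inverse x) = D x * inverse x + x * D (inverse x)"
    using assms by (simp only: derivation_mult)
  then have "0 = D x * inverse x + x * D (inverse x)" using assms by (simp add: derivation_1)
  then have "x * D (inverse x) = - D x * inverse x" by (simp add: eq_neg_iff_add_eq_0 add.commute)
  then have "inverse x * (x * D (inverse x)) = - D x * inverse x * inverse x" by simp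
  then show ?thesis using assms(2) by (simp add: divide_inverse power2_eq_square mult.assoc[symmetric])
qed

lemma derivation_divide_eq_0:
  fixes x :: "'a::field"
  assumes "derivation D" "D x = 0" "D y = 0"
  shows "D (x / y) = 0"
  using assms by (cases "y = 0") (auto simp: derivation_0 divide_inverse derivation_mult derivation_inverse)

lemma derivation_of_rat: "derivation D \<Longrightarrow> D (of_rat r :: 'a::field_char_0) = 0"
proof -
  assume D: "derivation D"
  have nat: "D (of_nat n) = 0" for n
    by (induction n) (auto simp: derivation_0[OF D] derivation_1[OF D] derivation_add[OF D])
  have int: "D (of_int n) = 0" for n
    by (cases n) (auto simp: nat derivation_uminus[OF D] derivation_add[OF D] derivation_diff[OF D] derivation_1[OF D])
  show ?thesis
    by (cases r) (auto simp: of_rat_rat intro!: derivation_divide_eq_0[OF D] int)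
qed

lemma derivation_poly_map_poly:
  fixes \<phi> :: "'a::field \<Rightarrow> 'b::field"
  assumes D: "derivation D" and \<phi>: "field_hom \<phi>" and D\<phi>: "\<And>c. D (\<phi> c) = 0"
  shows "D (poly (map_poly \<phi> g) y) = poly (map_poly \<phi> (pderiv g)) y * D y"
proof (induction g)
  case 0 then show ?case by (simp add: derivation_0[OF D])
next
  case (pCons c g)
  then show ?case
    by (simp add: pderiv_pCons map_poly_hom_add[OF \<phi>] map_poly_pCons field_hom_0[OF \<phi>]
        derivation_add[OF D] derivation_mult[OF D] D\<phi> algebra_simps)
qed

text \<open>Induction on the degree: applying \<open>D\<close> to g(y) gives g'(y) * D y, so g(y) =
  0 would force g'(y) = 0, and in characteristic zero g' vanishes only for constant g.\<close>

lemma transc_if_derivation: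
  fixes \<phi> :: "'a::field_char_0 \<Rightarrow> 'b::field"
  assumes D: "derivation D" and \<phi>: "field_hom \<phi>" and D\<phi>: "\<And>c. D (\<phi> c) = 0" and y: "D y \<noteq> 0"
  shows "transc \<phi> y"
  unfolding transc_def
proof (intro allI impI)
  fix g :: "'a poly" assume "g \<noteq> 0"
  then show "poly (map_poly \<phi> g) y \<noteq> 0"
  proof (induction "degree g" arbitrary: g rule: less_induct)
    case less
    show ?case
    proof (cases "pderiv g = 0")
      case True
      then have "degree g = 0" by (simp add: pderiv_eq_0_iff)
      then obtain c where "g = [:c:]" by (rule degree_eq_zeroE)
      with less.prems show ?thesis
        using field_hom_eq_0[OF \<phi>, of c] by (simp add: map_poly_pCons field_hom_0[OF \<phi>])
    next
      case False
      then have "degree (pderiv g) < degree g"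
        by (metis degree_pderiv diff_less less_numeral_extra(1) not_gr_zero pderiv_eq_0_iff)
      then have "poly (map_poly \<phi> (pderiv g)) y \<noteq> 0" using less.hyps False by blast
      with y derivation_poly_map_poly[OF D \<phi> D\<phi>, of g y] derivation_0[OF D]
      show ?thesis by auto
    qed
  qed
qed

lemma derivation_rf_eval:
  fixes \<phi> :: "'a::field \<Rightarrow> 'b::field"
  assumes D: "derivation D" and \<phi>: "field_hom \<phi>" and D\<phi>: "\<And>c. D (\<phi> c) = 0" and y: "D y = 0"
    and t: "transc \<phi> y"
  shows "D (rf_eval \<phi> y r) = 0"
proof -
  obtain f g where r: "r = Fract f g" "g \<noteq> 0" by (cases r)
  then have "poly (map_poly \<phi> g) y \<noteq> 0" using t by (auto simp: transc_def)
  then show ?thesis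
    using r derivation_poly_map_poly[OF D \<phi> D\<phi>, of _ y] y
    by (auto simp: rf_eval_Fract[OF \<phi>] intro!: derivation_divide_eq_0[OF D])
qed

text \<open>The Jacobian criterion for the independence of the values substituted, in triangular form.\<close>

lemma K_subst_field_hom:
  fixes x1 x2 x3 x4 x5 :: "'b::field_char_0"
  assumes D: "derivation D1" "derivation D2" "derivation D3" "derivation D4" "derivation D5"
    and nz: "D1 x1 \<noteq> 0" "D2 x2 \<noteq> 0" "D3 x3 \<noteq> 0" "D4 x4 \<noteq> 0" "D5 x5 \<noteq> 0"
    and z: "D2 x1 = 0" "D3 x1 = 0" "D4 x1 = 0" "D5 x1 = 0" "D3 x2 = 0" "D4 x2 = 0" "D5 x2 = 0"
           "D4 x3 = 0" "D5 x3 = 0" "D5 x4 = 0"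
  shows "field_hom (K_subst x1 x2 x3 x4 x5)" (is ?hom)
    and "K_subst x1 x2 x3 x4 x5 K_sab = x1" "K_subst x1 x2 x3 x4 x5 K_b = x2"
        "K_subst x1 x2 x3 x4 x5 K_scd = x3" "K_subst x1 x2 x3 x4 x5 K_d = x4"
        "K_subst x1 x2 x3 x4 x5 K_sq = x5"
proof -
  let ?p0 = "of_rat :: rat \<Rightarrow> 'b"
  let ?p1 = "rf_eval ?p0 x1" let ?p2 = "rf_eval ?p1 x2" let ?p3 = "rf_eval ?p2 x3"
  let ?p4 = "rf_eval ?p3 x4" let ?p5 = "rf_eval ?p4 x5"
  note h0 = field_hom_of_rat[where ?'a = 'b]
  have k0: "D (?p0 c) = 0" if "derivation D" for D c using derivation_of_rat[OF that] .
  have t1: "transc ?p0 x1" by (rule transc_if_derivation[OF D(1) h0]) (auto simp: k0 D nz)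
  note h1 = rf_eval_field_hom[OF h0 t1]
  have k1: "D (?p1 c) = 0" if "derivation D" "D x1 = 0" for D c
    using derivation_rf_eval[OF that(1) h0 _ that(2) t1] k0[OF that(1)] by blast
  have t2: "transc ?p1 x2" by (rule transc_if_derivation[OF D(2) h1]) (auto simp: k1 D nz z)
  note h2 = rf_eval_field_hom[OF h1 t2]
  have k2: "D (?p2 c) = 0" if "derivation D" "D x1 = 0" "D x2 = 0" for D c
    using derivation_rf_eval[OF that(1) h1 _ that(3) t2] k1[OF that(1,2)] by blast
  have t3: "transc ?p2 x3" by (rule transc_if_derivation[OF D(3) h2]) (auto simp: k2 D nz z)
  note h3 = rf_eval_field_hom[OF h2 t3]
  have k3: "D (?p3 c) = 0" if "derivation D" "D x1 = 0" "D x2 = 0" "D x3 = 0" for D c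
    using derivation_rf_eval[OF that(1) h2 _ that(4) t3] k2[OF that(1-3)] by blast
  have t4: "transc ?p3 x4" by (rule transc_if_derivation[OF D(4) h3]) (auto simp: k3 D nz z)
  note h4 = rf_eval_field_hom[OF h3 t4]
  have k4: "D (?p4 c) = 0" if "derivation D" "D x1 = 0" "D x2 = 0" "D x3 = 0" "D x4 = 0" for D c
    using derivation_rf_eval[OF that(1) h3 _ that(5) t4] k3[OF that(1-4)] by blast
  have t5: "transc ?p4 x5" by (rule transc_if_derivation[OF D(5) h4]) (auto simp: k4 D nz z)
  show ?hom unfolding K_subst_def by (rule rf_eval_field_hom[OF h4 t5])
  note rf = rf_eval_const rf_eval_var h0 h1 h2 h3 h4
  show "K_subst x1 x2 x3 x4 x5 K_sab = x1" "K_subst x1 x2 x3 x4 x5 K_b = x2"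
        "K_subst x1 x2 x3 x4 x5 K_scd = x3" "K_subst x1 x2 x3 x4 x5 K_d = x4"
        "K_subst x1 x2 x3 x4 x5 K_sq = x5"
    unfolding K_subst_def K_sab_def K_b_def K_scd_def K_d_def K_sq_def
    by (simp_all add: rf)
qed

text \<open>\<open>D\<close> on the coefficients plus e times the Euler operator x d/dx. The
  variable is scaled, not sent to a constant, because the values substituted by
  \<open>K_star\<close> and \<open>K_emb\<close> are monomials in the generators, on which such
  derivations act by scalars.\<close>

definition poly_der :: "('a::idom \<Rightarrow> 'a) \<Rightarrow> 'a \<Rightarrow> 'a poly \<Rightarrow> 'a poly" where
  "poly_der D e p = map_poly D p + smult e (pCons 0 (pderiv p))"

lemma coeff_poly_der:
  "derivation D \<Longrightarrow> coeff (poly_der D e p) n = D (coeff p n) + e * of_nat n * coeff p n"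
  by (cases n) (auto simp: poly_der_def coeff_map_poly derivation_0 coeff_pderiv)

lemma derivation_poly_der:
  assumes D: "derivation D"
  shows "derivation (poly_der D e)"
  unfolding derivation_def
proof (intro conjI allI)
  fix p q
  show "poly_der D e (p + q) = poly_der D e p + poly_der D e q"
    by (intro poly_eqI) (simp add: coeff_poly_der[OF D] derivation_add[OF D] algebra_simps)
  show "poly_der D e (p * q) = poly_der D e p * q + p * poly_der D e q"
  proof (intro poly_eqI)
    fix n
    have "coeff (poly_der D e (p * q)) n =
      (\<Sum>i\<le>n. D (coeff p i) * coeff q (n - i) + coeff p i * D (coeff q (n - i))
         + e * of_nat n * (coeff p i * coeff q (n - i)))"
      by (simp add: coeff_poly_der[OF D] coeff_mult derivation_sum[OF D] derivation_mult[OF D]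
          sum.distrib sum_distrib_left)
    also have "\<dots> = (\<Sum>i\<le>n. (D (coeff p i) + e * of_nat i * coeff p i) * coeff q (n - i)
         + coeff p i * (D (coeff q (n - i)) + e * of_nat (n - i) * coeff q (n - i)))"
    proof (rule sum.cong[OF refl])
      fix i assume "i \<in> {..n}"
      then have "(of_nat n :: 'a) = of_nat i + of_nat (n - i)" by (simp flip: of_nat_add)
      then show "D (coeff p i) * coeff q (n - i) + coeff p i * D (coeff q (n - i))
         + e * of_nat n * (coeff p i * coeff q (n - i)) =
        (D (coeff p i) + e * of_nat i * coeff p i) * coeff q (n - i)
         + coeff p i * (D (coeff q (n - i)) + e * of_nat (n - i) * coeff q (n - i))"
        by (simp add: algebra_simps)
    qed
    finally show "coeff (poly_der D e (p * q)) n = coeff (poly_der D e p * q + p * poly_der D e q) n"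
      by (simp add: coeff_mult coeff_poly_der[OF D] sum.distrib)
  qed
qed

definition fract_der :: "('a::idom \<Rightarrow> 'a) \<Rightarrow> 'a fract \<Rightarrow> 'a fract" where
  "fract_der d r = (case SOME p. r = Fract (fst p) (snd p) \<and> snd p \<noteq> 0 of
     (f, g) \<Rightarrow> Fract (d f * g - f * d g) (g * g))"

text \<open>Independence of the representative chosen by \<open>SOME\<close>: differentiating f g' =
  f' g shows that the two quotient-rule values are equal fractions.\<close>

lemma fract_der_Fract:
  assumes d: "derivation d" and g: "g \<noteq> 0"
  shows "fract_der d (Fract f g) = Fract (d f * g - f * d g) (g * g)"
proof -
  let ?P = "\<lambda>p. Fract f g = Fract (fst p) (snd p) \<and> snd p \<noteq> 0"
  have "?P (f, g)" using g by simp
  then have *: "?P (SOME p. ?P p)" by (rule someI)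
  obtain f' g' where p: "(SOME p. ?P p) = (f', g')" by fastforce
  with * have e: "Fract f g = Fract f' g'" "g' \<noteq> 0" by auto
  with g have e2: "f * g' = f' * g" by (simp add: eq_fract)
  then have "d (f * g') = d (f' * g)" by simp
  then have e3: "d f * g' + f * d g' = d f' * g + f' * d g" by (simp add: derivation_mult[OF d])
  have "(d f' * g' - f' * d g') * (g * g) - (d f * g - f * d g) * (g' * g')
      = g * g' * (d f' * g + f' * d g - (d f * g' + f * d g'))
        + (f * g' - f' * g) * (d g * g' + d g' * g)"
    by (simp add: algebra_simps)
  also have "\<dots> = 0" using e2 e3 by simp
  finally have "(d f' * g' - f' * d g') * (g * g) = (d f * g - f * d g) * (g' * g')" by simp
  then show ?thesis using g e(2) p by (simp add: fract_der_def eq_fract)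
qed

lemma derivation_fract_der:
  assumes d: "derivation d"
  shows "derivation (fract_der d)"
  unfolding derivation_def
proof (intro conjI allI)
  fix r r' :: "'a fract"
  obtain f g where r: "r = Fract f g" "g \<noteq> 0" by (cases r)
  obtain f' g' where r': "r' = Fract f' g'" "g' \<noteq> 0" by (cases r')
  show "fract_der d (r + r') = fract_der d r + fract_der d r'"
    using r r' by (simp add: fract_der_Fract[OF d] eq_fract derivation_mult[OF d]
        derivation_add[OF d]) (simp add: algebra_simps)
  show "fract_der d (r * r') = fract_der d r * r' + r * fract_der d r'"
    using r r' by (simp add: fract_der_Fract[OF d] eq_fract derivation_mult[OF d]
        derivation_add[OF d]) (simp add: algebra_simps)
qed

definition rf_der :: "('a::field \<Rightarrow> 'a) \<Rightarrow> 'a \<Rightarrow> 'a poly fract \<Rightarrow> 'a poly fract" where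
  "rf_der D e = fract_der (poly_der D e)"

lemma derivation_rf_der: "derivation D \<Longrightarrow> derivation (rf_der D e)"
  unfolding rf_der_def by (intro derivation_fract_der derivation_poly_der)

lemma rf_der_const: "derivation D \<Longrightarrow> rf_der D e (rf_const c) = rf_const (D c)"
  by (simp add: rf_der_def rf_const_def fract_der_Fract derivation_poly_der)
     (simp add: poly_der_def derivation_0 derivation_1 map_poly_pCons map_poly_1 eq_fract one_pCons)

lemma rf_der_var: "derivation D \<Longrightarrow> rf_der D e rf_var = rf_const e * rf_var"
  by (simp add: rf_der_def rf_const_def rf_var_def fract_der_Fract derivation_poly_der)
     (simp add: poly_der_def derivation_0 derivation_1 map_poly_pCons map_poly_1 eq_fract one_pCons
        pderiv_pCons)

definition fls_der :: "('a::comm_ring_1 \<Rightarrow> 'a) \<Rightarrow> 'a \<Rightarrow> 'a fls \<Rightarrow> 'a fls" where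
  "fls_der D e f = Abs_fls (\<lambda>n. D (fls_nth f n) + e * of_int n * fls_nth f n)"

lemma fls_der_nth:
  assumes "derivation D"
  shows "fls_nth (fls_der D e f) n = D (fls_nth f n) + e * of_int n * fls_nth f n"
  unfolding fls_der_def
proof (subst nth_Abs_fls_lower_bound[where N = "fls_subdegree f"])
  show "\<forall>k<fls_subdegree f. D (fls_nth f k) + e * of_int k * fls_nth f k = 0"
    by (simp add: derivation_0[OF assms])
qed simp

lemma derivation_fls_der:
  fixes D :: "'a::comm_ring_1 \<Rightarrow> 'a"
  assumes D: "derivation D"
  shows "derivation (fls_der D e)"
  unfolding derivation_def
proof (intro conjI allI)
  fix p q :: "'a fls"
  show "fls_der D e (p + q) = fls_der D e p + fls_der D e q"
    by (intro fls_eqI) (simp add: fls_der_nth[OF D] derivation_add[OF D] algebra_simps)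
  let ?N = "fls_subdegree p" and ?M = "fls_subdegree q"
  \<comment> \<open>A derived series may have a larger subdegree than the original, so every
    convolution is taken over the window given by \<open>p\<close> and \<open>q\<close>.\<close>
  have mult: "fls_nth (x * y) n = (\<Sum>i=?N..n - ?M. fls_nth x i * fls_nth y (n - i))"
    if "\<And>i. i < ?N \<Longrightarrow> fls_nth x i = 0" "\<And>i. i < ?M \<Longrightarrow> fls_nth y i = 0"
    for x y :: "'a fls" and n
  proof -
    have sub: "x \<noteq> 0 \<Longrightarrow> ?N \<le> fls_subdegree x" "y \<noteq> 0 \<Longrightarrow> ?M \<le> fls_subdegree y"
      using that by (meson fls_subdegree_geI nth_fls_subdegree_nonzero not_le)+
    show ?thesis
    proof (cases "x = 0 \<or> y = 0")
      case True then show ?thesis by auto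
    next
      case False
      have "fls_nth (x * y) n = (\<Sum>i=fls_subdegree x..n - fls_subdegree y. fls_nth x i * fls_nth y (n - i))"
        by (rule fls_times_nth(2))
      also have "\<dots> = (\<Sum>i=?N..n - ?M. fls_nth x i * fls_nth y (n - i))"
        using sub False by (intro sum.mono_neutral_left) auto
      finally show ?thesis .
    qed
  qed
  have dz: "fls_nth (fls_der D e x) i = 0" if "i < fls_subdegree x" for x i
    using that by (simp add: fls_der_nth[OF D] derivation_0[OF D])
  show "fls_der D e (p * q) = fls_der D e p * q + p * fls_der D e q"
  proof (intro fls_eqI)
    fix n
    have "fls_nth (fls_der D e (p * q)) n =
      (\<Sum>i=?N..n - ?M. D (fls_nth p i) * fls_nth q (n - i) + fls_nth p i * D (fls_nth q (n - i))
         + e * of_int n * (fls_nth p i * fls_nth q (n - i)))"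
      by (simp add: fls_der_nth[OF D] mult derivation_sum[OF D] derivation_mult[OF D]
          sum.distrib sum_distrib_left)
    also have "\<dots> = (\<Sum>i=?N..n - ?M. (D (fls_nth p i) + e * of_int i * fls_nth p i) * fls_nth q (n - i)
         + fls_nth p i * (D (fls_nth q (n - i)) + e * of_int (n - i) * fls_nth q (n - i)))"
      by (rule sum.cong) (simp_all add: algebra_simps)
    also have "\<dots> = fls_nth (fls_der D e p * q) n + fls_nth (p * fls_der D e q) n"
      by (subst mult[of "fls_der D e p" q], simp add: dz, simp, subst mult[of p "fls_der D e q"], simp,
          simp add: dz, simp only: fls_der_nth[OF D] sum.distrib)
    finally show "fls_nth (fls_der D e (p * q)) n = fls_nth (fls_der D e p * q + p * fls_der D e q) n"
      by simp
  qed
qed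

lemma fls_der_const: "derivation D \<Longrightarrow> fls_der D e (fls_const c) = fls_const (D c)"
  by (intro fls_eqI) (auto simp: fls_der_nth derivation_0)

lemma fls_der_X: "derivation D \<Longrightarrow> fls_der D e fls_X = fls_const e * fls_X"
  by (intro fls_eqI) (auto simp: fls_der_nth derivation_0 derivation_1)

section \<open>The fields \<open>F\<close> and \<open>K\<close>\<close>

lemma rf_const_simps:
  "rf_const 0 = 0" "rf_const 1 = 1" "rf_const (x * y) = rf_const x * rf_const y"
  "rf_const (- x) = - rf_const x"
  by (simp_all add: rf_const_def Zero_fract_def One_fract_def one_pCons mult.commute)

lemma rf_const_eq_0: "rf_const c = 0 \<longleftrightarrow> c = 0"
  by (simp add: rf_const_def Zero_fract_def eq_fract)

lemma rf_var_neq_0: "rf_var \<noteq> 0"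
  by (simp add: rf_var_def Zero_fract_def eq_fract)

text \<open>Euler derivation with one weight per generator; each weight lies in the field to which
  that generator is adjoined.\<close>

definition F_der :: "rat \<Rightarrow> rat poly fract \<Rightarrow> rat poly fract poly fract \<Rightarrow>
    rat poly fract poly fract poly fract \<Rightarrow> F \<Rightarrow> F" where
  "F_der e1 e2 e3 e4 = rf_der (rf_der (rf_der (rf_der (\<lambda>_. 0) e1) e2) e3) e4"

lemma derivation_zero: "derivation (\<lambda>_. 0)"
  by (simp add: derivation_def)

lemma derivation_F_der: "derivation (F_der e1 e2 e3 e4)"
  unfolding F_der_def by (intro derivation_rf_der derivation_zero)

lemma F_der_gen:
  "F_der e1 e2 e3 e4 F_sab = rf_const (rf_const (rf_const (rf_const e1))) * F_sab"
  "F_der e1 e2 e3 e4 F_b = rf_const (rf_const (rf_const e2)) * F_b"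
  "F_der e1 e2 e3 e4 F_sgd = rf_const (rf_const e3) * F_sgd"
  "F_der e1 e2 e3 e4 F_delta = rf_const e4 * F_delta"
  by (simp_all add: F_der_def F_sab_def F_b_def F_sgd_def F_delta_def rf_der_const rf_der_var
      derivation_rf_der derivation_zero rf_const_simps)

definition K_der :: "rat \<Rightarrow> rat poly fract \<Rightarrow> rat poly fract poly fract \<Rightarrow>
    rat poly fract poly fract poly fract \<Rightarrow> F \<Rightarrow> K \<Rightarrow> K" where
  "K_der e1 e2 e3 e4 e5 = rf_der (F_der e1 e2 e3 e4) e5"

lemma derivation_K_der: "derivation (K_der e1 e2 e3 e4 e5)"
  unfolding K_der_def by (intro derivation_rf_der derivation_F_der)

lemma K_der_gen:
  "K_der e1 e2 e3 e4 e5 K_sab = rf_const (rf_const (rf_const (rf_const (rf_const e1)))) * K_sab"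
  "K_der e1 e2 e3 e4 e5 K_b = rf_const (rf_const (rf_const (rf_const e2))) * K_b"
  "K_der e1 e2 e3 e4 e5 K_scd = rf_const (rf_const (rf_const e3)) * K_scd"
  "K_der e1 e2 e3 e4 e5 K_d = rf_const (rf_const e4) * K_d"
  "K_der e1 e2 e3 e4 e5 K_sq = rf_const e5 * K_sq"
proof -
  note K_gen = K_sab_def K_b_def K_scd_def K_d_def K_sq_def
  note F_gen = F_sab_def F_b_def F_sgd_def F_delta_def
  have K: "K_sab = rf_const F_sab" "K_b = rf_const F_b" "K_scd = rf_const F_sgd" "K_d = rf_const F_delta"
    by (simp_all add: K_gen F_gen)
  show "K_der e1 e2 e3 e4 e5 K_sab = rf_const (rf_const (rf_const (rf_const (rf_const e1)))) * K_sab"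
    "K_der e1 e2 e3 e4 e5 K_b = rf_const (rf_const (rf_const (rf_const e2))) * K_b"
    "K_der e1 e2 e3 e4 e5 K_scd = rf_const (rf_const (rf_const e3)) * K_scd"
    "K_der e1 e2 e3 e4 e5 K_d = rf_const (rf_const e4) * K_d"
    unfolding K_der_def K rf_der_const[OF derivation_F_der] F_der_gen rf_const_simps by (rule refl)+
  show "K_der e1 e2 e3 e4 e5 K_sq = rf_const e5 * K_sq"
    by (simp add: K_der_def K_sq_def rf_der_var derivation_F_der)
qed

lemma F_gen_neq_0: "F_sab \<noteq> 0" "F_b \<noteq> 0" "F_sgd \<noteq> 0" "F_delta \<noteq> 0"
  by (simp_all add: F_sab_def F_b_def F_sgd_def F_delta_def rf_const_eq_0 rf_var_neq_0)

lemma K_gen_neq_0: "K_sab \<noteq> 0" "K_b \<noteq> 0" "K_scd \<noteq> 0" "K_d \<noteq> 0" "K_sq \<noteq> 0"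
  by (simp_all add: K_sab_def K_b_def K_scd_def K_d_def K_sq_def rf_const_eq_0 rf_var_neq_0)

lemma field_hom_K_star: "field_hom K_star"
  unfolding K_star_def
  by (rule K_subst_field_hom(1)[where ?D1.0 = "K_der 1 0 0 0 0" and ?D2.0 = "K_der 0 1 0 0 0"
        and ?D3.0 = "K_der 0 0 1 0 0" and ?D4.0 = "K_der 0 0 0 1 0" and ?D5.0 = "K_der 0 0 0 0 1"])
     (simp_all add: derivation_K_der derivation_inverse K_gen_neq_0 K_der_gen rf_const_simps)

lemma fls_const_neq_0: "c \<noteq> 0 \<Longrightarrow> fls_const c \<noteq> 0"
  by simp

text \<open>The triangular criterion asks the last derivation to kill the images of
  \<open>K_scd\<close> and \<open>K_d\<close>, which contain a factor \<open>fls_X\<close>. Its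
  weights -1 on \<open>F_sgd\<close> and \<open>F_delta\<close> cancel the weight 1 of that
  factor.\<close>

lemma
  shows field_hom_K_emb: "field_hom K_emb"
    and K_emb_sab: "K_emb K_sab = fls_const F_sab" and K_emb_b: "K_emb K_b = fls_const F_b"
    and K_emb_scd: "K_emb K_scd = fls_const F_sgd * fls_X"
    and K_emb_d: "K_emb K_d = fls_const F_delta * fls_X" and K_emb_sq: "K_emb K_sq = fls_X"
  unfolding K_emb_def
  by (rule K_subst_field_hom[where ?D1.0 = "fls_der (F_der 1 0 0 0) 0"
        and ?D2.0 = "fls_der (F_der 0 1 0 0) 0" and ?D3.0 = "fls_der (F_der 0 0 1 0) 0"
        and ?D4.0 = "fls_der (F_der 0 0 0 1) 0" and ?D5.0 = "fls_der (F_der 0 0 (- 1) (- 1)) 1"];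
      simp add: derivation_fls_der derivation_F_der fls_der_const fls_der_X F_gen_neq_0 F_der_gen
        rf_const_simps derivation_mult fls_const_neq_0 del: fls_const_mult_const)+

definition K_c :: K where "K_c = - (K_scd\<^sup>2) / K_d"
definition K_q :: K where "K_q = K_sq\<^sup>2"

lemma K_emb_a: "K_emb K_a = fls_const F_a"
proof -
  have "K_emb K_a = - (fls_const F_sab)\<^sup>2 / fls_const F_b"
    by (simp add: K_a_def field_hom_divide[OF field_hom_K_emb] field_hom_uminus[OF field_hom_K_emb]
        field_hom_power[OF field_hom_K_emb] K_emb_sab K_emb_b)
  also have "\<dots> = fls_const F_a"
    by (simp add: F_a_def power2_eq_square fls_const_mult_const fls_const_divide_const)
  finally show ?thesis .
qed

lemma K_emb_c: "K_emb K_c = fls_const F_gamma * fls_X"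
proof -
  have "K_emb K_c = - (fls_const F_sgd * fls_X)\<^sup>2 / (fls_const F_delta * fls_X)"
    by (simp add: K_c_def field_hom_divide[OF field_hom_K_emb] field_hom_uminus[OF field_hom_K_emb]
        field_hom_power[OF field_hom_K_emb] K_emb_scd K_emb_d)
  also have "\<dots> = fls_X * (- (fls_const F_sgd)\<^sup>2 / fls_const F_delta)"
    by (simp add: power2_eq_square F_gen_neq_0)
  also have "- (fls_const F_sgd)\<^sup>2 / fls_const F_delta = fls_const F_gamma"
    by (simp add: F_gamma_def power2_eq_square fls_const_mult_const fls_const_divide_const)
  finally show ?thesis by (simp add: mult.commute)
qed

lemma K_a_neq_0: "K_a \<noteq> 0" and K_c_neq_0: "K_c \<noteq> 0" and K_q_neq_0: "K_q \<noteq> 0"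
  by (simp_all add: K_a_def K_c_def K_q_def K_gen_neq_0)

text \<open>These keep the denominators nonzero. As a b = -(\<open>K_sab\<close>)^2, the Euler
  derivation of \<open>K_sab\<close> multiplies a b by 2 and kills b, c, d and q; an equation a b y
  = z with y and z killed would give 2 a b y = 0. For c d the derivation of \<open>K_scd\<close>
  plays the same part, and a = b is first multiplied by b.\<close>

lemma K_generic:
  shows "K_a \<noteq> K_b" "K_a * K_b * K_q ^ n \<noteq> 1" "K_a * K_b * K_c * K_d * K_q ^ n \<noteq> 1"
    "K_a * K_b * K_c * K_d \<noteq> K_q" "K_c * K_d \<noteq> K_q"
proof -
  define D where "D = K_der 1 0 0 0 0"
  have D: "derivation D" by (simp add: D_def derivation_K_der)
  have D0: "D K_b = 0" "D K_c = 0" "D K_d = 0" "D (K_q ^ n) = 0" "D K_q = 0" for n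
  proof -
    show "D K_b = 0" "D K_d = 0" by (simp_all add: D_def K_der_gen rf_const_simps)
    have 2: "D (K_scd\<^sup>2) = 0" "D (K_sq\<^sup>2) = 0"
      unfolding power2_eq_square derivation_mult[OF D] by (simp_all add: D_def K_der_gen rf_const_simps)
    then show "D K_c = 0" "D K_q = 0"
      by (auto simp: K_c_def K_q_def derivation_divide_eq_0[OF D] derivation_uminus[OF D] \<open>D K_d = 0\<close>)
    then show "D (K_q ^ n) = 0"
      by (induction n) (auto simp: derivation_1[OF D] derivation_mult[OF D])
  qed
  have Dab: "D (K_a * K_b * y) = 2 * (K_a * K_b * y)" if "D y = 0" for y
  proof -
    have "K_a * K_b * y = - (K_sab * K_sab) * y" by (simp add: K_a_def K_gen_neq_0 power2_eq_square)
    moreover have "D K_sab = K_sab" by (simp add: D_def K_der_gen rf_const_simps)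
    ultimately show ?thesis using that by (simp add: derivation_mult[OF D] derivation_uminus[OF D])
  qed
  have nz: "K_a * K_b * y \<noteq> z" if "D y = 0" "D z = 0" "y \<noteq> 0" for y z
  proof
    assume "K_a * K_b * y = z"
    with Dab[OF that(1)] that show False by (simp add: K_a_neq_0 K_gen_neq_0)
  qed
  show "K_a * K_b * K_q ^ n \<noteq> 1" by (rule nz) (simp_all add: D0 derivation_1[OF D] K_q_neq_0)
  show "K_a * K_b * K_c * K_d * K_q ^ n \<noteq> 1"
    using nz[of "K_c * K_d * K_q ^ n" 1]
    by (simp add: D0 derivation_1[OF D] derivation_mult[OF D] K_q_neq_0 K_c_neq_0 K_gen_neq_0 mult.assoc)
  show "K_a * K_b * K_c * K_d \<noteq> K_q"
    using nz[of "K_c * K_d" K_q]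
    by (simp add: D0 derivation_1[OF D] derivation_mult[OF D] K_c_neq_0 K_gen_neq_0 mult.assoc)
  show "K_a \<noteq> K_b"
    using nz[of 1 "K_b * K_b"] by (auto simp: D0 derivation_1[OF D] derivation_mult[OF D])
  define D' where "D' = K_der 0 0 1 0 0"
  have D': "derivation D'" by (simp add: D'_def derivation_K_der)
  show "K_c * K_d \<noteq> K_q"
  proof
    assume "K_c * K_d = K_q"
    then have "D' (- (K_scd * K_scd)) = D' (K_sq * K_sq)"
      by (simp add: K_c_def K_q_def K_gen_neq_0 power2_eq_square)
    then have "2 * (K_scd * K_scd) = 0"
      by (simp add: derivation_mult[OF D'] derivation_uminus[OF D'])
         (simp add: D'_def K_der_gen rf_const_simps)
    then show False by (simp add: K_gen_neq_0)
  qed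
qed

section \<open>The weight\<close>

definition cf :: "uv_series \<Rightarrow> nat \<Rightarrow> nat \<Rightarrow> F" where
  "cf X i j = fps_nth (fps_nth X j) i"

definition mono_uv :: "F \<Rightarrow> nat \<Rightarrow> nat \<Rightarrow> uv_series" where
  "mono_uv c i j = uv_const c * uv_u ^ i * uv_v ^ j"

lemma uv_eqI: "(\<And>i j. cf X i j = cf Y i j) \<Longrightarrow> X = Y"
  by (simp add: cf_def fps_eq_iff)

lemma cf_diff: "cf (X - Y) i j = cf X i j - cf Y i j"
  by (simp add: cf_def)

lemma cf_mult: "cf (X * Y) i j = (\<Sum>b\<le>j. \<Sum>a\<le>i. cf X a b * cf Y (i - a) (j - b))"
  by (simp add: cf_def fps_mult_nth fps_sum_nth atMost_atLeast0)

lemma cf_mono: "cf (mono_uv c i j) i' j' = (if i' = i \<and> j' = j then c else 0)"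
  by (simp add: cf_def mono_uv_def uv_const_def uv_u_def uv_v_def fps_const_power
      fps_X_power_nth fps_mult_left_const_nth mult.assoc)

lemma mono_mult: "mono_uv c i j * mono_uv d k l = mono_uv (c * d) (i + k) (j + l)"
  by (simp add: mono_uv_def uv_const_def power_add algebra_simps)

lemma mono_1: "mono_uv 1 0 0 = 1"
  by (simp add: mono_uv_def uv_const_def)

lemma cf_1: "cf 1 i j = (if i = 0 \<and> j = 0 then 1 else 0)"
  using cf_mono[of 1 0 0 i j] by (simp add: mono_1)

lemma cf_mono_mult:
  "cf (mono_uv c i j * X) i' j' = (if i \<le> i' \<and> j \<le> j' then c * cf X (i' - i) (j' - j) else 0)"
proof -
  have "cf (mono_uv c i j * X) i' j' =
    (\<Sum>b\<le>j'. \<Sum>a\<le>i'. if b = j then (if a = i then c * cf X (i' - a) (j' - b) else 0) else 0)"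
    unfolding cf_mult cf_mono by (intro sum.cong) auto
  also have "\<dots> = (\<Sum>b\<le>j'. if b = j then (\<Sum>a\<le>i'. if a = i then c * cf X (i' - a) (j' - b) else 0) else 0)"
    by (intro sum.cong) auto
  also have "\<dots> = (if i \<le> i' \<and> j \<le> j' then c * cf X (i' - i) (j' - j) else 0)"
    by auto
  finally show ?thesis .
qed

section \<open>The q-shifted factorials as infinite products\<close>

definition qpoch_fin :: "nat \<Rightarrow> F \<Rightarrow> nat \<Rightarrow> nat \<Rightarrow> uv_series" where
  "qpoch_fin N c i j = (\<Prod>k<N. 1 - mono_uv c (i + 2 * k) (j + 2 * k))"

text \<open>As q^(1/2) = u v, each power of q raises both exponents by 2.\<close>

lemma uv_q_power: "uv_q ^ k = mono_uv 1 (2 * k) (2 * k)"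
  by (simp add: uv_q_def uv_sq_def mono_uv_def uv_const_def power_mult_distrib flip: power_mult)

lemma mono_uv_q: "mono_uv c i j * uv_q ^ k = mono_uv c (i + 2 * k) (j + 2 * k)"
  by (simp add: uv_q_power mono_mult)

lemma cf_diff_mono_mult:
  "cf ((1 - mono_uv c i j) * X) i' j' =
     cf X i' j' - (if i \<le> i' \<and> j \<le> j' then c * cf X (i' - i) (j' - j) else 0)"
  by (simp add: left_diff_distrib cf_diff cf_mono_mult)

text \<open>The factor of index M subtracts a monomial whose v-exponent is at least 2 M > j', hence
  it leaves the coefficients of v^j' unchanged.\<close>

lemma qpoch_fin_stable:
  assumes "N > j'" "M \<ge> N"
  shows "cf (qpoch_fin M c i j) i' j' = cf (qpoch_fin N c i j) i' j'"
  using assms(2)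
proof (induction M rule: dec_induct)
  case (step M)
  have "qpoch_fin (Suc M) c i j = (1 - mono_uv c (i + 2 * M) (j + 2 * M)) * qpoch_fin M c i j"
    by (simp add: qpoch_fin_def)
  with step assms show ?case by (simp add: cf_diff_mono_mult)
qed simp

lemma qpoch_fin_Suc:
  "qpoch_fin (Suc N) c i j = (1 - mono_uv c i j) * qpoch_fin N c (i + 2) (j + 2)"
  unfolding qpoch_fin_def prod.lessThan_Suc_shift by (simp add: o_def)

lemma cf_qpoch_fin_0:
  assumes "i > 0 \<or> j > 0"
  shows "cf (qpoch_fin N c i j) 0 0 = 1"
  using assms by (induction N arbitrary: i j)
    (auto simp: qpoch_fin_Suc cf_diff_mono_mult cf_1 qpoch_fin_def[of 0])

text \<open>The infinite product is nonzero, as required by the convergence notion behind \<open>prodinf\<close>.\<close>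

lemma cf_qpoch_inf:
  assumes ij: "i > 0 \<or> j > 0" and N: "N > j'"
  shows "cf (qpoch_inf (mono_uv c i j)) i' j' = cf (qpoch_fin N c i j) i' j'"
proof -
  let ?f = "\<lambda>k. 1 - mono_uv c i j * uv_q ^ k"
  \<comment> \<open>The limit is read off diagonally: its coefficient of v^n comes from the product
    of n + 1 factors, which is already stable there.\<close>
  define P :: uv_series where "P = Abs_fps (\<lambda>n. fps_nth (qpoch_fin (Suc n) c i j) n)"
  have P: "cf P i' j' = cf (qpoch_fin N c i j) i' j'" if "N > j'" for N i' j'
    using qpoch_fin_stable[of j' "Suc j'" N c i j i'] that by (simp add: P_def cf_def)
  have "(\<lambda>n. \<Prod>k\<le>n. ?f k) \<longlonglongrightarrow> P"
  proof (rule tendsto_fpsI)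
    fix n
    have "fps_nth (\<Prod>k\<le>m. ?f k) n = fps_nth P n" if "m \<ge> n" for m
    proof (rule fps_ext)
      fix i'
      have "(\<Prod>k\<le>m. ?f k) = qpoch_fin (Suc m) c i j"
        by (simp add: qpoch_fin_def mono_uv_q lessThan_Suc_atMost)
      then show "fps_nth (fps_nth (\<Prod>k\<le>m. ?f k) n) i' = fps_nth (fps_nth P n) i'"
        using P[of n "Suc m" i'] that by (simp add: cf_def)
    qed
    then show "\<forall>\<^sub>F m in sequentially. fps_nth (\<Prod>k\<le>m. ?f k) n = fps_nth P n"
      unfolding eventually_sequentially by blast
  qed
  moreover have "P \<noteq> 0"
    using P[of 0 1 0] cf_qpoch_fin_0[OF ij, of 1 c] by (auto simp: cf_def)
  ultimately have "?f has_prod P"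
    by (simp add: has_prod_def raw_has_prod_def)
  then have "qpoch_inf (mono_uv c i j) = P"
    unfolding qpoch_inf_def by (rule has_prod_unique[symmetric])
  with P[OF N] show ?thesis by simp
qed

definition qpoch :: "F \<Rightarrow> nat \<Rightarrow> nat \<Rightarrow> uv_series" where
  "qpoch c i j = qpoch_inf (mono_uv c i j)"

lemma cf_qpoch_0: "i > 0 \<or> j > 0 \<Longrightarrow> cf (qpoch c i j) 0 0 = 1"
  unfolding qpoch_def by (subst cf_qpoch_inf[of i j 0 1]) (simp_all add: cf_qpoch_fin_0)

lemma qpoch_rec:
  assumes "i > 0 \<or> j > 0"
  shows "qpoch c i j = (1 - mono_uv c i j) * qpoch c (i + 2) (j + 2)"
proof (rule uv_eqI)
  fix i' j'
  have "cf (qpoch c i j) i' j' = cf ((1 - mono_uv c i j) * qpoch_fin (Suc j') c (i + 2) (j + 2)) i' j'"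
    unfolding qpoch_def qpoch_fin_Suc[symmetric] using assms by (subst cf_qpoch_inf[of _ _ _ "Suc (Suc j')"]) auto
  also have "\<dots> = cf ((1 - mono_uv c i j) * qpoch c (i + 2) (j + 2)) i' j'"
    unfolding cf_diff_mono_mult qpoch_def by (simp add: cf_qpoch_inf[of _ _ _ "Suc j'"] split: if_splits)
  finally show "cf (qpoch c i j) i' j' = cf ((1 - mono_uv c i j) * qpoch c (i + 2) (j + 2)) i' j'" .
qed

section \<open>Exchanging u and v: the substitution z -> q^(1/2)/z\<close>

definition swap_uv :: "uv_series \<Rightarrow> uv_series" where
  "swap_uv X = Abs_fps (\<lambda>j. Abs_fps (\<lambda>i. cf X j i))"

lemma cf_swap: "cf (swap_uv X) i j = cf X j i"
  by (simp add: swap_uv_def cf_def)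

lemma swap_mult: "swap_uv (X * Y) = swap_uv X * swap_uv Y"
  by (rule uv_eqI) (simp only: cf_swap cf_mult, rule sum.swap)

lemma swap_1: "swap_uv 1 = 1"
  by (rule uv_eqI) (auto simp: cf_swap cf_1)

lemma swap_diff_mono: "swap_uv (1 - mono_uv c i j) = 1 - mono_uv c j i"
  by (rule uv_eqI) (auto simp: cf_swap cf_1 cf_diff cf_mono)

lemma swap_qpoch_fin: "swap_uv (qpoch_fin N c i j) = qpoch_fin N c j i"
  by (induction N arbitrary: i j) (simp_all add: qpoch_fin_Suc swap_mult swap_diff_mono swap_1 qpoch_fin_def[of 0])

lemma swap_qpoch: "i > 0 \<or> j > 0 \<Longrightarrow> swap_uv (qpoch c i j) = qpoch c j i"
proof (rule uv_eqI)
  fix i' j' assume ij: "i > 0 \<or> j > 0"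
  define N where "N = Suc (max i' j')"
  have "cf (swap_uv (qpoch c i j)) i' j' = cf (qpoch_fin N c i j) j' i'"
    unfolding cf_swap qpoch_def using ij by (intro cf_qpoch_inf) (auto simp: N_def)
  also have "\<dots> = cf (qpoch_fin N c j i) i' j'"
    by (metis cf_swap swap_qpoch_fin)
  also have "\<dots> = cf (qpoch c j i) i' j'"
    unfolding qpoch_def using ij by (intro cf_qpoch_inf[symmetric]) (auto simp: N_def)
  finally show "cf (swap_uv (qpoch c i j)) i' j' = cf (qpoch c j i) i' j'" .
qed

text \<open>
  The reflection \<open>z \<mapsto> 1/z\<close> fixes \<open>q\<^sup>1\<^sup>/\<^sup>2 = u v\<close> and exchanges \<open>v\<close> with \<open>u\<^sup>2 v\<close>. It is defined on
  the series in the monomials \<open>u\<^sup>i v\<^sup>j\<close> with \<open>i \<le> 2 j\<close>, and it is multiplicative there.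
\<close>

definition refl_dom :: "uv_series \<Rightarrow> bool" where
  "refl_dom X \<longleftrightarrow> (\<forall>i j. i > 2 * j \<longrightarrow> cf X i j = 0)"

definition refl_uv :: "uv_series \<Rightarrow> uv_series" where
  "refl_uv X = Abs_fps (\<lambda>j. Abs_fps (\<lambda>i. if i \<le> 2 * j then cf X (2 * j - i) j else 0))"

lemma cf_refl: "cf (refl_uv X) i j = (if i \<le> 2 * j then cf X (2 * j - i) j else 0)"
  by (simp add: refl_uv_def cf_def)

lemma refl_dom_mult:
  assumes "refl_dom X" "refl_dom Y"
  shows "refl_dom (X * Y)"
  unfolding refl_dom_def
proof (intro allI impI)
  fix i j :: nat assume ij: "i > 2 * j"
  have "cf X a b * cf Y (i - a) (j - b) = 0" if "b \<le> j" for a b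
    using assms that ij by (cases "a > 2 * b") (auto simp: refl_dom_def)
  then show "cf (X * Y) i j = 0" unfolding cf_mult by (intro sum.neutral ballI) auto
qed

text \<open>The exponent map (i, j) -> (2 j - i, j) is additive, so it respects convolution;
  \<open>refl_dom\<close> discards exactly the terms whose new exponent would be negative. The
  substitution in the inner sum is a -> 2 b - a.\<close>

lemma refl_mult:
  assumes X: "refl_dom X" and Y: "refl_dom Y"
  shows "refl_uv (X * Y) = refl_uv X * refl_uv Y"
proof (rule uv_eqI)
  fix i j
  show "cf (refl_uv (X * Y)) i j = cf (refl_uv X * refl_uv Y) i j"
  proof (cases "i \<le> 2 * j")
    case False
    have "refl_dom (refl_uv X)" "refl_dom (refl_uv Y)" by (auto simp: refl_dom_def cf_refl)
    then show ?thesis using refl_dom_mult False by (auto simp: refl_dom_def cf_refl)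
  next
    case True
    have inner: "(\<Sum>a\<le>2 * j - i. cf X a b * cf Y (2 * j - i - a) (j - b)) =
          (\<Sum>a\<le>i. cf (refl_uv X) a b * cf (refl_uv Y) (i - a) (j - b))" if b: "b \<le> j" for b
    proof -
      let ?S = "{a. a \<le> 2 * j - i \<and> a \<le> 2 * b \<and> 2 * b - a \<le> i}"
      let ?T = "{a. a \<le> i \<and> a \<le> 2 * b \<and> i - a \<le> 2 * (j - b)}"
      have "(\<Sum>a\<le>2 * j - i. cf X a b * cf Y (2 * j - i - a) (j - b)) =
            (\<Sum>a\<in>?S. cf X a b * cf Y (2 * j - i - a) (j - b))"
      proof (intro sum.mono_neutral_right ballI)
        fix a assume a: "a \<in> {..2 * j - i} - ?S"
        then have "a > 2 * b \<or> 2 * j - i - a > 2 * (j - b)" using b True by auto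
        with X Y show "cf X a b * cf Y (2 * j - i - a) (j - b) = 0" by (auto simp: refl_dom_def)
      qed auto
      also have "\<dots> = (\<Sum>a\<in>?T. cf (refl_uv X) a b * cf (refl_uv Y) (i - a) (j - b))"
      proof (rule sum.reindex_bij_witness[where i = "\<lambda>a. 2 * b - a" and j = "\<lambda>a. 2 * b - a"])
        fix a assume a: "a \<in> ?S"
        then have "2 * (j - b) - (i - (2 * b - a)) = 2 * j - i - a" "i - (2 * b - a) \<le> 2 * (j - b)"
          using b True by auto
        with a b show "cf (refl_uv X) (2 * b - a) b * cf (refl_uv Y) (i - (2 * b - a)) (j - b) =
            cf X a b * cf Y (2 * j - i - a) (j - b)"
          by (auto simp: cf_refl)
      qed (use b True in auto)
      also have "\<dots> = (\<Sum>a\<le>i. cf (refl_uv X) a b * cf (refl_uv Y) (i - a) (j - b))"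
        by (intro sum.mono_neutral_left) (auto simp: cf_refl)
      finally show ?thesis .
    qed
    have "(\<Sum>b\<le>j. \<Sum>a\<le>2 * j - i. cf X a b * cf Y (2 * j - i - a) (j - b)) =
          (\<Sum>b\<le>j. \<Sum>a\<le>i. cf (refl_uv X) a b * cf (refl_uv Y) (i - a) (j - b))"
      by (rule sum.cong[OF refl], rule inner) simp
    then show ?thesis using True by (simp add: cf_refl[of "X * Y"] cf_mult)
  qed
qed

lemma refl_1: "refl_uv 1 = 1"
  by (rule uv_eqI) (auto simp: cf_refl cf_1)

lemma refl_dom_1: "refl_dom 1"
  by (auto simp: refl_dom_def cf_1)

lemma refl_diff_mono: "i \<le> 2 * j \<Longrightarrow> refl_uv (1 - mono_uv c i j) = 1 - mono_uv c (2 * j - i) j"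
  by (rule uv_eqI) (auto simp: cf_refl cf_1 cf_diff cf_mono)

lemma refl_dom_diff_mono: "i \<le> 2 * j \<Longrightarrow> refl_dom (1 - mono_uv c i j)"
  by (auto simp: refl_dom_def cf_1 cf_diff cf_mono)

lemma refl_dom_qpoch_fin: "i \<le> 2 * j \<Longrightarrow> refl_dom (qpoch_fin N c i j)"
  by (induction N arbitrary: i j)
     (simp_all add: qpoch_fin_Suc refl_dom_mult refl_dom_diff_mono refl_dom_1 qpoch_fin_def[of 0])

lemma refl_qpoch_fin: "i \<le> 2 * j \<Longrightarrow> refl_uv (qpoch_fin N c i j) = qpoch_fin N c (2 * j - i) j"
proof (induction N arbitrary: i j)
  case (Suc N)
  have e: "2 * (j + 2) - (i + 2) = (2 * j - i) + 2" and le: "i + 2 \<le> 2 * (j + 2)"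
    using Suc.prems by auto
  show ?case
    unfolding qpoch_fin_Suc refl_mult[OF refl_dom_diff_mono[OF Suc.prems] refl_dom_qpoch_fin[OF le]]
      refl_diff_mono[OF Suc.prems] Suc.IH[OF le] e ..
qed (simp add: refl_1 qpoch_fin_def[of 0])

lemma refl_dom_qpoch: "i \<le> 2 * j \<Longrightarrow> j > 0 \<Longrightarrow> refl_dom (qpoch c i j)"
  unfolding refl_dom_def qpoch_def
  by (metis cf_qpoch_inf lessI refl_dom_def refl_dom_qpoch_fin)

lemma refl_qpoch: "i \<le> 2 * j \<Longrightarrow> j > 0 \<Longrightarrow> refl_uv (qpoch c i j) = qpoch c (2 * j - i) j"
proof (rule uv_eqI)
  fix i' j' assume ij: "i \<le> 2 * j" "j > 0"
  have "cf (refl_uv (qpoch c i j)) i' j' = cf (refl_uv (qpoch_fin (Suc j') c i j)) i' j'"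
    unfolding cf_refl qpoch_def using ij by (simp add: cf_qpoch_inf[of _ _ _ "Suc j'"])
  also have "\<dots> = cf (qpoch c (2 * j - i) j) i' j'"
    unfolding qpoch_def using ij by (simp add: refl_qpoch_fin cf_qpoch_inf[of _ _ _ "Suc j'"])
  finally show "cf (refl_uv (qpoch c i j)) i' j' = cf (qpoch c (2 * j - i) j) i' j'" .
qed

lemma cf_mult_0: "cf (X * Y) 0 0 = cf X 0 0 * cf Y 0 0"
  by (simp add: cf_def)

lemma uv_inverse: "cf X 0 0 = 1 \<Longrightarrow> X * inverse X = 1"
proof -
  assume "cf X 0 0 = 1"
  then have "fps_nth X 0 * inverse (fps_nth X 0) = 1"
    by (intro inverse_mult_eq_1') (simp add: cf_def)
  then show ?thesis unfolding fps_inverse_def by (rule fps_right_inverse)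
qed

text \<open>Induction on j: in the coefficient of X Y at i > 2 j every term vanishes, by the domain
  of X or by the induction hypothesis, except the one with the constant coefficient 1 of X.\<close>

lemma refl_dom_inverse:
  assumes X: "refl_dom X" and XY: "X * Y = 1" and X0: "cf X 0 0 = 1"
  shows "refl_dom Y"
proof -
  have "cf Y i j = 0" if "i > 2 * j" for i j
    using that
  proof (induction j arbitrary: i rule: less_induct)
    case (less j)
    have "0 = cf (X * Y) i j" using less.prems by (simp add: XY cf_1)
    also have "\<dots> = (\<Sum>b\<le>j. \<Sum>a\<le>i. if b = 0 \<and> a = 0 then cf Y i j else 0)"
      unfolding cf_mult
    proof (intro sum.cong refl)
      fix a b assume "b \<in> {..j}" "a \<in> {..i}"
      then show "cf X a b * cf Y (i - a) (j - b) = (if b = 0 \<and> a = 0 then cf Y i j else 0)"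
        using X less X0 by (cases "a > 2 * b"; cases "b = 0") (auto simp: refl_dom_def)
    qed
    also have "\<dots> = (\<Sum>b\<le>j. if b = 0 then (\<Sum>a\<le>i. if a = 0 then cf Y i j else 0) else 0)"
      by (intro sum.cong) auto
    also have "\<dots> = cf Y i j" by simp
    finally show ?case by simp
  qed
  then show ?thesis by (simp add: refl_dom_def)
qed

section \<open>The weight and its two symmetries\<close>

definition den_ab :: "F \<Rightarrow> nat \<Rightarrow> uv_series" where
  "den_ab a h = qpoch a (2 * h + 1) (2 * h) * qpoch a (2 * h + 1) (2 * h + 2)"

definition den_cd :: "F \<Rightarrow> uv_series" where
  "den_cd c = qpoch c 2 1 * qpoch c 0 1"

text \<open>In terms of z, \<open>den_ab a h\<close> is (a q^h z, a q^(h+1)/z; q) and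
  \<open>den_cd c\<close> is (c q^(1/2) z, c q^(1/2)/z; q). The shifts sit on the first two
  parameters, where the labels k + \<epsilon>1, k + \<epsilon>2 and k + \<epsilon>1 + \<epsilon>2
  differ from k.\<close>

definition wt :: "F \<Rightarrow> nat \<Rightarrow> F \<Rightarrow> nat \<Rightarrow> F \<Rightarrow> F \<Rightarrow> uv_series" where
  "wt a h b h' c d = qpoch 1 2 0 * qpoch 1 0 2 * inverse (den_ab a h * den_ab b h' * den_cd c * den_cd d)"

lemma weight_uv_eq_wt:
  fixes h :: "nat ^ 4"
  assumes "vec_nth h 3 = 0" "vec_nth h 4 = 0"
  shows "weight_uv h = wt F_a (vec_nth h 1) F_b (vec_nth h 2) F_gamma F_delta"
proof -
  have m: "uv_const c * uv_q ^ k * uv_u = mono_uv c (2 * k + 1) (2 * k)"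
    "uv_const c * uv_q ^ k * uv_sq * uv_v = mono_uv c (2 * k + 1) (2 * k + 2)"
    "uv_const c * uv_q ^ 0 * uv_sq * uv_u = mono_uv c 2 1"
    "uv_const c * uv_q ^ 0 * uv_v = mono_uv c 0 1"
    "uv_u\<^sup>2 = mono_uv 1 2 0" "uv_v\<^sup>2 = mono_uv 1 0 2" for c k
    by (simp_all add: uv_q_power mono_uv_def uv_const_def uv_sq_def power_add power2_eq_square mult_ac)
  show ?thesis
    unfolding weight_uv_def Let_def assms wt_def den_ab_def den_cd_def qpoch_def m
    by (simp only: mult_ac)
qed

lemma cf_den_0: "cf (den_ab a h) 0 0 = 1" "cf (den_cd c) 0 0 = 1"
  by (simp_all add: den_ab_def den_cd_def cf_mult_0 cf_qpoch_0)

text \<open>The form in which weights are compared: multiplied by their denominators, which have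
  constant coefficient 1 and can be cancelled.\<close>

lemma wt_mult_den: "wt a h b h' c d * (den_ab a h * den_ab b h' * den_cd c * den_cd d) = qpoch 1 2 0 * qpoch 1 0 2"
  unfolding wt_def
  using uv_inverse[of "den_ab a h * den_ab b h' * den_cd c * den_cd d"]
  by (simp add: cf_mult_0 cf_den_0 mult_ac)

lemma uv_mult_right_cancel:
  assumes "X * Z = Y * Z" "cf Z 0 0 = 1"
  shows "X = Y"
proof -
  have "Z \<noteq> 0" using assms(2) by (auto simp: cf_def)
  with assms(1) show ?thesis by simp
qed

lemma cf_wt_0: "cf (wt a h b h' c d) 0 0 = 1"
  using arg_cong[OF wt_mult_den[of a h b h' c d], of "\<lambda>X. cf X 0 0"]
  by (simp add: cf_mult_0 cf_den_0 cf_qpoch_0)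

lemma wt_commute: "wt a h b h' c d = wt b h' a h c d"
  by (simp add: wt_def mult_ac)

lemma wt_Suc:
  "wt a (Suc h) b h' c d =
     (1 - mono_uv a (2 * h + 1) (2 * h)) * ((1 - mono_uv a (2 * h + 1) (2 * h + 2)) * wt a h b h' c d)"
proof (rule uv_mult_right_cancel[where Z = "den_ab a (Suc h) * den_ab b h' * den_cd c * den_cd d"])
  have "den_ab a h = (1 - mono_uv a (2 * h + 1) (2 * h)) * (1 - mono_uv a (2 * h + 1) (2 * h + 2)) *
      den_ab a (Suc h)"
    unfolding den_ab_def by (subst (1 2) qpoch_rec) (simp_all add: mult_ac)
  then have "(1 - mono_uv a (2 * h + 1) (2 * h)) * ((1 - mono_uv a (2 * h + 1) (2 * h + 2)) * wt a h b h' c d) *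
       (den_ab a (Suc h) * den_ab b h' * den_cd c * den_cd d) =
     wt a h b h' c d * (den_ab a h * den_ab b h' * den_cd c * den_cd d)"
    by (simp only: mult_ac)
  then show "wt a (Suc h) b h' c d * (den_ab a (Suc h) * den_ab b h' * den_cd c * den_cd d) =
     (1 - mono_uv a (2 * h + 1) (2 * h)) * ((1 - mono_uv a (2 * h + 1) (2 * h + 2)) * wt a h b h' c d) *
       (den_ab a (Suc h) * den_ab b h' * den_cd c * den_cd d)"
    unfolding wt_mult_den by (rule sym)
qed (simp add: cf_mult_0 cf_den_0)

text \<open>The exchange of u and v turns \<open>den_ab x 0\<close> into \<open>den_cd x\<close> and
  permutes the two factors of the numerator.\<close>

lemma swap_wt: "swap_uv (wt a 0 b 0 c d) = wt c 0 d 0 a b"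
proof (rule uv_mult_right_cancel[where Z = "den_ab c 0 * den_ab d 0 * den_cd a * den_cd b"])
  have sw: "swap_uv (den_ab x 0) = den_cd x" "swap_uv (den_cd x) = den_ab x 0" for x
    by (simp_all add: den_ab_def den_cd_def swap_mult swap_qpoch mult_ac numeral_2_eq_2)
  have "swap_uv (wt a 0 b 0 c d) * (den_ab c 0 * den_ab d 0 * den_cd a * den_cd b) =
    swap_uv (wt a 0 b 0 c d * (den_ab a 0 * den_ab b 0 * den_cd c * den_cd d))"
    by (simp only: swap_mult sw mult_ac)
  also have "\<dots> = qpoch 1 2 0 * qpoch 1 0 2"
    unfolding wt_mult_den by (simp add: swap_mult swap_qpoch mult.commute)
  finally show "swap_uv (wt a 0 b 0 c d) * (den_ab c 0 * den_ab d 0 * den_cd a * den_cd b) =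
    wt c 0 d 0 a b * (den_ab c 0 * den_ab d 0 * den_cd a * den_cd b)"
    unfolding wt_mult_den .
qed (simp add: cf_mult_0 cf_den_0)

text \<open>The monomial z = u has no reflection in nonnegative powers of u and v, so the factors 1
  - a z, 1 - b z and 1 - z^2 are split off. The others fall into pairs such as (a q z, a q/z), (c z,
  c/z) and (q z^2, q/z^2), inside \<open>refl_dom\<close> and exchanged by the reflection.\<close>

lemma wt_symmetric_part:
  obtains S where "(1 - mono_uv a 1 0) * ((1 - mono_uv b 1 0) * wt a 0 b 0 c d) = (1 - mono_uv 1 2 0) * S"
    "refl_dom S" "refl_uv S = S"
proof -
  define E where "E = qpoch a 3 2 * qpoch a 1 2 * (qpoch b 3 2 * qpoch b 1 2) * (qpoch c 2 1 * qpoch c 0 1) * (qpoch d 2 1 * qpoch d 0 1)"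
  define S where "S = qpoch 1 4 2 * qpoch 1 0 2 * inverse E"
  have E0: "cf E 0 0 = 1" by (simp add: E_def cf_mult_0 cf_qpoch_0)
  have EE: "E * inverse E = 1" by (rule uv_inverse) (rule E0)
  have gE: "refl_dom E" by (simp add: E_def refl_dom_mult refl_dom_qpoch)
  have gI: "refl_dom (inverse E)" by (rule refl_dom_inverse[OF gE EE E0])
  have rE: "refl_uv E = E"
    by (simp add: E_def refl_mult refl_dom_mult refl_dom_qpoch refl_qpoch mult_ac)
  have "refl_uv E * refl_uv (inverse E) = 1"
    by (simp add: refl_1 EE flip: refl_mult[OF gE gI])
  with EE have "refl_uv (inverse E) * E = inverse E * E" by (simp add: rE mult_ac)
  then have rI: "refl_uv (inverse E) = inverse E" by (rule uv_mult_right_cancel) (rule E0)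
  have gS: "refl_dom S" by (simp add: S_def refl_dom_mult refl_dom_qpoch gI)
  have rS: "refl_uv S = S"
    by (simp add: S_def refl_mult refl_dom_mult refl_dom_qpoch refl_qpoch gI rI mult_ac)
  have den: "den_ab x 0 = (1 - mono_uv x 1 0) * (qpoch x 3 2 * qpoch x 1 2)" for x
    unfolding den_ab_def by (subst qpoch_rec) (simp_all add: mult_ac numeral_2_eq_2 numeral_3_eq_3)
  have num: "qpoch 1 2 0 = (1 - mono_uv 1 2 0) * qpoch 1 4 2"
    using qpoch_rec[of 2 0 1] by (simp add: eval_nat_numeral)
  have "(1 - mono_uv a 1 0) * ((1 - mono_uv b 1 0) * wt a 0 b 0 c d) * E =
      wt a 0 b 0 c d * (den_ab a 0 * den_ab b 0 * den_cd c * den_cd d)"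
    unfolding den den_cd_def E_def by (simp only: mult_ac)
  also have "\<dots> = (1 - mono_uv 1 2 0) * qpoch 1 4 2 * qpoch 1 0 2" unfolding wt_mult_den num ..
  also have "\<dots> = (1 - mono_uv 1 2 0) * qpoch 1 4 2 * qpoch 1 0 2 * (E * inverse E)"
    unfolding EE by simp
  also have "\<dots> = (1 - mono_uv 1 2 0) * S * E"
    by (simp only: S_def mult_ac)
  finally have "(1 - mono_uv a 1 0) * ((1 - mono_uv b 1 0) * wt a 0 b 0 c d) = (1 - mono_uv 1 2 0) * S"
    using E0 by (rule uv_mult_right_cancel)
  with gS rS that show thesis by blast
qed

section \<open>Coefficients of z^n as Laurent series in q^(1/2)\<close>

definition zcoeff :: "uv_series \<Rightarrow> int \<Rightarrow> F fls" where
  "zcoeff X n = fps_to_fls (Abs_fps (\<lambda>j. if 0 \<le> n + int j then cf X (nat (n + int j)) j else 0))"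

lemma weight_coeff_eq: "weight_coeff h n = zcoeff (weight_uv h) n"
  unfolding weight_coeff_def zcoeff_def cf_def ..

lemma zcoeff_nth:
  "fls_nth (zcoeff X n) k = (if 0 \<le> k \<and> 0 \<le> n + k then cf X (nat (n + k)) (nat k) else 0)"
  by (simp add: zcoeff_def)

lemma zcoeff_diff: "zcoeff (X - Y) n = zcoeff X n - zcoeff Y n"
  by (rule fls_eqI) (simp add: zcoeff_nth cf_diff)

lemma zcoeff_mono_mult:
  "zcoeff (mono_uv c i j * X) n = fls_const c * fls_X ^ j * zcoeff X (n - int i + int j)"
proof (rule fls_eqI)
  fix k
  have "fls_nth (fls_const c * fls_X ^ j * zcoeff X (n - int i + int j)) k =
      c * fls_nth (zcoeff X (n - int i + int j)) (k - int j)"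
    unfolding mult.assoc fls_X_power_times_conv_shift(1) by simp
  also have "\<dots> = fls_nth (zcoeff (mono_uv c i j * X) n) k"
  proof (cases "int j \<le> k \<and> int i \<le> n + k")
    case True
    then have "nat (n - int i + int j + (k - int j)) = nat (n + k) - i" "nat (k - int j) = nat k - j"
      "i \<le> nat (n + k)" "j \<le> nat k" by auto
    with True show ?thesis by (simp add: zcoeff_nth cf_mono_mult)
  next
    case False
    then show ?thesis by (auto simp: zcoeff_nth cf_mono_mult)
  qed
  finally show "fls_nth (zcoeff (mono_uv c i j * X) n) k =
      fls_nth (fls_const c * fls_X ^ j * zcoeff X (n - int i + int j)) k" by simp
qed

lemma zcoeff_diff_mono_mult:
  "zcoeff ((1 - mono_uv c i j) * X) n = zcoeff X n - fls_const c * fls_X ^ j * zcoeff X (n - int i + int j)"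
  by (simp add: left_diff_distrib zcoeff_diff zcoeff_mono_mult)

lemma zcoeff_refl:
  assumes "refl_dom X" "refl_uv X = X"
  shows "zcoeff X (- n) = zcoeff X n"
proof (rule fls_eqI)
  fix k
  have r: "cf X i j = cf X (2 * j - i) j" if "i \<le> 2 * j" for i j
    using that cf_refl[of X i j] assms(2) by simp
  have z: "cf X i j = 0" if "i > 2 * j" for i j
    using assms(1) that by (auto simp: refl_dom_def)
  consider "k < 0" | "k \<ge> 0" "k < n" | "k \<ge> 0" "k < - n" | "k \<ge> 0" "n \<le> k" "- n \<le> k" by linarith
  then show "fls_nth (zcoeff X (- n)) k = fls_nth (zcoeff X n) k"
  proof cases
    case 4
    then have "2 * nat k - nat (- n + k) = nat (n + k)" "nat (- n + k) \<le> 2 * nat k" by auto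
    with 4 r[of "nat (- n + k)" "nat k"] show ?thesis by (simp add: zcoeff_nth)
  qed (auto simp: zcoeff_nth z)
qed

lemma zcoeff_swap: "zcoeff (swap_uv X) n = fls_X_intpow (- n) * zcoeff X (- n)"
  unfolding fls_X_intpow_times_conv_shift(1)
  by (rule fls_eqI) (auto simp: zcoeff_nth cf_swap add.commute)

text \<open>\<open>(1 - a z) (1 - b z) \<Delta> = (1 - z\<^sup>2) S\<close> with \<open>S\<close> invariant under \<open>z \<mapsto> 1/z\<close>.\<close>

lemma wt_antisymmetric:
  fixes a b c d :: F and n :: int
  defines "w \<equiv> zcoeff (wt a 0 b 0 c d)"
    and "\<alpha> \<equiv> fls_const a" and "\<beta> \<equiv> fls_const b"
  shows "w (1 - n) - (\<alpha> + \<beta>) * w (- n) + \<alpha> * \<beta> * w (- 1 - n) =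
       - (w (1 + n) - (\<alpha> + \<beta>) * w n + \<alpha> * \<beta> * w (n - 1))"
proof -
  obtain S where S: "(1 - mono_uv a 1 0) * ((1 - mono_uv b 1 0) * wt a 0 b 0 c d) = (1 - mono_uv 1 2 0) * S"
    "refl_dom S" "refl_uv S = S" by (rule wt_symmetric_part)
  \<comment> \<open>The coefficient of z^m in (1 - z^2) S; it is odd about m = 1 because the
    coefficients of S are even.\<close>
  let ?t = "\<lambda>m. w m - (\<alpha> + \<beta>) * w (m - 1) + \<alpha> * \<beta> * w (m - 2)"
  have t: "?t m = zcoeff S m - zcoeff S (m - 2)" for m
  proof -
    have "?t m = zcoeff ((1 - mono_uv a 1 0) * ((1 - mono_uv b 1 0) * wt a 0 b 0 c d)) m"
      unfolding zcoeff_diff_mono_mult by (simp add: w_def \<alpha>_def \<beta>_def algebra_simps)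
    also have "\<dots> = zcoeff S m - zcoeff S (m - 2)"
      unfolding S(1) zcoeff_diff_mono_mult by simp
    finally show ?thesis .
  qed
  have "?t (1 - n) = - ?t (1 + n)"
    unfolding t using zcoeff_refl[OF S(2,3), of "1 - n"] zcoeff_refl[OF S(2,3), of "1 + n"]
    by (simp add: algebra_simps)
  then show ?thesis by (simp add: algebra_simps)
qed

text \<open>Only the monomials u^i v^0 contribute to order 0 in q^(1/2), and these are nonnegative
  powers of z. Together with the constant coefficient 1 this makes the Gram matrix unitriangular
  modulo q^(1/2).\<close>

lemma zcoeff_wt_nth_0:
  "fls_nth (zcoeff (wt a h b h' c d) n) k = 0" if "k < 0 \<or> k = 0 \<and> n < 0"
  using that by (auto simp: zcoeff_nth)

lemma zcoeff_wt_0_nth_0: "fls_nth (zcoeff (wt a h b h' c d) 0) 0 = 1"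
  by (simp add: zcoeff_nth cf_wt_0)

section \<open>Laurent polynomials and functionals\<close>

abbreviation lk :: "laurent \<Rightarrow> int \<Rightarrow> K" where "lk \<equiv> Poly_Mapping.lookup"

lemma lk_monom_mult: "lk (Poly_Mapping.single i c * f) n = c * lk f (n - i)"
proof -
  have "lk (Poly_Mapping.single i c * f) n =
      (\<Sum>l. (c when i = l) * (\<Sum>k. lk f k when n = l + k))"
    by (simp add: lookup_mult lookup_single)
  also have "\<dots> = (\<Sum>l. (c * (\<Sum>k. lk f k when n = i + k)) when l = i)"
    by (rule Sum_any.cong) (auto simp: when_def)
  also have "\<dots> = c * (\<Sum>k. lk f k when k = n - i)"
  proof -
    have "(n = i + k) = (k = n - i)" for k by auto
    then show ?thesis by (simp only: Sum_any_when_equal)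
  qed
  finally show ?thesis by (simp only: Sum_any_when_equal)
qed

lemma zpow_mult: "zpow m * zpow n = zpow (m + n)"
  and lconst_mult: "lconst c * lconst d = lconst (c * d)"
  and zpow_0: "zpow 0 = 1" and lconst_1: "lconst 1 = 1" and lconst_0: "lconst 0 = 0"
  and lconst_add: "lconst (c + d) = lconst c + lconst d"
  and lconst_uminus: "lconst (- c) = - lconst c"
  by (simp_all add: zpow_def lconst_def mult_single single_add single_uminus)

lemma lk_zpow_mult: "lk (zpow i * f) n = lk f (n - i)"
  and lk_lconst_mult: "lk (lconst c * f) n = c * lk f n"
  by (simp_all add: zpow_def lconst_def lk_monom_mult)

lemma lk_zpow: "lk (zpow i) n = (if n = i then 1 else 0)"
  by (auto simp: zpow_def lookup_single when_def)

lemma lk_1: "lk 1 n = (if n = 0 then 1 else 0)"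
  by (simp add: lookup_one when_def)

lemma lk_linear_mult: "lk ((1 - lconst c * zpow i) * f) n = lk f n - c * lk f (n - i)"
  by (simp add: left_diff_distrib lookup_minus mult.assoc lk_lconst_mult lk_zpow_mult)

lemma lk_zsym: "lk (zsym k) n = (if n = k then 1 else 0) + (if n = - k then 1 else 0)"
  by (simp add: zsym_def lookup_add lk_zpow)

lemmas lk_simps = lk_zpow_mult lk_lconst_mult lk_linear_mult lookup_add lookup_minus lookup_uminus

lemma laurent_eqI: "(\<And>n. lk f n = lk g n) \<Longrightarrow> f = g"
  by (rule poly_mapping_eqI)

text \<open>The functional z^n -> w n, semilinear along \<open>\<phi>\<close>: with
  \<open>K_emb\<close> it describes \<open>ct_weight\<close>, with the identity the
  \<open>K\<close>-valued functionals below.\<close>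

definition functional :: "(K \<Rightarrow> 'b::comm_ring_1) \<Rightarrow> (int \<Rightarrow> 'b) \<Rightarrow> laurent \<Rightarrow> 'b" where
  "functional \<phi> w f = (\<Sum>n\<in>Poly_Mapping.keys f. \<phi> (lk f n) * w n)"

lemma functional_superset:
  assumes "\<phi> 0 = 0" "finite A" "Poly_Mapping.keys f \<subseteq> A"
  shows "functional \<phi> w f = (\<Sum>n\<in>A. \<phi> (lk f n) * w n)"
  unfolding functional_def using assms
  by (intro sum.mono_neutral_left) (auto simp: in_keys_iff)

lemma functional_add:
  assumes "field_hom \<phi>"
  shows "functional \<phi> w (f + g) = functional \<phi> w f + functional \<phi> w g"
proof -
  let ?A = "Poly_Mapping.keys f \<union> Poly_Mapping.keys g"
  have "functional \<phi> w h = (\<Sum>n\<in>?A. \<phi> (lk h n) * w n)" if "Poly_Mapping.keys h \<subseteq> ?A" for h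
    using functional_superset[of \<phi> ?A h w] that field_hom_0[OF assms] by simp
  with Poly_Mapping.keys_add[of f g] show ?thesis
    by (simp add: lookup_add field_hom_add[OF assms] distrib_right sum.distrib)
qed

lemma functional_lconst:
  assumes "field_hom \<phi>"
  shows "functional \<phi> w (lconst c * f) = \<phi> c * functional \<phi> w f"
proof -
  have "Poly_Mapping.keys (lconst c * f) \<subseteq> Poly_Mapping.keys f"
    by (auto simp: in_keys_iff lk_simps)
  then have "functional \<phi> w (lconst c * f) = (\<Sum>n\<in>Poly_Mapping.keys f. \<phi> (lk (lconst c * f) n) * w n)"
    by (intro functional_superset field_hom_0[OF assms]) auto
  then show ?thesis
    by (simp add: functional_def lk_simps field_hom_mult[OF assms] sum_distrib_left mult.assoc)
qed

lemma functional_zpow: "field_hom \<phi> \<Longrightarrow> functional \<phi> w (zpow n) = w n"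
  by (simp add: functional_def zpow_def field_hom_1)

lemma laurent_expand: "f = (\<Sum>n\<in>Poly_Mapping.keys f. lconst (lk f n) * zpow n)"
proof (rule laurent_eqI)
  fix n
  have "lk (\<Sum>n\<in>Poly_Mapping.keys f. lconst (lk f n) * zpow n) n =
      (\<Sum>k\<in>Poly_Mapping.keys f. if k = n then lk f k else 0)"
    unfolding lookup_sum lk_simps lk_zpow by (intro sum.cong) auto
  also have "\<dots> = lk f n" by (simp add: in_keys_iff)
  finally show "lk f n = lk (\<Sum>n\<in>Poly_Mapping.keys f. lconst (lk f n) * zpow n) n" by simp
qed

definition linear_fun :: "(laurent \<Rightarrow> K) \<Rightarrow> bool" where
  "linear_fun M \<longleftrightarrow> (\<forall>f g. M (f + g) = M f + M g) \<and> (\<forall>c f. M (lconst c * f) = c * M f)"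

lemma linear_fun_add: "linear_fun M \<Longrightarrow> M (f + g) = M f + M g"
  and linear_fun_lconst: "linear_fun M \<Longrightarrow> M (lconst c * f) = c * M f"
  by (auto simp: linear_fun_def)

lemma linear_fun_0: "linear_fun M \<Longrightarrow> M 0 = 0"
  using linear_fun_lconst[of M 0 0] by (simp add: lconst_0)

lemma linear_fun_uminus: "linear_fun M \<Longrightarrow> M (- f) = - M f"
  using linear_fun_lconst[of M "-1" f] by (simp add: lconst_uminus lconst_1)

lemma linear_fun_diff: "linear_fun M \<Longrightarrow> M (f - g) = M f - M g"
  using linear_fun_add[of M f "- g"] by (simp add: linear_fun_uminus)

lemma linear_fun_sum: "linear_fun M \<Longrightarrow> M (sum f A) = (\<Sum>x\<in>A. M (f x))"
  by (induction A rule: infinite_finite_induct) (auto simp: linear_fun_0 linear_fun_add)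

lemma linear_fun_mult: "linear_fun M \<Longrightarrow> linear_fun (\<lambda>f. M (g * f))"
  unfolding linear_fun_def distrib_left mult.left_commute[of g] by blast

lemma linear_fun_mult_expand:
  assumes "linear_fun M"
  shows "M (g * f) = (\<Sum>n\<in>Poly_Mapping.keys f. lk f n * M (g * zpow n))"
proof -
  have "g * f = g * (\<Sum>n\<in>Poly_Mapping.keys f. lconst (lk f n) * zpow n)"
    using laurent_expand[of f] by simp
  also have "\<dots> = (\<Sum>n\<in>Poly_Mapping.keys f. lconst (lk f n) * (g * zpow n))"
    unfolding sum_distrib_left by (intro sum.cong refl mult.left_commute)
  finally show ?thesis by (simp only: linear_fun_sum[OF assms] linear_fun_lconst[OF assms])
qed

lemma field_hom_id: "field_hom (\<lambda>x. x)"
  by (simp add: field_hom_def)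

lemma linear_fun_functional: "linear_fun (functional (\<lambda>x. x) w)"
  by (simp add: linear_fun_def functional_add functional_lconst field_hom_id)

text \<open>The substitution f(z) -> f(s/z).\<close>

definition scale_rfl :: "K \<Rightarrow> laurent \<Rightarrow> laurent" where
  "scale_rfl s f = (\<Sum>n\<in>Poly_Mapping.keys f. lconst (lk f n * s powi n) * zpow (- n))"

lemma lk_scale_rfl:
  assumes "s \<noteq> 0"
  shows "lk (scale_rfl s f) n = s powi (- n) * lk f (- n)"
proof -
  have "lk (scale_rfl s f) n = (\<Sum>k\<in>Poly_Mapping.keys f. if k = - n then lk f k * s powi k else 0)"
    unfolding scale_rfl_def lookup_sum lk_simps lk_zpow by (intro sum.cong) auto
  then show ?thesis by (auto simp: in_keys_iff)
qed

lemma laurent_sym_lk: "f \<in> laurent_sym \<longleftrightarrow> (\<forall>n. lk f (- n) = lk f n)"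
  by (simp add: laurent_sym_def)

definition supp :: "laurent \<Rightarrow> int \<Rightarrow> int \<Rightarrow> bool" where
  "supp f i j \<longleftrightarrow> (\<forall>n. lk f n \<noteq> 0 \<longrightarrow> i \<le> n \<and> n \<le> j)"

lemma suppI: "(\<And>n. n < i \<or> n > j \<Longrightarrow> lk f n = 0) \<Longrightarrow> supp f i j"
  by (force simp: supp_def)

lemma suppD: "supp f i j \<Longrightarrow> n < i \<or> n > j \<Longrightarrow> lk f n = 0"
  by (auto simp: supp_def)

lemma supp_mono: "supp f i j \<Longrightarrow> i' \<le> i \<Longrightarrow> j \<le> j' \<Longrightarrow> supp f i' j'"
  by (force simp: supp_def)

lemma supp_add: "supp f i j \<Longrightarrow> supp g i j \<Longrightarrow> supp (f + g) i j"
  and supp_diff: "supp f i j \<Longrightarrow> supp g i j \<Longrightarrow> supp (f - g) i j"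
  and supp_lconst: "supp f i j \<Longrightarrow> supp (lconst c * f) i j"
  and supp_zpow_mult: "supp f (i - k) (j - k) \<Longrightarrow> supp (zpow k * f) i j"
  by (auto intro!: suppI simp: lk_simps suppD)

lemma supp_linear: "supp f i j \<Longrightarrow> supp ((1 - lconst c * zpow 1) * f) i (j + 1)"
  by (auto intro!: suppI simp: lk_simps suppD)

lemma zsym_sym: "zsym k \<in> laurent_sym"
  by (auto simp: laurent_sym_lk lk_zsym)

lemma sym_diff: "f \<in> laurent_sym \<Longrightarrow> g \<in> laurent_sym \<Longrightarrow> f - g \<in> laurent_sym"
  and sym_add: "f \<in> laurent_sym \<Longrightarrow> g \<in> laurent_sym \<Longrightarrow> f + g \<in> laurent_sym"
  and sym_lconst: "f \<in> laurent_sym \<Longrightarrow> lconst c * f \<in> laurent_sym"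
  and sym_0: "0 \<in> laurent_sym" and sym_1: "1 \<in> laurent_sym"
  by (auto simp: laurent_sym_lk lk_simps lk_1)

section \<open>Monic orthogonal symmetric polynomials of a functional\<close>

definition symdeg :: "int \<Rightarrow> laurent \<Rightarrow> bool" where
  "symdeg n f \<longleftrightarrow> f \<in> laurent_sym \<and> supp f (- n) n"

text \<open>All leading principal minors of the Gram matrix of M on symmetric Laurent polynomials
  are nonzero.\<close>

definition sym_nondegenerate :: "(laurent \<Rightarrow> K) \<Rightarrow> bool" where
  "sym_nondegenerate M \<longleftrightarrow> (\<forall>n f. symdeg n f \<longrightarrow> (\<forall>k. 0 \<le> k \<and> k \<le> n \<longrightarrow> M (f * zsym k) = 0) \<longrightarrow> f = 0)"

lemma symdeg_combination:
  assumes "symdeg (n - 1) f" "n \<ge> 1"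
  shows "\<exists>c. f = (\<Sum>j\<in>{0..<n}. lconst (c j) * zsym j)"
proof
  \<comment> \<open>Since \<open>zsym 0\<close> is the constant 2, the constant coefficient has to
    be halved.\<close>
  define c where "c j = (if j = 0 then lk f 0 / 2 else lk f j)" for j
  show "f = (\<Sum>j\<in>{0..<n}. lconst (c j) * zsym j)"
  proof (rule laurent_eqI)
    fix k
    have s: "lk f (- k) = lk f k" using assms(1) by (auto simp: symdeg_def laurent_sym_lk)
    have z: "lk f k = 0" if "k \<ge> n \<or> k \<le> - n" using assms(1) that by (auto simp: symdeg_def intro: suppD)
    have "lk (\<Sum>j\<in>{0..<n}. lconst (c j) * zsym j) k =
      (\<Sum>j\<in>{0..<n}. (if j = k then c k else 0) + (if j = - k then c (- k) else 0))"
      unfolding lookup_sum lk_simps lk_zsym by (intro sum.cong) auto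
    also have "\<dots> = (if 0 \<le> k \<and> k < n then c k else 0) + (if k \<le> 0 \<and> - k < n then c (- k) else 0)"
      by (simp add: sum.distrib)
    also have "\<dots> = lk f k" using s z by (auto simp: c_def)
    finally show "lk f k = lk (\<Sum>j\<in>{0..<n}. lconst (c j) * zsym j) k" by simp
  qed
qed

lemma symdeg_sum_zsym: "symdeg (n - 1) (\<Sum>j\<in>{0..<n}. lconst (c j) * zsym j)"
proof -
  have "symdeg (n - 1) (\<Sum>j\<in>A. lconst (c j) * zsym j)" if "finite A" "A \<subseteq> {0..<n}" for A
    using that
  proof (induction A)
    case empty then show ?case by (simp add: symdeg_def sym_0 supp_def)
  next
    case (insert j A)
    then have "symdeg (n - 1) (lconst (c j) * zsym j)"
      by (auto simp: symdeg_def sym_lconst zsym_sym supp_def lk_simps lk_zsym)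
    with insert show ?case by (auto simp: symdeg_def sym_add supp_add)
  qed
  then show ?thesis by simp
qed

text \<open>A Gram-Schmidt step: the solution for the moments of \<open>zsym n\<close> yields the
  orthogonal polynomial p of degree n. By nondegeneracy its pairing with \<open>zsym n\<close> is
  nonzero, so a multiple of p corrects the last value without disturbing the earlier ones.\<close>

lemma gram_solvable:
  assumes M: "linear_fun M" and nd: "sym_nondegenerate M"
  shows "\<exists>f. symdeg (int n - 1) f \<and> (\<forall>k. 0 \<le> k \<and> k < int n \<longrightarrow> M (f * zsym k) = v k)"
proof (induction n arbitrary: v)
  case 0
  show ?case by (rule exI[of _ 0]) (simp add: symdeg_def sym_0 supp_def)
next
  case (Suc n)
  have lin: "M ((f + g) * h) = M (f * h) + M (g * h)" "M ((f - g) * h) = M (f * h) - M (g * h)"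
    "M (lconst c * f * h) = c * M (f * h)" for f g h c
    by (simp_all add: distrib_right left_diff_distrib linear_fun_add[OF M] linear_fun_diff[OF M] linear_fun_lconst[OF M] mult.assoc)
  obtain g where g: "symdeg (int n - 1) g"
    "\<And>k. 0 \<le> k \<and> k < int n \<Longrightarrow> M (g * zsym k) = M (zsym (int n) * zsym k)"
    using Suc.IH[of "\<lambda>k. M (zsym (int n) * zsym k)"] by blast
  define p where "p = zsym (int n) - g"
  have p: "symdeg (int n) p" using g(1)
    by (auto simp: p_def symdeg_def sym_diff zsym_sym intro!: supp_diff elim: supp_mono)
       (auto simp: supp_def lk_zsym)
  have p0: "M (p * zsym k) = 0" if "0 \<le> k \<and> k < int n" for k
    using g(2)[OF that] by (simp add: p_def lin)
  have "lk g (int n) = 0" using g(1) by (auto simp: symdeg_def intro: suppD)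
  then have "lk p (int n) \<noteq> 0" by (simp add: p_def lk_simps lk_zsym)
  then have "p \<noteq> 0" by auto
  have pn: "M (p * zsym (int n)) \<noteq> 0"
  proof
    assume "M (p * zsym (int n)) = 0"
    with p0 have "M (p * zsym k) = 0" if "0 \<le> k \<and> k \<le> int n" for k
      using that by (cases "k = int n") auto
    with nd p \<open>p \<noteq> 0\<close> show False unfolding sym_nondegenerate_def by blast
  qed
  obtain f where f: "symdeg (int n - 1) f" "\<And>k. 0 \<le> k \<and> k < int n \<Longrightarrow> M (f * zsym k) = v k"
    using Suc.IH[of v] by blast
  define t where "t = (v (int n) - M (f * zsym (int n))) / M (p * zsym (int n))"
  define F where "F = f + lconst t * p"
  have "symdeg (int (Suc n) - 1) F"
    using f(1) p by (auto simp: F_def symdeg_def sym_add sym_lconst intro!: supp_add supp_lconst elim: supp_mono)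
  moreover have "M (F * zsym k) = v k" if "0 \<le> k \<and> k < int (Suc n)" for k
    using that f(2)[of k] p0[of k] pn
    by (cases "k = int n") (auto simp: F_def lin t_def)
  ultimately show ?case by blast
qed

text \<open>Normalized by the coefficient of z^n instead of \<open>zsym n\<close>: this gives 1 at n
  = 0, where \<open>zsym 0\<close> would give 2, and agrees with the usual form for n \<ge>
  1.\<close>

definition monic_orth :: "(laurent \<Rightarrow> K) \<Rightarrow> int \<Rightarrow> laurent \<Rightarrow> bool" where
  "monic_orth M n P \<longleftrightarrow> symdeg n P \<and> lk P n = 1 \<and> (\<forall>k. 0 \<le> k \<and> k < n \<longrightarrow> M (P * zsym k) = 0)"

lemma monic_orth_0: "monic_orth M 0 1"
  by (auto simp: monic_orth_def symdeg_def sym_1 supp_def lk_1)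

lemma monic_orth_lk:
  assumes "monic_orth M n P"
  shows "lk P n = 1" "lk P (- n) = 1" "P \<in> laurent_sym" "supp P (- n) n"
  using assms by (auto simp: monic_orth_def symdeg_def laurent_sym_lk)

lemma monic_orth_exists_pos:
  assumes M: "linear_fun M" and nd: "sym_nondegenerate M" and n: "n \<ge> 1"
  shows "\<exists>P. symdeg (n - 1) (P - zsym n) \<and> (\<forall>k. 0 \<le> k \<and> k < n \<longrightarrow> M (P * zsym k) = 0)"
proof -
  obtain f where f: "symdeg (n - 1) f" "\<And>k. 0 \<le> k \<and> k < n \<Longrightarrow> M (f * zsym k) = M (zsym n * zsym k)"
    using gram_solvable[OF M nd, of "nat n" "\<lambda>k. M (zsym n * zsym k)"] n by auto
  have "symdeg (n - 1) (- f)" using f(1) by (auto simp: symdeg_def laurent_sym_lk supp_def)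
  with f(2) show ?thesis
    by (intro exI[of _ "zsym n - f"]) (auto simp: left_diff_distrib linear_fun_diff[OF M])
qed

lemma monic_orth_iff:
  assumes "n \<ge> 1"
  shows "monic_orth M n P \<longleftrightarrow> symdeg (n - 1) (P - zsym n) \<and> (\<forall>k. 0 \<le> k \<and> k < n \<longrightarrow> M (P * zsym k) = 0)"
proof -
  have "symdeg n P \<and> lk P n = 1" if "symdeg (n - 1) (P - zsym n)"
  proof -
    have "symdeg n (P - zsym n)" using that by (auto simp: symdeg_def elim: supp_mono)
    moreover have "symdeg n (zsym n)"
      using assms by (auto simp: symdeg_def zsym_sym lk_zsym intro!: suppI)
    ultimately    have "symdeg n (P - zsym n + zsym n)" unfolding symdeg_def using sym_add supp_add by blast
    moreover have "lk (P - zsym n) n = 0" using that by (auto simp: symdeg_def intro: suppD)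
    ultimately show ?thesis using assms by (simp add: lk_simps lk_zsym)
  qed
  moreover have "symdeg (n - 1) (P - zsym n)" if "symdeg n P" "lk P n = 1"
    unfolding symdeg_def
  proof
    show "P - zsym n \<in> laurent_sym" using that by (auto simp: symdeg_def sym_diff zsym_sym)
    have "lk P (- n) = 1" using that by (auto simp: symdeg_def laurent_sym_lk)
    have "lk (P - zsym n) k = 0" if "k < - (n - 1) \<or> k > n - 1" for k
    proof (cases "k = n \<or> k = - n")
      case True then show ?thesis using assms \<open>lk P n = 1\<close> \<open>lk P (- n) = 1\<close> by (auto simp: lk_simps lk_zsym)
    next
      case False
      with that have "k < - n \<or> k > n" by linarith
      then have "lk P k = 0" using \<open>symdeg n P\<close> by (auto simp: symdeg_def intro: suppD)
      with False show ?thesis by (simp add: lk_simps lk_zsym)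
    qed
    then show "supp (P - zsym n) (- (n - 1)) (n - 1)" by (meson not_le supp_def)
  qed
  ultimately show ?thesis unfolding monic_orth_def by blast
qed

lemma monic_orth_unique:
  assumes M: "linear_fun M" and nd: "sym_nondegenerate M" and n: "n \<ge> 1" and "monic_orth M n P" "monic_orth M n P'"
  shows "P = P'"
proof -
  have d: "symdeg (n - 1) ((P - zsym n) - (P' - zsym n))"
    using assms monic_orth_iff[OF n] unfolding symdeg_def by (blast intro: sym_diff supp_diff)
  have "M ((P - P') * zsym k) = 0" if "0 \<le> k \<and> k \<le> n - 1" for k
    using assms that by (auto simp: left_diff_distrib linear_fun_diff[OF M] monic_orth_def)
  moreover have "symdeg (n - 1) (P - P')" using d by simp
  ultimately have "P - P' = 0" using nd unfolding sym_nondegenerate_def by blast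
  then show ?thesis by simp
qed

lemma monic_orth_exists:
  assumes "linear_fun M" "sym_nondegenerate M" "n \<ge> 0"
  shows "\<exists>P. monic_orth M n P"
  using monic_orth_exists_pos[OF assms(1,2), of n] monic_orth_iff[of n M] monic_orth_0[of M] assms(3)
  by (cases "n = 0") auto

section \<open>Orthogonality for functionals with a reflection symmetry\<close>

text \<open>Applied to the moments \<mu> of (1 - a z) P. Orthogonality to symmetric polynomials
  controls only \<mu> k + \<mu> (-k); the reflection separates the two. From the window -n \<le> j <
  n, the sum at n kills \<mu> n, and then the relation at n kills \<mu> (-n - 1).\<close>

lemma refl_seq_Steinberg:
  fixes \<mu> :: "int \<Rightarrow> K"
  assumes rel: "\<And>k. \<mu> (k - 1) + \<mu> (- k - 1) = b * (\<mu> k + \<mu> (- k))"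
    and z: "\<And>k. 0 \<le> k \<Longrightarrow> k < int m \<Longrightarrow> \<mu> k + \<mu> (- k) = 0"
  shows "- int m \<le> j \<Longrightarrow> j < int m \<Longrightarrow> \<mu> j = 0" and "\<mu> (- int m - 1) = b * \<mu> (int m)"
proof -
  have C: "\<forall>j. - int n \<le> j \<and> j < int n \<longrightarrow> \<mu> j = 0" if "n \<le> m" for n
    using that
  proof (induction n)
    case (Suc n)
    then have IH: "\<And>j. - int n \<le> j \<Longrightarrow> j < int n \<Longrightarrow> \<mu> j = 0" by simp
    have s: "\<mu> (int n) + \<mu> (- int n) = 0" using z[of "int n"] Suc.prems by simp
    have "\<mu> (int n) = 0" "\<mu> (- int n - 1) = 0"
      using s rel[of "int n"] IH[of "- int n"] IH[of "int n - 1"] by (cases "n = 0"; simp)+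
    moreover have "j = int n \<or> j = - int n - 1 \<or> - int n \<le> j \<and> j < int n"
      if "- int (Suc n) \<le> j" "j < int (Suc n)" for j using that by auto
    ultimately show ?case using IH by blast
  qed simp
  then show "- int m \<le> j \<Longrightarrow> j < int m \<Longrightarrow> \<mu> j = 0" by blast
  show "\<mu> (- int m - 1) = b * \<mu> (int m)"
    using rel[of "int m"] C[OF order_refl] by (cases "m = 0") auto
qed

text \<open>The moments of P itself. Once the window -n < j < n vanishes, the relation at n - 1
  reads a b \<mu> n + \<mu> (-n) = 0; with \<mu> n + \<mu> (-n) = 0 it leaves (a b - 1) \<mu> n =
  0.\<close>

lemma refl_seq_symmetric:
  fixes \<mu> :: "int \<Rightarrow> K"
  assumes rel: "\<And>k. \<mu> (k - 1) - (a + b) * \<mu> k + a * b * \<mu> (k + 1) =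
      - (\<mu> (- k - 1) - (a + b) * \<mu> (- k) + a * b * \<mu> (1 - k))"
    and z: "\<And>k. 0 \<le> k \<Longrightarrow> k < int m \<Longrightarrow> \<mu> k + \<mu> (- k) = 0" and ab: "a * b \<noteq> 1"
  shows "- int m < j \<Longrightarrow> j < int m \<Longrightarrow> \<mu> j = 0" and "m \<ge> 1 \<Longrightarrow> \<mu> (- int m) = - a * b * \<mu> (int m)"
proof -
  have step: "a * b * \<mu> (int n) + \<mu> (- int n) = 0"
    if IH: "\<And>j. - int n < j \<Longrightarrow> j < int n \<Longrightarrow> \<mu> j = 0" and n: "n \<ge> 1" for n
  proof -
    have *: "\<mu> (int n - 1) = 0" "\<mu> (1 - int n) = 0" using IH n by auto
    show ?thesis
    proof (cases "n = 1")
      case True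
      then have "2 * (a * b * \<mu> 1 + \<mu> (- 1)) = 0" using rel[of 0] * by (simp add: algebra_simps)
      then show ?thesis using True by simp
    next
      case False
      then have "\<mu> (int n - 2) = 0" "\<mu> (2 - int n) = 0" using IH n by auto
      then show ?thesis using rel[of "int n - 1"] * by (simp add: algebra_simps)
    qed
  qed
  have C: "\<forall>j. - int n < j \<and> j < int n \<longrightarrow> \<mu> j = 0" if "n \<le> m" for n
    using that
  proof (induction n)
    case (Suc n)
    then have IH: "\<And>j. - int n < j \<Longrightarrow> j < int n \<Longrightarrow> \<mu> j = 0" by simp
    have s: "\<mu> (- int n) = - \<mu> (int n)" using z[of "int n"] Suc.prems by (simp add: eq_neg_iff_add_eq_0 add.commute)
    have "\<mu> (int n) = 0"
    proof (cases "n = 0")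
      case True then show ?thesis using s by (simp add: eq_neg_iff_add_eq_0)
    next
      case False
      have "a * b * \<mu> (int n) + \<mu> (- int n) = 0" by (rule step) (use IH False in auto)
      then have "(a * b - 1) * \<mu> (int n) = 0" using s by (simp add: algebra_simps)
      then show ?thesis using ab by simp
    qed
    moreover from this s have "\<mu> (- int n) = 0" by simp
    moreover have "j = int n \<or> j = - int n \<or> - int n < j \<and> j < int n"
      if "- int (Suc n) < j" "j < int (Suc n)" for j using that by auto
    ultimately show ?case using IH by blast
  qed simp
  then show "- int m < j \<Longrightarrow> j < int m \<Longrightarrow> \<mu> j = 0" by blast
  show "m \<ge> 1 \<Longrightarrow> \<mu> (- int m) = - a * b * \<mu> (int m)"
    using step[of m] C[OF order_refl] by (simp add: eq_neg_iff_add_eq_0 add.commute)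
qed

text \<open>The moments of (1 - a z) (1 - b z) P are odd about -1, so the induction starts from
  \<mu> (-1) = 0 and the window is -n - 1 \<le> j < n.\<close>

lemma refl_seq_antisymmetric:
  fixes \<mu> :: "int \<Rightarrow> K"
  assumes rel: "\<And>k. \<mu> (k - 1) = - \<mu> (- k - 1)"
    and z: "\<And>k. 0 \<le> k \<Longrightarrow> k < int m \<Longrightarrow> \<mu> k + \<mu> (- k) = 0"
  shows "- int m - 1 \<le> j \<Longrightarrow> j < int m \<Longrightarrow> \<mu> j = 0" and "\<mu> (- int m - 2) = - \<mu> (int m)"
proof -
  have C: "\<forall>j. - int n - 1 \<le> j \<and> j < int n \<longrightarrow> \<mu> j = 0" if "n \<le> m" for n
    using that
  proof (induction n)
    case 0
    have "\<mu> (- 1) = 0" using rel[of 0] by (simp add: eq_neg_iff_add_eq_0)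
    moreover have "j = - 1" if "- int 0 - 1 \<le> j" "j < int 0" for j using that by auto
    ultimately show ?case by blast
  next
    case (Suc n)
    then have IH: "\<And>j. - int n - 1 \<le> j \<Longrightarrow> j < int n \<Longrightarrow> \<mu> j = 0" by simp
    have s: "\<mu> (int n) + \<mu> (- int n) = 0" using z[of "int n"] Suc.prems by simp
    have n0: "\<mu> (int n) = 0" using s IH[of "- int n"] by (cases "n = 0") auto
    then have "\<mu> (- int n - 2) = 0" using rel[of "int n + 1"] by (simp add: algebra_simps)
    moreover have "j = int n \<or> j = - int n - 2 \<or> - int n - 1 \<le> j \<and> j < int n"
      if "- int (Suc n) - 1 \<le> j" "j < int (Suc n)" for j using that by auto
    ultimately show ?case using IH n0 by blast
  qed
  then show "- int m - 1 \<le> j \<Longrightarrow> j < int m \<Longrightarrow> \<mu> j = 0" by blast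
  show "\<mu> (- int m - 2) = - \<mu> (int m)" using rel[of "int m + 1"] by (simp add: algebra_simps)
qed

text \<open>The reflection relation says that \<open>z\<^sup>-\<^sup>1 (1 - a z) (1 - b z) \<Delta>\<close> is odd under \<open>z \<mapsto> 1/z\<close>.\<close>

locale refl_functional =
  fixes a b :: K and ell :: "int \<Rightarrow> K"
  assumes reflection: "\<And>n. ell (n - 1) - (a + b) * ell n + a * b * ell (n + 1) =
      - (ell (- n - 1) - (a + b) * ell (- n) + a * b * ell (1 - n))"
    and toeplitz: "\<And>f i j. supp f i j \<Longrightarrow>
      (\<And>n. i \<le> n \<Longrightarrow> n \<le> j \<Longrightarrow> functional (\<lambda>x. x) ell (f * zpow (- n)) = 0) \<Longrightarrow> f = 0"
    and ab: "a * b \<noteq> 1"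
begin

definition L :: "laurent \<Rightarrow> K" where "L = functional (\<lambda>x. x) ell"

lemma linear_fun_L: "linear_fun L"
  by (simp add: L_def linear_fun_functional)

lemma L_zpow: "L (zpow n) = ell n"
  by (simp add: L_def functional_zpow field_hom_id)

lemma L_shift: "L ((1 - lconst c * zpow i) * f * zpow k) = L (f * zpow k) - c * L (f * zpow (i + k))"
  and L_shift': "L (zpow i * f * zpow k) = L (f * zpow (i + k))"
  and L_plus: "L ((f + g) * h) = L (f * h) + L (g * h)"
  and L_minus: "L ((f - g) * h) = L (f * h) - L (g * h)"
  and L_lconst: "L (lconst c * f * h) = c * L (f * h)"
proof -
  have "(1 - lconst c * zpow i) * f * zpow k = f * zpow k - lconst c * (f * (zpow i * zpow k))"
    by (simp add: algebra_simps)
  then show "L ((1 - lconst c * zpow i) * f * zpow k) = L (f * zpow k) - c * L (f * zpow (i + k))"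
    by (simp add: linear_fun_diff[OF linear_fun_L] linear_fun_lconst[OF linear_fun_L] zpow_mult)
  have "zpow i * f * zpow k = f * (zpow i * zpow k)" by (simp only: mult_ac)
  then show "L (zpow i * f * zpow k) = L (f * zpow (i + k))" by (simp only: zpow_mult)
qed (simp_all add: distrib_right left_diff_distrib linear_fun_add[OF linear_fun_L] linear_fun_diff[OF linear_fun_L]
       linear_fun_lconst[OF linear_fun_L] mult.assoc)

lemma L_zsym: "L (f * zsym k) = L (f * zpow k) + L (f * zpow (- k))"
  by (simp add: zsym_def distrib_left linear_fun_add[OF linear_fun_L])

text \<open>Nondegeneracy of the pairing on each span of consecutive monomials.\<close>

lemma toeplitz_L: "supp f i j \<Longrightarrow> (\<And>n. i \<le> n \<Longrightarrow> n \<le> j \<Longrightarrow> L (f * zpow (- n)) = 0) \<Longrightarrow> f = 0"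
  unfolding L_def by (rule toeplitz)

text \<open>Oddness under z -> 1/z survives multiplication by a symmetric f: expand f in monomials
  and exchange n with -n in the sum.\<close>

lemma L_expand_sym:
  assumes "f \<in> laurent_sym" and odd: "\<And>n. L (g * zpow n) = - L (g * zpow (- n))"
  shows "L (g * f * zpow k) = - L (g * f * zpow (- k))"
proof -
  have fin: "finite (Poly_Mapping.keys f)" by simp
  have ex: "L (g * f * zpow k) = (\<Sum>n\<in>Poly_Mapping.keys f. lk f n * L (g * zpow (n + k)))" for k
  proof -
    have "g * f * zpow k = (zpow k * g) * f" by (simp add: ac_simps)
    then have "L (g * f * zpow k) = (\<Sum>n\<in>Poly_Mapping.keys f. lk f n * L (zpow k * g * zpow n))"
      using linear_fun_mult_expand[OF linear_fun_L, of "zpow k * g" f] by (simp only:)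
    then show ?thesis by (simp add: L_shift' add.commute)
  qed
  have sym: "lk f (- n) = lk f n" for n using assms(1) by (simp add: laurent_sym_lk)
  have "L (g * f * zpow k) = (\<Sum>n\<in>Poly_Mapping.keys f. lk f n * - L (g * zpow (- n - k)))"
    unfolding ex by (intro sum.cong refl) (subst odd, simp)
  also have "\<dots> = (\<Sum>n\<in>Poly_Mapping.keys f. lk f n * - L (g * zpow (n - k)))"
    by (rule sum.reindex_bij_witness[where i = uminus and j = uminus]) (auto simp: in_keys_iff sym)
  also have "\<dots> = - L (g * f * zpow (- k))" unfolding ex by (simp add: sum_negf)
  finally show ?thesis .
qed

lemma L_refl:
  assumes f: "f \<in> laurent_sym"
  defines "\<mu> \<equiv> \<lambda>k. L (f * zpow k)"
  shows "\<mu> (k - 1) - (a + b) * \<mu> k + a * b * \<mu> (k + 1) =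
      - (\<mu> (- k - 1) - (a + b) * \<mu> (- k) + a * b * \<mu> (1 - k))"
proof -
  define B where "B = (1 - lconst a * zpow 1) * ((1 - lconst b * zpow 1) * zpow (- 1))"
  have B: "L (B * h * zpow k) = L (h * zpow (k - 1)) - (a + b) * L (h * zpow k) + a * b * L (h * zpow (k + 1))" for h k
  proof -
    have "B * h * zpow k = (1 - lconst a * zpow 1) * ((1 - lconst b * zpow 1) * (zpow (- 1) * h)) * zpow k"
      by (simp add: B_def mult_ac)
    then show ?thesis by (simp only: L_shift L_shift') (simp add: algebra_simps)
  qed
  have "L (B * zpow n) = - L (B * zpow (- n))" for n
    using B[of 1 n] B[of 1 "- n"] reflection[of n] by (simp add: L_zpow add.commute[of "- n"])
  from L_expand_sym[OF f this, of k] show ?thesis unfolding B \<mu>_def by (simp add: add.commute[of "- k"])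
qed

abbreviation wa :: laurent where "wa \<equiv> 1 - lconst a * zpow 1"
abbreviation wb :: laurent where "wb \<equiv> 1 - lconst b * zpow 1"

text \<open>The odd factor is z^-1 (1 - a z) (1 - b z) = (1 - a z) (z^-1 - b), so L of (1 - a z)
  (z^-1 - b) f (z^k + z^-k) vanishes.\<close>

lemma L_wa_refl:
  assumes f: "f \<in> laurent_sym"
  shows "L (wa * f * zpow (k - 1)) + L (wa * f * zpow (- k - 1)) =
     b * (L (wa * f * zpow k) + L (wa * f * zpow (- k)))"
  unfolding L_shift using L_refl[OF f, of k] by (simp add: algebra_simps)

lemma L_wab_refl:
  assumes f: "f \<in> laurent_sym"
  shows "L (wa * (wb * f) * zpow (k - 1)) = - L (wa * (wb * f) * zpow (- k - 1))"
  unfolding L_shift using L_refl[OF f, of k] by (simp add: algebra_simps)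

lemma monic_orthD:
  assumes "monic_orth (\<lambda>f. L (w * f)) (int m) P" "0 \<le> k" "k < int m"
  shows "L (w * P * zpow k) + L (w * P * zpow (- k)) = 0"
proof -
  have "L (w * (P * zsym k)) = 0" using assms by (auto simp: monic_orth_def)
  then show ?thesis by (simp add: L_zsym flip: mult.assoc)
qed

lemma orth_wa:
  assumes P: "monic_orth (\<lambda>f. L (wa * f)) (int m) P"
  shows "- int m \<le> j \<Longrightarrow> j < int m \<Longrightarrow> L (wa * P * zpow j) = 0"
    and "L (wa * P * zpow (- int m - 1)) = b * L (wa * P * zpow (int m))"
proof -
  note * = refl_seq_Steinberg[of "\<lambda>j. L (wa * P * zpow j)" b m,
      OF L_wa_refl[OF monic_orth_lk(3)[OF P]] monic_orthD[OF P]]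
  show "- int m \<le> j \<Longrightarrow> j < int m \<Longrightarrow> L (wa * P * zpow j) = 0" by (rule *(1))
  show "L (wa * P * zpow (- int m - 1)) = b * L (wa * P * zpow (int m))" by (rule *(2))
qed

lemma orth_1:
  assumes P: "monic_orth L (int m) P"
  shows "- int m < j \<Longrightarrow> j < int m \<Longrightarrow> L (P * zpow j) = 0"
    and "m \<ge> 1 \<Longrightarrow> L (P * zpow (- int m)) = - a * b * L (P * zpow (int m))"
proof -
  have P': "monic_orth (\<lambda>f. L (1 * f)) (int m) P" using P by simp
  note * = refl_seq_symmetric[of "\<lambda>j. L (P * zpow j)" a b m,
      OF L_refl[OF monic_orth_lk(3)[OF P]] monic_orthD[OF P', simplified] ab]
  show "- int m < j \<Longrightarrow> j < int m \<Longrightarrow> L (P * zpow j) = 0" by (rule *(1))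
  show "m \<ge> 1 \<Longrightarrow> L (P * zpow (- int m)) = - a * b * L (P * zpow (int m))" by (rule *(2))
qed

lemma orth_wab:
  assumes P: "monic_orth (\<lambda>f. L (wa * wb * f)) (int m) P"
  shows "- int m - 1 \<le> j \<Longrightarrow> j < int m \<Longrightarrow> L (wa * (wb * P) * zpow j) = 0"
    and "L (wa * (wb * P) * zpow (- int m - 2)) = - L (wa * (wb * P) * zpow (int m))"
proof -
  have z: "L (wa * (wb * P) * zpow k) + L (wa * (wb * P) * zpow (- k)) = 0" if "0 \<le> k" "k < int m" for k
    using monic_orthD[OF P that] by (simp only: mult.assoc)
  note * = refl_seq_antisymmetric[of "\<lambda>j. L (wa * (wb * P) * zpow j)" m,
      OF L_wab_refl[OF monic_orth_lk(3)[OF P]] z]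
  show "- int m - 1 \<le> j \<Longrightarrow> j < int m \<Longrightarrow> L (wa * (wb * P) * zpow j) = 0" by (rule *(1))
  show "L (wa * (wb * P) * zpow (- int m - 2)) = - L (wa * (wb * P) * zpow (int m))" by (rule *(2))
qed

lemma linear_mult_eq_0:
  assumes "(1 - lconst c * zpow 1) * f = 0" "supp f i j"
  shows "f = 0"
proof (rule ccontr)
  assume "f \<noteq> 0"
  have "\<not> (\<forall>n. lk f n = 0)" using \<open>f \<noteq> 0\<close> by (auto intro: laurent_eqI)
  then have ne: "Poly_Mapping.keys f \<noteq> {}" by (auto simp: in_keys_iff)
  define m where "m = Min (Poly_Mapping.keys f)"
  have "lk f m \<noteq> 0" using Min_in[OF _ ne] by (simp add: m_def in_keys_iff)
  moreover have "lk f (m - 1) = 0"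
  proof (rule ccontr)
    assume "lk f (m - 1) \<noteq> 0"
    then have "m \<le> m - 1" unfolding m_def by (intro Min_le) (auto simp: in_keys_iff)
    then show False by simp
  qed
  moreover have "lk f m - c * lk f (m - 1) = 0"
    unfolding lk_linear_mult[symmetric] assms(1) by simp
  ultimately show False by simp
qed

text \<open>Symmetric orthogonality up to degree n spreads to the 2 n + 2 exponents from -n - 1 to
  n. That is exactly what \<open>toeplitz_L\<close> asks for the support -n, ..., n + 1 of
  \<open>wa * f\<close>. The next two nondegeneracy lemmas match windows and supports in the same
  way.\<close>

lemma sym_nondegenerate_wa: "sym_nondegenerate (\<lambda>f. L (wa * f))"
  unfolding sym_nondegenerate_def
proof (intro allI impI)
  fix n f assume f: "symdeg n f" and z: "\<forall>k. 0 \<le> k \<and> k \<le> n \<longrightarrow> L (wa * (f * zsym k)) = 0"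
  show "f = 0"
  proof (cases "n < 0")
    case True
    with f show ?thesis by (auto simp: symdeg_def intro!: laurent_eqI suppD)
  next
    case False
    have fs: "f \<in> laurent_sym" and fp: "supp f (- n) n" using f by (auto simp: symdeg_def)
    have z': "L (wa * f * zpow k) + L (wa * f * zpow (- k)) = 0" if "0 \<le> k" "k < int (Suc (nat n))" for k
      using z that False by (simp add: L_zsym flip: mult.assoc)
    have "L (wa * f * zpow j) = 0" if "- n - 1 \<le> j" "j \<le> n" for j
      using refl_seq_Steinberg(1)[of "\<lambda>j. L (wa * f * zpow j)" b "Suc (nat n)" j, OF L_wa_refl[OF fs] z'] that False
      by simp
    then have "wa * f = 0"
      by (intro toeplitz_L[OF supp_linear[OF fp]]) auto
    then show ?thesis using fp by (rule linear_mult_eq_0)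
  qed
qed

lemma sym_nondegenerate_1: "sym_nondegenerate L"
  unfolding sym_nondegenerate_def
proof (intro allI impI)
  fix n f assume f: "symdeg n f" and z: "\<forall>k. 0 \<le> k \<and> k \<le> n \<longrightarrow> L (f * zsym k) = 0"
  show "f = 0"
  proof (cases "n < 0")
    case True
    with f show ?thesis by (auto simp: symdeg_def intro!: laurent_eqI suppD)
  next
    case False
    have fs: "f \<in> laurent_sym" and fp: "supp f (- n) n" using f by (auto simp: symdeg_def)
    have z': "L (f * zpow k) + L (f * zpow (- k)) = 0" if "0 \<le> k" "k < int (Suc (nat n))" for k
      using z that False by (simp add: L_zsym)
    have "L (f * zpow j) = 0" if "- n \<le> j" "j \<le> n" for j
      using refl_seq_symmetric(1)[of "\<lambda>j. L (f * zpow j)" a b "Suc (nat n)" j, OF L_refl[OF fs] z' ab] that False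
      by simp
    then show "f = 0" by (intro toeplitz_L[OF fp]) auto
  qed
qed

lemma sym_nondegenerate_wab: "sym_nondegenerate (\<lambda>f. L (wa * wb * f))"
  unfolding sym_nondegenerate_def
proof (intro allI impI)
  fix n f assume f: "symdeg n f" and z: "\<forall>k. 0 \<le> k \<and> k \<le> n \<longrightarrow> L (wa * wb * (f * zsym k)) = 0"
  show "f = 0"
  proof (cases "n < 0")
    case True
    with f show ?thesis by (auto simp: symdeg_def intro!: laurent_eqI suppD)
  next
    case False
    have fs: "f \<in> laurent_sym" and fp: "supp f (- n) n" using f by (auto simp: symdeg_def)
    have z': "L (wa * (wb * f) * zpow k) + L (wa * (wb * f) * zpow (- k)) = 0"
      if "0 \<le> k" "k < int (Suc (nat n))" for k
      using z that False by (simp add: L_zsym flip: mult.assoc)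
    have o: "L (wa * (wb * f) * zpow j) = 0" if "- n - 2 \<le> j" "j \<le> n" for j
      using refl_seq_antisymmetric(1)[of "\<lambda>j. L (wa * (wb * f) * zpow j)" "Suc (nat n)" j, OF L_wab_refl[OF fs] z'] that False
      by simp
    have s1: "supp (wb * f) (- n) (n + 1)" by (rule supp_linear[OF fp])
    have s2: "supp (wa * (wb * f)) (- n) (n + 2)" by (rule supp_mono[OF supp_linear[OF s1]]) auto
    have "supp (wa * (wb * f)) (- n - 1 - - 1) (n + 1 - - 1)" using s2 by (simp add: add.commute)
    then have "supp (zpow (- 1) * (wa * (wb * f))) (- n - 1) (n + 1)" by (rule supp_zpow_mult)
    then have "zpow (- 1) * (wa * (wb * f)) = 0"
    proof (rule toeplitz_L)
      fix k assume "- n - 1 \<le> k" "k \<le> n + 1"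
      then show "L (zpow (- 1) * (wa * (wb * f)) * zpow (- k)) = 0"
        unfolding L_shift' by (intro o) auto
    qed
    then have "zpow 1 * (zpow (- 1) * (wa * (wb * f))) = 0" by simp
    then have "wa * (wb * f) = 0" by (simp add: zpow_mult zpow_0 flip: mult.assoc)
    then have "wb * f = 0" using s1 by (rule linear_mult_eq_0)
    then show ?thesis using fp by (rule linear_mult_eq_0)
  qed
qed

text \<open>The source of two-dimensionality: the difference is supported strictly inside, where it
  is orthogonal to every monomial of its support. An element is thus determined by its inner
  pairings and two end coefficients.\<close>

lemma eq_by_ends:
  assumes "supp f i j" "supp g i j" "lk f i = lk g i" "lk f j = lk g j"
    and "\<And>n. i < n \<Longrightarrow> n < j \<Longrightarrow> L (f * zpow (- n)) = L (g * zpow (- n))"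
  shows "f = g"
proof -
  have "supp (f - g) (i + 1) (j - 1)"
  proof (rule suppI)
    fix n assume "n < i + 1 \<or> n > j - 1"
    then consider "n = i" | "n = j" | "n < i \<or> n > j" by linarith
    then show "lk (f - g) n = 0" using assms by cases (auto simp: lk_simps suppD)
  qed
  then have "f - g = 0" by (rule toeplitz_L) (simp add: L_minus assms)
  then show ?thesis by simp
qed

lemma swap: "refl_functional b a ell"
proof
  show "ell (n - 1) - (b + a) * ell n + b * a * ell (n + 1) =
      - (ell (- n - 1) - (b + a) * ell (- n) + b * a * ell (1 - n))" for n
    using reflection[of n] by (simp add: add.commute mult.commute)
  show "f = 0" if "supp f i j"
      "\<And>n. i \<le> n \<Longrightarrow> n \<le> j \<Longrightarrow> functional (\<lambda>x. x) ell (f * zpow (- n)) = 0" for f i j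
    using that by (rule toeplitz)
qed (use ab in \<open>simp add: mult.commute\<close>)

end

lemma supp_right: "supp f i j \<Longrightarrow> lk f j = 0 \<Longrightarrow> supp f i (j - 1)"
  and supp_left: "supp f i j \<Longrightarrow> lk f i = 0 \<Longrightarrow> supp f (i + 1) j"
  by (auto simp: supp_def) (metis add1_zle_eq le_less zle_diff1_eq)+

context refl_functional
begin

section \<open>Bases of the two-dimensional spaces and the E determined by end coefficients\<close>

lemma wa_ends:
  assumes P: "monic_orth (\<lambda>f. L (wa * f)) (int m) P"
  shows "supp (wa * P) (- int m) (int m + 1)" "lk (wa * P) (- int m) = 1" "lk (wa * P) (int m + 1) = - a"
    and "\<And>n. - int m < n \<Longrightarrow> n \<le> int m \<Longrightarrow> L (wa * P * zpow (- n)) = 0"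
    and "L (wa * P * zpow (- (int m + 1))) = b * L (wa * P * zpow (int m))"
proof -
  note P' = monic_orth_lk[OF P]
  show "supp (wa * P) (- int m) (int m + 1)" by (rule supp_linear[OF P'(4)])
  show "lk (wa * P) (- int m) = 1" "lk (wa * P) (int m + 1) = - a"
    by (simp_all add: lk_simps P'(1,2) suppD[OF P'(4)])
  show "L (wa * P * zpow (- n)) = 0" if "- int m < n" "n \<le> int m" for n
    by (rule orth_wa(1)[OF P]) (use that in auto)
  show "L (wa * P * zpow (- (int m + 1))) = b * L (wa * P * zpow (int m))"
  proof -
    have "- (int m + 1) = - int m - 1" by simp
    then show ?thesis using orth_wa(2)[OF P] by (simp only:)
  qed
qed

text \<open>P has degree m, while R reaches degree m + 1; in the Koornwinder case the index of E is
  therefore m + 1 throughout, and at least 1.\<close>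

lemma wab_ends:
  assumes P: "monic_orth (\<lambda>f. L (wa * wb * f)) (int m) P"
  defines "R \<equiv> zpow (- 1) * (wa * (wb * P))"
  shows "supp R (- (int m + 1)) (int m + 1)" "lk R (- (int m + 1)) = 1" "lk R (int m + 1) = a * b"
    and "\<And>n. - (int m + 1) < n \<Longrightarrow> n < int m + 1 \<Longrightarrow> L (R * zpow (- n)) = 0"
    and "L (R * zpow (- (int m + 1))) = - L (R * zpow (int m + 1))"
proof -
  note P' = monic_orth_lk[OF P]
  have "supp (wa * (wb * P)) (- (int m + 1) - - 1) (int m + 1 - - 1)"
    by (rule supp_mono[OF supp_linear[OF supp_linear[OF P'(4)]]]) auto
  then show "supp R (- (int m + 1)) (int m + 1)" unfolding R_def by (rule supp_zpow_mult)
  show "lk R (- (int m + 1)) = 1" "lk R (int m + 1) = a * b"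
    by (simp_all add: R_def lk_simps P'(1,2) suppD[OF P'(4)])
  show "L (R * zpow (- n)) = 0" if "- (int m + 1) < n" "n < int m + 1" for n
    unfolding R_def L_shift' by (rule orth_wab(1)[OF P]) (use that in auto)
  show "L (R * zpow (- (int m + 1))) = - L (R * zpow (int m + 1))"
  proof -
    have "- 1 + - (int m + 1) = - int m - 2" "- 1 + (int m + 1) = int m" by simp_all
    then show ?thesis unfolding R_def L_shift' using orth_wab(2)[OF P] by (simp only:)
  qed
qed

text \<open>The leading coefficients at z^(m+1) are -a and -b, so b (1 - a z) P - a (1 - b z) P'
  loses that term; its orthogonality is inherited from both summands, and b - a normalizes the
  coefficient at z^-m.\<close>

lemma E_neg_eq:
  assumes P: "monic_orth (\<lambda>f. L (wa * f)) (int m) P" and P': "monic_orth (\<lambda>f. L (wb * f)) (int m) P'"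
    and neq: "a \<noteq> b"
  defines "E \<equiv> lconst (b / (b - a)) * (wa * P) + lconst (- a / (b - a)) * (wb * P')"
  shows "supp E (- int m) (int m)" "lk E (- int m) = 1"
    "\<And>n. - int m < n \<Longrightarrow> n \<le> int m \<Longrightarrow> L (E * zpow (- n)) = 0"
proof -
  interpret S: refl_functional b a ell by (rule swap)
  note e = wa_ends[OF P] and e' = S.wa_ends[OF P']
  have "supp E (- int m) (int m + 1)"
    unfolding E_def using e(1) e'(1) by (intro supp_add supp_lconst)
  moreover have "lk E (int m + 1) = 0"
    unfolding E_def by (simp only: lk_lconst_mult lookup_add e(3) e'(3)) simp
  ultimately show "supp E (- int m) (int m)"
    using supp_right[of E "- int m" "int m + 1"] by simp
  have "b / (b - a) + - a / (b - a) = (b + - a) / (b - a)" by (rule add_divide_distrib[symmetric])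
  also have "\<dots> = 1" using neq by simp
  finally have "b / (b - a) + - a / (b - a) = 1" .
  then show "lk E (- int m) = 1"
    unfolding E_def by (simp only: lk_lconst_mult lookup_add e(2) e'(2) mult_1_right)
  show "L (E * zpow (- n)) = 0" if "- int m < n" "n \<le> int m" for n
    unfolding E_def L_plus L_lconst using e(4)[OF that] e'(4)[OF that] by simp
qed

text \<open>P and R both have coefficient 1 at the lowest end, so their difference loses it. At the
  upper end the coefficients are 1 and a b, which explains the divisor 1 - a b.\<close>

lemma E_pos_eq:
  assumes P: "monic_orth L (int m + 1) P" and P': "monic_orth (\<lambda>f. L (wa * wb * f)) (int m) P'"
  defines "R \<equiv> zpow (- 1) * (wa * (wb * P'))"
  defines "E \<equiv> lconst (1 / (1 - a * b)) * P + lconst (- 1 / (1 - a * b)) * R"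
  shows "supp E (- int m) (int m + 1)" "lk E (int m + 1) = 1"
    "\<And>n. - (int m + 1) < n \<Longrightarrow> n < int m + 1 \<Longrightarrow> L (E * zpow (- n)) = 0"
proof -
  note r = wab_ends[OF P', folded R_def]
  have P1: "monic_orth L (int (Suc m)) P" using P by (simp add: add.commute)
  note e = monic_orth_lk[OF P]
  have "supp E (- (int m + 1)) (int m + 1)"
    unfolding E_def using e(4) r(1) by (intro supp_add supp_lconst)
  moreover have "lk E (- (int m + 1)) = 0"
    unfolding E_def by (simp only: lk_lconst_mult lookup_add e(2) r(2) mult_1_right flip: add_divide_distrib)
       simp
  ultimately show "supp E (- int m) (int m + 1)"
    using supp_left[of E "- (int m + 1)" "int m + 1"] by simp
  have "1 / (1 - a * b) + - 1 / (1 - a * b) * (a * b) = 1" using ab by (simp add: field_simps)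
  then show "lk E (int m + 1) = 1"
    unfolding E_def by (simp only: lk_lconst_mult lookup_add e(1) r(3) mult_1_right)
  show "L (E * zpow (- n)) = 0" if "- (int m + 1) < n" "n < int m + 1" for n
  proof -
    have "L (P * zpow (- n)) = 0" by (rule orth_1(1)[OF P1]) (use that in auto)
    then show ?thesis unfolding E_def L_plus L_lconst using r(4)[OF that] by simp
  qed
qed

end

section \<open>The dual substitution and the norm ratios\<close>

lemma functional_scale_rfl:
  fixes ell ell' :: "int \<Rightarrow> K"
  assumes s: "s \<noteq> 0" and ell': "\<And>n. ell' n = s powi n * ell (- n)"
  shows "functional (\<lambda>x. x) ell (scale_rfl s f * zpow k) = s powi k * functional (\<lambda>x. x) ell' (f * zpow (- k))"
proof -
  let ?L = "functional (\<lambda>x. x) ell" and ?L' = "functional (\<lambda>x. x) ell'"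
  have "?L (scale_rfl s f * zpow k) =
      ?L (\<Sum>n\<in>Poly_Mapping.keys f. lconst (lk f n * s powi n) * zpow (- n + k))"
    unfolding scale_rfl_def sum_distrib_right mult.assoc zpow_mult ..
  also have "\<dots> = (\<Sum>n\<in>Poly_Mapping.keys f. lk f n * s powi n * ell (- n + k))"
    by (simp add: linear_fun_sum[OF linear_fun_functional] linear_fun_lconst[OF linear_fun_functional] functional_zpow field_hom_id)
  also have "\<dots> = (\<Sum>n\<in>Poly_Mapping.keys f. s powi k * (lk f n * ?L' (zpow (- k) * zpow n)))"
  proof (rule sum.cong[OF refl])
    fix n
    have "s powi n = s powi k * s powi (- k + n)" using s by (simp flip: power_int_add)
    then show "lk f n * s powi n * ell (- n + k) = s powi k * (lk f n * ?L' (zpow (- k) * zpow n))"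
      by (simp add: zpow_mult functional_zpow field_hom_id ell')
  qed
  also have "\<dots> = s powi k * ?L' (zpow (- k) * f)"
    by (simp add: linear_fun_mult_expand[OF linear_fun_functional, of ell' "zpow (- k)" f] sum_distrib_left)
  finally show ?thesis by (simp only: mult.commute[of f])
qed

text \<open>
  The substitution \<open>z \<mapsto> s/z\<close> with \<open>s = q\<^sup>1\<^sup>/\<^sup>2\<close> exchanges \<open>(a, b)\<close> with
  \<open>(g, h) = (c/s, d/s)\<close> and yields a second reflection relation.
\<close>

locale dual_functionals = refl_functional a b ell + D: refl_functional g h ell'
  for a b :: K and ell and g h :: K and ell' +
  fixes s :: K
  assumes s: "s \<noteq> 0" and ell': "\<And>n. ell' n = s powi n * ell (- n)" and a_neq_b: "a \<noteq> b"
begin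

lemma L_scale_rfl: "L (scale_rfl s f * zpow k) = s powi k * D.L (f * zpow (- k))"
  unfolding L_def D.L_def using s ell' by (rule functional_scale_rfl)

text \<open>The dual element f is expanded in the basis \<open>wa * P\<close>,
  \<open>wb * P'\<close>. Its pairings at the two ends are known multiples of the dual norm
  \<kappa>; eliminating \<kappa> relates the two norms. Here q denotes s^(2 m), that is q^m, and g
  s, h s are c, d.\<close>

lemma norm_ratio_wa_wb:
  assumes P: "monic_orth (\<lambda>f. L (wa * f)) (int m) P" and P': "monic_orth (\<lambda>f. L (wb * f)) (int m) P'"
  defines "q \<equiv> s ^ (2 * m)"
  shows "L (wa * P * zpow (int m)) * (1 - b * (g * s) * q) * (1 - b * (h * s) * q) =
         L (wb * P' * zpow (int m)) * (1 - a * (g * s) * q) * (1 - a * (h * s) * q)"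
proof -
  interpret S: refl_functional b a ell by (rule swap)
  define \<nu> where "\<nu> = L (wa * P * zpow (int m))"
  define \<nu>' where "\<nu>' = L (wb * P' * zpow (int m))"
  note e = wa_ends[OF P, folded \<nu>_def] and e' = S.wa_ends[OF P', folded \<nu>'_def]
  obtain T where T: "monic_orth (\<lambda>f. D.L (D.wa * f)) (int m) T"
    using monic_orth_exists[OF linear_fun_mult[OF D.linear_fun_L] D.sym_nondegenerate_wa, of "int m"] by auto
  define \<kappa> where "\<kappa> = D.L (D.wa * T * zpow (int m))"
  note t = D.wa_ends[OF T, folded \<kappa>_def]
  \<comment> \<open>The substitution s/z moves the support -m, ..., m + 1 to -m - 1, ..., m; the
    factor z moves it back, and s^m makes the top coefficient 1.\<close>
  define f where "f = lconst (s ^ m) * (zpow 1 * scale_rfl s (D.wa * T))"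
  have lkf: "lk f n = s ^ m * (s powi (1 - n) * lk (D.wa * T) (1 - n))" for n
    unfolding f_def lk_lconst_mult lk_zpow_mult lk_scale_rfl[OF s] by simp
  have sm: "s powi (1 + int m) = s * s ^ m" "s powi (- int m) = inverse (s ^ m)"
    "s powi (int m + 1) = s * s ^ m"
    using s by (simp_all add: power_int_add power_int_minus)
  have f1: "supp f (- int m) (int m + 1)"
    by (rule suppI) (auto simp: lkf suppD[OF t(1)])
  have f2: "lk f (- int m) = - (g * s) * q"
    using t(3) by (simp add: lkf sm q_def power_add mult_2 add.commute)
  have f3: "lk f (int m + 1) = 1"
    using t(2) s by (simp add: lkf sm)
  have Lf: "L (f * zpow (- n)) = s ^ m * (s powi (1 - n) * D.L (D.wa * T * zpow (- (1 - n))))" for n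
    unfolding f_def L_lconst L_shift' L_scale_rfl by simp
  have f4: "L (f * zpow (- n)) = 0" if "- int m < n" "n < int m + 1" for n
    unfolding Lf using t(4)[of "1 - n"] that by simp
  have f5: "L (f * zpow (- (int m + 1))) = \<kappa>"
    unfolding Lf using s by (simp add: sm \<kappa>_def)
  have f6: "L (f * zpow (- (- int m))) = h * s * q * \<kappa>"
  proof -
    have "q = s ^ m * s ^ m" by (simp add: q_def mult_2 power_add)
    moreover have "- (1 - - int m) = - (int m + 1)" "1 - - int m = 1 + int m" by simp_all
    then have "L (f * zpow (- (- int m))) = s ^ m * (s powi (1 + int m) * (h * \<kappa>))"
      using Lf[of "- int m"] t(5) by (simp only:)
    ultimately show ?thesis by (simp add: sm)
  qed
  \<comment> \<open>Solution of x + y = -g s q and -a x - b y = 1, the comparison of the end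
    coefficients.\<close>
  define x where "x = (1 - b * (g * s) * q) / (b - a)"
  define y where "y = - (1 - a * (g * s) * q) / (b - a)"
  have ba: "b - a \<noteq> 0" using a_neq_b by simp
  have x: "(b - a) * x = 1 - b * (g * s) * q" and y: "(b - a) * y = - (1 - a * (g * s) * q)"
    using ba by (simp_all add: x_def y_def)
  have "(b - a) * (x + y) = (b - a) * x + (b - a) * y"
    "(b - a) * (- a * x - b * y) = - a * ((b - a) * x) - b * ((b - a) * y)"
    by (simp_all add: algebra_simps)
  then have "(b - a) * (x + y) = (b - a) * (- (g * s) * q)" "(b - a) * (- a * x - b * y) = (b - a) * 1"
    unfolding x y by (simp_all add: algebra_simps)
  then have xy: "x + y = - (g * s) * q" "- a * x - b * y = 1"
    by (simp_all only: mult_left_cancel[OF ba])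
  have "f = lconst x * (wa * P) + lconst y * (wb * P')"
  proof (rule eq_by_ends[where i = "- int m" and j = "int m + 1"])
    show "supp (lconst x * (wa * P) + lconst y * (wb * P')) (- int m) (int m + 1)"
      using e(1) e'(1) by (intro supp_add supp_lconst)
    show "lk f (- int m) = lk (lconst x * (wa * P) + lconst y * (wb * P')) (- int m)"
      unfolding lookup_add lk_lconst_mult e(2) e'(2) f2 using xy(1) by simp
    show "lk f (int m + 1) = lk (lconst x * (wa * P) + lconst y * (wb * P')) (int m + 1)"
      unfolding lookup_add lk_lconst_mult e(3) e'(3) f3 using xy(2) by (simp add: mult.commute)
    show "L (f * zpow (- n)) = L ((lconst x * (wa * P) + lconst y * (wb * P')) * zpow (- n))"
      if "- int m < n" "n < int m + 1" for n
      unfolding L_plus L_lconst using f4[OF that] e(4)[of n] e'(4)[of n] that by simp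
  qed (rule f1)
  then have Lf': "L (f * zpow k) = x * L (wa * P * zpow k) + y * L (wb * P' * zpow k)" for k
    by (simp only: L_plus L_lconst)
  \<comment> \<open>The pairings at the lower and the upper end of the support; \<kappa> is the only
    other unknown.\<close>
  have 1: "x * \<nu> + y * \<nu>' = h * s * q * \<kappa>"
    using f6 unfolding minus_minus Lf' \<nu>_def \<nu>'_def by simp
  have 2: "x * (b * \<nu>) + y * (a * \<nu>') = \<kappa>"
    using f5 unfolding Lf' e(5) e'(5) by simp
  have "x * \<nu> + y * \<nu>' = h * s * q * (x * (b * \<nu>) + y * (a * \<nu>'))"
    unfolding 2 by (rule 1)
  then have "(b - a) * (x * \<nu> * (1 - b * (h * s) * q) + y * \<nu>' * (1 - a * (h * s) * q)) = 0"
    by (simp add: algebra_simps)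
  then have "((b - a) * x) * \<nu> * (1 - b * (h * s) * q) + ((b - a) * y) * \<nu>' * (1 - a * (h * s) * q) = 0"
    by (simp add: algebra_simps)
  then show ?thesis unfolding x y by (simp add: \<nu>_def \<nu>'_def algebra_simps)
qed

text \<open>Beyond the shared orthogonality, only the pairing with z^-m has to vanish. The two
  coefficients are taken proportional to the factors in \<open>norm_ratio_wa_wb\<close> so that it
  does. The top coefficient then factors as \<xi> (b - a) (1 - a b c d q^2), which dictates
  \<xi>.\<close>

lemma E_succ_eq:
  assumes P: "monic_orth (\<lambda>f. L (wa * f)) (int m) P" and P': "monic_orth (\<lambda>f. L (wb * f)) (int m) P'"
  defines "q \<equiv> s ^ (2 * m)" and "c \<equiv> g * s" and "d \<equiv> h * s"
  assumes den: "a * b * c * d * q\<^sup>2 \<noteq> 1"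
  defines "\<xi> \<equiv> 1 / ((b - a) * (1 - a * b * c * d * q\<^sup>2))"
  defines "E \<equiv> lconst (\<xi> * ((1 - b * c * q) * (1 - b * d * q))) * (wa * P) +
     lconst (- (\<xi> * ((1 - a * c * q) * (1 - a * d * q)))) * (wb * P')"
  shows "supp E (- int m) (int m + 1)" "lk E (int m + 1) = 1"
    "\<And>n. - int m \<le> n \<Longrightarrow> n \<le> int m \<Longrightarrow> L (E * zpow (- n)) = 0"
proof -
  interpret S: refl_functional b a ell by (rule swap)
  note e = wa_ends[OF P] and e' = S.wa_ends[OF P']
  show "supp E (- int m) (int m + 1)"
    unfolding E_def using e(1) e'(1) by (intro supp_add supp_lconst)
  have "(b - a) * (1 - a * b * c * d * q\<^sup>2) \<noteq> 0" using den a_neq_b by simp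
  then have x: "\<xi> * ((b - a) * (1 - a * b * c * d * q\<^sup>2)) = 1" by (simp add: \<xi>_def)
  have "\<xi> * ((1 - b * c * q) * (1 - b * d * q)) * - a + - (\<xi> * ((1 - a * c * q) * (1 - a * d * q))) * - b =
      \<xi> * ((b - a) * (1 - a * b * c * d * q\<^sup>2))"
    by (simp add: algebra_simps power2_eq_square)
  with x show "lk E (int m + 1) = 1"
    unfolding E_def by (simp only: lk_lconst_mult lookup_add e(3) e'(3))
  show "L (E * zpow (- n)) = 0" if "- int m \<le> n" "n \<le> int m" for n
  proof (cases "n = - int m")
    case True
    have "L (E * zpow (- n)) = \<xi> * (L (wa * P * zpow (int m)) * (1 - b * (g * s) * q) * (1 - b * (h * s) * q)) -
       \<xi> * (L (wb * P' * zpow (int m)) * (1 - a * (g * s) * q) * (1 - a * (h * s) * q))"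
      unfolding E_def L_plus L_lconst True by (simp add: c_def d_def mult_ac)
    then show ?thesis using norm_ratio_wa_wb[OF P P'] by (simp add: q_def)
  next
    case False
    then show ?thesis
      unfolding E_def L_plus L_lconst using that e(4)[of n] e'(4)[of n] by simp
  qed
qed

text \<open>The same elimination with the dual symmetric polynomial, whose image T(s/z) already has
  symmetric support. Here q denotes s^(2 (m + 1)), the power that belongs to the degree m + 1 of
  P.\<close>

lemma norm_ratio_1_wab:
  assumes P: "monic_orth L (int m + 1) P" and P': "monic_orth (\<lambda>f. L (wa * wb * f)) (int m) P'"
  defines "R \<equiv> zpow (- 1) * (wa * (wb * P'))" and "q \<equiv> s ^ (2 * (m + 1))"
  shows "(1 - a * b * q) * (1 - a * b * g * h * q) * L (P * zpow (int m + 1)) =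
     (1 - q) * (1 - g * h * q) * L (R * zpow (int m + 1))"
proof -
  define n where "n = m + 1"
  have n: "int m + 1 = int n" "n \<ge> 1" by (auto simp: n_def)
  define \<nu> where "\<nu> = L (R * zpow (int n))"
  define \<kappa> where "\<kappa> = L (P * zpow (int n))"
  note r = wab_ends[OF P', folded R_def, unfolded n, folded \<nu>_def]
  note P1 = P[unfolded n]
  note e = monic_orth_lk[OF P1]
  obtain T where T: "monic_orth D.L (int n) T"
    using monic_orth_exists[OF D.linear_fun_L D.sym_nondegenerate_1, of "int n"] by auto
  note t = monic_orth_lk[OF T]
  define \<kappa>' where "\<kappa>' = D.L (T * zpow (int n))"
  define f where "f = lconst (s ^ n) * scale_rfl s T"
  have lkf: "lk f k = s ^ n * (s powi (- k) * lk T (- k))" for k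
    unfolding f_def lk_lconst_mult lk_scale_rfl[OF s] by simp
  have sn: "s powi (- int n) = inverse (s ^ n)" using s by (simp add: power_int_minus)
  have q: "q = s ^ n * s ^ n" by (simp add: q_def n_def mult_2 flip: power_add)
  have f1: "supp f (- int n) (int n)"
    by (rule suppI) (auto simp: lkf suppD[OF t(4)])
  have f2: "lk f (- int n) = q" using t(1) by (simp add: lkf q)
  have f3: "lk f (int n) = 1" using t(2) s by (simp add: lkf sn)
  have Lf: "L (f * zpow (- k)) = s ^ n * (s powi (- k) * D.L (T * zpow k))" for k
    unfolding f_def L_lconst L_scale_rfl by simp
  have f4: "L (f * zpow (- k)) = 0" if "- int n < k" "k < int n" for k
    unfolding Lf using D.orth_1(1)[OF T that] by simp
  have f5: "L (f * zpow (- int n)) = \<kappa>'" unfolding Lf using s by (simp add: sn \<kappa>'_def)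
  have f6: "L (f * zpow (- (- int n))) = - g * h * q * \<kappa>'"
    unfolding Lf using D.orth_1(2)[OF T n(2)] by (simp add: q \<kappa>'_def)
  \<comment> \<open>Solution of x + y = q and x + a b y = 1, from the end coefficients.\<close>
  define x where "x = (1 - a * b * q) / (1 - a * b)"
  define y where "y = (q - 1) / (1 - a * b)"
  have ab': "1 - a * b \<noteq> 0" using ab by simp
  have x: "(1 - a * b) * x = 1 - a * b * q" and y: "(1 - a * b) * y = q - 1"
    using ab' by (simp_all add: x_def y_def)
  have "(1 - a * b) * (x + y) = (1 - a * b) * q" "(1 - a * b) * (x + a * b * y) = (1 - a * b) * 1"
    using x y by (simp_all add: distrib_left mult.left_commute[of "1 - a * b"]) (simp_all add: algebra_simps)
  then have xy: "x + y = q" "x + a * b * y = 1" using ab' by auto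
  have "f = lconst x * P + lconst y * R"
  proof (rule eq_by_ends[where i = "- int n" and j = "int n"])
    show "supp (lconst x * P + lconst y * R) (- int n) (int n)"
      using e(4) r(1) by (intro supp_add supp_lconst)
    show "lk f (- int n) = lk (lconst x * P + lconst y * R) (- int n)"
      unfolding lookup_add lk_lconst_mult e(2) r(2) f2 using xy(1) by simp
    show "lk f (int n) = lk (lconst x * P + lconst y * R) (int n)"
      unfolding lookup_add lk_lconst_mult e(1) r(3) f3 using xy(2) by (simp add: mult.commute)
    show "L (f * zpow (- k)) = L ((lconst x * P + lconst y * R) * zpow (- k))"
      if "- int n < k" "k < int n" for k
    proof -
      have "L (P * zpow (- k)) = 0" by (rule orth_1(1)[OF P1]) (use that in auto)
      then show ?thesis unfolding L_plus L_lconst using f4[OF that] r(4)[OF that] by simp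
    qed
  qed (rule f1)
  then have Lf': "L (f * zpow k) = x * L (P * zpow k) + y * L (R * zpow k)" for k
    by (simp only: L_plus L_lconst)
  have 1: "x * \<kappa> + y * \<nu> = - g * h * q * \<kappa>'"
    using f6 unfolding minus_minus Lf' \<nu>_def \<kappa>_def by simp
  have 2: "x * (- a * b * \<kappa>) - y * \<nu> = \<kappa>'"
    using f5 unfolding Lf' orth_1(2)[OF P1 n(2)] r(5) by (simp add: \<kappa>_def)
  have "x * \<kappa> + y * \<nu> = - g * h * q * (x * (- a * b * \<kappa>) - y * \<nu>)"
    unfolding 2 by (rule 1)
  then have "(1 - a * b) * (x * \<kappa> * (1 - a * b * g * h * q) + y * \<nu> * (1 - g * h * q)) = 0"
    by (simp add: algebra_simps)
  then have "((1 - a * b) * x) * \<kappa> * (1 - a * b * g * h * q) + ((1 - a * b) * y) * \<nu> * (1 - g * h * q) = 0"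
    by (simp add: algebra_simps)
  then show ?thesis unfolding x y n \<nu>_def[symmetric] \<kappa>_def[symmetric] by (simp add: algebra_simps)
qed

text \<open>The remaining condition is the pairing with z^(m+1), where P contributes -a b times its
  norm and R minus its norm; hence the extra factor a b in the second coefficient. The coefficient
  at the lowest end then factors as \<xi> (1 - a b) (1 - a b g h q^2).\<close>

lemma E_neg_Koornwinder_eq:
  assumes P: "monic_orth L (int m + 1) P" and P': "monic_orth (\<lambda>f. L (wa * wb * f)) (int m) P'"
  defines "R \<equiv> zpow (- 1) * (wa * (wb * P'))" and "q \<equiv> s ^ (2 * (m + 1))"
  assumes den: "a * b * g * h * q\<^sup>2 \<noteq> 1"
  defines "\<xi> \<equiv> 1 / ((1 - a * b) * (1 - a * b * g * h * q\<^sup>2))"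
  defines "E \<equiv> lconst (\<xi> * ((1 - a * b * q) * (1 - a * b * g * h * q))) * P +
     lconst (- (\<xi> * (a * b * (1 - q) * (1 - g * h * q)))) * R"
  shows "supp E (- (int m + 1)) (int m + 1)" "lk E (- (int m + 1)) = 1"
    "\<And>n. - (int m + 1) < n \<Longrightarrow> n \<le> int m + 1 \<Longrightarrow> L (E * zpow (- n)) = 0"
proof -
  note r = wab_ends[OF P', folded R_def]
  have P1: "monic_orth L (int (Suc m)) P" using P by (simp add: add.commute)
  note e = monic_orth_lk[OF P]
  show "supp E (- (int m + 1)) (int m + 1)"
    unfolding E_def using e(4) r(1) by (intro supp_add supp_lconst)
  have "(1 - a * b) * (1 - a * b * g * h * q\<^sup>2) \<noteq> 0" using den ab by simp
  then have x: "\<xi> * ((1 - a * b) * (1 - a * b * g * h * q\<^sup>2)) = 1" by (simp add: \<xi>_def)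
  have "\<xi> * ((1 - a * b * q) * (1 - a * b * g * h * q)) * 1 + - (\<xi> * (a * b * (1 - q) * (1 - g * h * q))) * 1 =
      \<xi> * ((1 - a * b) * (1 - a * b * g * h * q\<^sup>2))"
    by (simp add: algebra_simps power2_eq_square)
  with x show "lk E (- (int m + 1)) = 1"
    unfolding E_def by (simp only: lk_lconst_mult lookup_add e(2) r(2))
  show "L (E * zpow (- n)) = 0" if "- (int m + 1) < n" "n \<le> int m + 1" for n
  proof (cases "n = int m + 1")
    case True
    have pP: "L (P * zpow (- (int m + 1))) = - a * b * L (P * zpow (int m + 1))"
      using orth_1(2)[OF P1] by (simp add: add.commute)
    have "L (E * zpow (- n)) = - \<xi> * a * b *
       ((1 - a * b * q) * (1 - a * b * g * h * q) * L (P * zpow (int m + 1)) -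
        (1 - q) * (1 - g * h * q) * L (R * zpow (int m + 1)))"
      unfolding E_def L_plus L_lconst True pP r(5) by (simp add: algebra_simps)
    then show ?thesis using norm_ratio_1_wab[OF P P'] by (simp add: q_def R_def)
  next
    case False
    have "L (P * zpow (- n)) = 0" by (rule orth_1(1)[OF P1]) (use that False in auto)
    then show ?thesis
      unfolding E_def L_plus L_lconst using r(4)[of n] that False by simp
  qed
qed

end

section \<open>The normalized moments of the weight\<close>

abbreviation weight0 :: uv_series where "weight0 \<equiv> wt F_a 0 F_b 0 F_gamma F_delta"

text \<open>The constant term of \<open>z\<^sup>n \<Delta>\<close>.\<close>

definition wmoment :: "int \<Rightarrow> F fls" where
  "wmoment n = zcoeff weight0 (- n)"

definition K_g :: K where "K_g = K_c / K_sq"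
definition K_h :: K where "K_h = K_d / K_sq"

lemma K_emb_g: "K_emb K_g = fls_const F_gamma" and K_emb_h: "K_emb K_h = fls_const F_delta"
  unfolding K_g_def K_h_def field_hom_divide[OF field_hom_K_emb] K_emb_c K_emb_d K_emb_sq
  by (rule nonzero_mult_div_cancel_right, simp)+

lemmas K_emb_simps = field_hom_add[OF field_hom_K_emb] field_hom_mult[OF field_hom_K_emb]
  field_hom_uminus[OF field_hom_K_emb] field_hom_diff[OF field_hom_K_emb] field_hom_0[OF field_hom_K_emb]
  field_hom_1[OF field_hom_K_emb] field_hom_power[OF field_hom_K_emb] field_hom_inverse[OF field_hom_K_emb]
  field_hom_sum[OF field_hom_K_emb]

lemma wmoment_refl:
  "wmoment (n - 1) - K_emb (K_a + K_b) * wmoment n + K_emb (K_a * K_b) * wmoment (n + 1) =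
    - (wmoment (- n - 1) - K_emb (K_a + K_b) * wmoment (- n) + K_emb (K_a * K_b) * wmoment (1 - n))"
proof -
  have i: "- (n - 1) = 1 - n" "- (n + 1) = - 1 - n" "- (- n - 1) = 1 + n" "- (- n) = n" "- (1 - n) = n - 1"
    by simp_all
  show ?thesis
    unfolding wmoment_def i field_hom_add[OF field_hom_K_emb] field_hom_mult[OF field_hom_K_emb] K_emb_a K_emb_b
    by (rule wt_antisymmetric)
qed

text \<open>\<open>v n\<close> is the n-th moment of the weight after z -> q^(1/2)/z, which is a
  weight of the same shape with parameters (\<gamma>, \<delta>) in place of (a, b).\<close>

lemma wmoment_refl_dual:
  defines "v \<equiv> \<lambda>n. K_emb (K_sq powi n) * wmoment (- n)"
  shows "v (n - 1) - K_emb (K_g + K_h) * v n + K_emb (K_g * K_h) * v (n + 1) =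
    - (v (- n - 1) - K_emb (K_g + K_h) * v (- n) + K_emb (K_g * K_h) * v (1 - n))"
proof -
  have pw: "K_emb (K_sq powi n) = fls_X_intpow n" for n
  proof (cases "n \<ge> 0")
    case True
    then obtain k where "n = int k" by (metis nonneg_int_cases)
    then show ?thesis by (simp add: K_emb_simps K_emb_sq fls_X_power_conv_shift_1)
  next
    case False
    then obtain k where "n = - int k" by (metis int_cases2 nle_le of_nat_0_le_iff)
    then show ?thesis
      by (simp add: power_int_minus K_emb_simps K_emb_sq fls_X_power_conv_shift_1 fls_inverse_shift)
  qed
  have v: "v n = zcoeff (wt F_gamma 0 F_delta 0 F_a F_b) (- n)" for n
    unfolding swap_wt[of F_a F_b F_gamma F_delta, symmetric] zcoeff_swap v_def pw wmoment_def minus_minus ..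
  have i: "- (n - 1) = 1 - n" "- (n + 1) = - 1 - n" "- (- n - 1) = 1 + n" "- (- n) = n" "- (1 - n) = n - 1"
    by simp_all
  show ?thesis
    unfolding v i field_hom_add[OF field_hom_K_emb] field_hom_mult[OF field_hom_K_emb] K_emb_g K_emb_h
    by (rule wt_antisymmetric)
qed

lemma wmoment_nth: "fls_nth (wmoment n) k = 0" if "k < 0 \<or> k = 0 \<and> n > 0"
  unfolding wmoment_def by (rule zcoeff_wt_nth_0) (use that in auto)

lemma wmoment_0_nth_0: "fls_nth (wmoment 0) 0 = 1"
  by (simp add: wmoment_def zcoeff_wt_0_nth_0)

lemma wmoment_0_neq_0: "wmoment 0 \<noteq> 0"
  using wmoment_0_nth_0 by auto

text \<open>
  The two reflection relations at \<open>n\<close> are linear equations for the moments of index \<open>n + 1\<close> and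
  \<open>- n - 1\<close>, with determinant \<open>1 - a b c d q\<^sup>n\<close>.
\<close>

lemma wmoment_rational: "\<exists>k. wmoment n = K_emb k * wmoment 0"
proof -
  define J where "J x \<longleftrightarrow> (\<exists>k. x = K_emb k * wmoment 0)" for x
  have J0: "J (wmoment 0)" unfolding J_def by (rule exI[of _ 1]) (simp add: K_emb_simps)
  have Jadd: "J (x + y)" if "J x" "J y" for x y
  proof -
    from that obtain k l where "x = K_emb k * wmoment 0" "y = K_emb l * wmoment 0" unfolding J_def by blast
    then have "x + y = K_emb (k + l) * wmoment 0"
      by (simp only: field_hom_add[OF field_hom_K_emb] distrib_right)
    then show ?thesis unfolding J_def by blast
  qed
  have Jm: "J (K_emb k * x)" if "J x" for k x
  proof -
    from that obtain l where "x = K_emb l * wmoment 0" unfolding J_def by blast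
    then have "K_emb k * x = K_emb (k * l) * wmoment 0"
      by (simp only: field_hom_mult[OF field_hom_K_emb] mult.assoc)
    then show ?thesis unfolding J_def by blast
  qed
  have Jneg: "J (- x)" if "J x" for x
    using Jm[OF that, of "- 1"] by (simp add: K_emb_simps)
  have Jdiff: "J (x - y)" if "J x" "J y" for x y
    using Jadd[OF that(1) Jneg[OF that(2)]] by simp
  \<comment> \<open>Cramer's rule inside the \<open>K\<close>-span of
    \<open>wmoment 0\<close>.\<close>
  have solve: "J x \<and> J y"
    if U: "J (K_emb r * x + y)" and V: "J (x + K_emb p * y)" and nz: "1 - p * r \<noteq> 0" for p r x y
  proof -
    have "J ((x + K_emb p * y) - K_emb p * (K_emb r * x + y))"
      by (intro Jdiff Jm U V)
    moreover have "(x + K_emb p * y) - K_emb p * (K_emb r * x + y) = K_emb (1 - p * r) * x"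
      by (simp add: K_emb_simps algebra_simps)
    ultimately have "J (K_emb (inverse (1 - p * r)) * (K_emb (1 - p * r) * x))" using Jm by metis
    moreover have "K_emb (inverse (1 - p * r)) * (K_emb (1 - p * r) * x) = x"
      using nz by (simp add: field_hom_inverse[OF field_hom_K_emb] field_hom_eq_0[OF field_hom_K_emb] flip: mult.assoc)
    ultimately have x: "J x" by simp
    have "J ((K_emb r * x + y) - K_emb r * x)" by (intro Jdiff Jm U x)
    with x show ?thesis by simp
  qed
  have nz: "1 - (K_g * K_h * K_sq ^ (2 * n + 2)) * (K_a * K_b) \<noteq> 0" for n
  proof -
    have "(K_g * K_h * K_sq ^ (2 * n + 2)) * (K_a * K_b) = K_a * K_b * K_c * K_d * K_q ^ n"
      by (simp add: K_g_def K_h_def K_q_def K_gen_neq_0 power_add power_mult power2_eq_square)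
    then show ?thesis using K_generic(3)[of n] by (metis eq_iff_diff_eq_0)
  qed
  \<comment> \<open>With X = q^(1/2) and Y = X^n, multiplying the dual relation by X Y removes the
    negative powers.\<close>
  have clear: "t + G * (Y * Y * X * X) * r = S * X * u + S * (Y * Y * X) * q - Y * Y * p - G * (X * X) * v"
    if "X \<noteq> 0" "Y \<noteq> 0"
      and eq: "Y / X * p - S * (Y * q) + G * (Y * X * r) = - (1 / (Y * X) * t - S * (1 / Y * u) + G * (X / Y * v))"
    for X Y p q r t u v S G :: "F fls"
  proof -
    have e: "Y * X * (Y / X * p - S * (Y * q) + G * (Y * X * r)) = Y * Y * p - S * (Y * Y * X) * q + G * (Y * Y * X * X) * r"
      "Y * X * - (1 / (Y * X) * t - S * (1 / Y * u) + G * (X / Y * v)) = - (t - S * X * u + G * (X * X) * v)"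
      using that(1,2) by (simp_all add: distrib_left right_diff_distrib)
    have "Y * Y * p - S * (Y * Y * X) * q + G * (Y * Y * X * X) * r = - (t - S * X * u + G * (X * X) * v)"
      unfolding e[symmetric] eq ..
    then show ?thesis by (simp add: algebra_simps eq_neg_iff_add_eq_0)
  qed
  have two: "(2 :: F fls) \<noteq> 0" by simp
  let ?s = "K_sq"
  have U: "K_emb (K_a * K_b) * wmoment (int n + 1) + wmoment (- int n - 1) =
      K_emb (K_a + K_b) * (wmoment (int n) + wmoment (- int n)) - wmoment (int n - 1)
        - K_emb (K_a * K_b) * wmoment (1 - int n)" for n
    using wmoment_refl[of "int n"] by (simp add: algebra_simps eq_neg_iff_add_eq_0)
  have V: "wmoment (int n + 1) + K_emb (K_g * K_h * ?s ^ (2 * n + 2)) * wmoment (- int n - 1) =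
      K_emb ((K_g + K_h) * ?s) * wmoment (int n) + K_emb ((K_g + K_h) * ?s ^ (2 * n + 1)) * wmoment (- int n)
      - K_emb (?s ^ (2 * n)) * wmoment (1 - int n) - K_emb (K_g * K_h * ?s\<^sup>2) * wmoment (int n - 1)" for n
  proof -
    have s: "K_emb (?s powi k) = K_emb ?s powi k" for k
      by (cases k rule: int_cases2) (simp_all add: power_int_minus K_emb_simps)
    have X: "K_emb ?s \<noteq> 0" by (simp add: K_emb_sq)
    define X where "X = K_emb ?s"
    have X0: "X \<noteq> 0" by (simp add: X_def K_emb_sq)
    define w where "w = wmoment"
    have p: "X powi (int n - 1) = X ^ n / X" "X powi (int n) = X ^ n" "X powi (int n + 1) = X ^ n * X"
      "X powi (- int n - 1) = 1 / (X ^ n * X)" "X powi (- int n) = 1 / X ^ n" "X powi (1 - int n) = X / X ^ n"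
      using X0 by (simp_all add: power_int_diff power_int_add power_int_minus divide_inverse)
    have "X ^ n / X * w (1 - int n) - K_emb (K_g + K_h) * (X ^ n * w (- int n)) +
         K_emb (K_g * K_h) * (X ^ n * X * w (- int n - 1)) =
       - (1 / (X ^ n * X) * w (int n + 1) - K_emb (K_g + K_h) * (1 / X ^ n * w (int n)) +
         K_emb (K_g * K_h) * (X / X ^ n * w (int n - 1)))"
      using wmoment_refl_dual[of "int n"] unfolding s X_def[symmetric] p w_def[symmetric] minus_minus
        minus_diff_eq add.commute[of _ "int n"] diff_minus_eq_add
      by (simp only: minus_diff_eq minus_add_distrib mult.assoc add.commute uminus_add_conv_diff)
    note c = clear[OF X0 _ this]
    have X2: "X ^ (2 * n) = X ^ n * X ^ n" by (simp add: mult_2 power_add)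
    show ?thesis
      unfolding K_emb_simps X_def[symmetric] w_def[symmetric] power_add power2_eq_square power_one_right X2
      using c X0 by (simp add: K_emb_simps mult_ac)
  qed
  have main: "\<forall>k\<le>n. J (wmoment (int k)) \<and> J (wmoment (- int k))" for n
  proof (induction n)
    case 0
    show ?case using J0 by simp
  next
    case (Suc n)
    have Jn: "J (wmoment (int n))" "J (wmoment (- int n))" using Suc by auto
    have "J (wmoment (int n + 1)) \<and> J (wmoment (- int n - 1))"
    proof (cases "n = 0")
      case False
      have "J (wmoment (int (n - 1))) \<and> J (wmoment (- int (n - 1)))"
        by (rule Suc[rule_format]) (rule diff_le_self)
      moreover have "int (n - 1) = int n - 1" "- int (n - 1) = 1 - int n" using False by auto
      ultimately have "J (wmoment (int n - 1))" "J (wmoment (1 - int n))" by (simp_all only:)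
      note Jn' = Jn this
      have "J (K_emb (K_a * K_b) * wmoment (int n + 1) + wmoment (- int n - 1))"
        unfolding U by (intro Jdiff Jadd Jm Jn')
      moreover have "J (wmoment (int n + 1) + K_emb (K_g * K_h * ?s ^ (2 * n + 2)) * wmoment (- int n - 1))"
        unfolding V by (intro Jdiff Jadd Jm Jn')
      ultimately show ?thesis by (rule solve[OF _ _ nz])
    next
      \<comment> \<open>At n = 0 the lower moments of the recursion coincide with the unknown ones,
        so each relation contains them twice and a factor 2 is cancelled.\<close>
      case True
      have "2 * (K_emb (K_a * K_b) * wmoment 1 + wmoment (- 1)) = 2 * (K_emb (K_a + K_b) * wmoment 0)"
        using U[of 0] by (simp add: algebra_simps)
      then have "K_emb (K_a * K_b) * wmoment 1 + wmoment (- 1) = K_emb (K_a + K_b) * wmoment 0"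
        by (simp only: mult_left_cancel[OF two])
      then have 1: "J (K_emb (K_a * K_b) * wmoment 1 + wmoment (- 1))" using J0 Jm by simp
      have "2 * (wmoment 1 + K_emb (K_g * K_h * ?s\<^sup>2) * wmoment (- 1)) = 2 * (K_emb ((K_g + K_h) * ?s) * wmoment 0)"
        using V[of 0] by (simp add: algebra_simps K_emb_simps power2_eq_square)
      then have "wmoment 1 + K_emb (K_g * K_h * ?s\<^sup>2) * wmoment (- 1) = K_emb ((K_g + K_h) * ?s) * wmoment 0"
        by (simp only: mult_left_cancel[OF two])
      then have "J (wmoment 1 + K_emb (K_g * K_h * ?s\<^sup>2) * wmoment (- 1))" using J0 Jm by simp
      moreover have "1 - (K_g * K_h * ?s\<^sup>2) * (K_a * K_b) \<noteq> 0"
        using nz[of 0] unfolding mult_0_right add_0 .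
      ultimately have "J (wmoment 1) \<and> J (wmoment (- 1))" by (rule solve[OF 1])
      with True show ?thesis by simp
    qed
    moreover have "int (Suc n) = int n + 1" "- int (Suc n) = - int n - 1" by simp_all
    ultimately have "J (wmoment (int (Suc n))) \<and> J (wmoment (- int (Suc n)))" by (simp only:)
    then show ?case using Suc le_Suc_eq by metis
  qed
  show ?thesis
    using main[of "nat \<bar>n\<bar>", rule_format, OF order_refl] unfolding J_def[symmetric]
    by (cases "n \<ge> 0") simp_all
qed

text \<open>The n-th moment divided by the zeroth, as an element of \<open>K\<close>; uniqueness is
  \<open>K_emb_cancel\<close>.\<close>

definition moment :: "int \<Rightarrow> K" where
  "moment n = (SOME k. wmoment n = K_emb k * wmoment 0)"

lemma wmoment_eq: "wmoment n = K_emb (moment n) * wmoment 0"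
  unfolding moment_def by (rule someI_ex[OF wmoment_rational])

lemma K_emb_cancel: "K_emb x * wmoment 0 = K_emb y * wmoment 0 \<Longrightarrow> x = y"
  using wmoment_0_neq_0 field_hom_eq_0[OF field_hom_K_emb, of "x - y"] by (simp add: K_emb_simps)

lemma fls_nth_sum: "fls_nth (sum f A) n = (\<Sum>x\<in>A. fls_nth (f x) n)"
  by (induction A rule: infinite_finite_induct) auto

text \<open>Let e be the lowest order in q^(1/2) among the coefficients of f and m the smallest
  exponent attaining it. In order e, the pairing with z^m sees no exponent below m by the choice of
  m and none above m by \<open>wmoment_nth\<close>, so it equals the nonzero leading term at
  m.\<close>

lemma moment_toeplitz:
  assumes supp: "supp f i j"
    and orth: "\<And>n. i \<le> n \<Longrightarrow> n \<le> j \<Longrightarrow> functional (\<lambda>x. x) moment (f * zpow (- n)) = 0"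
  shows "f = 0"
proof (rule ccontr)
  assume "f \<noteq> 0"
  define A where "A = Poly_Mapping.keys f"
  have A: "finite A" "A \<noteq> {}" using \<open>f \<noteq> 0\<close> by (auto simp: A_def)
  define u where "u k = K_emb (lk f k)" for k
  have u0: "u k \<noteq> 0" if "k \<in> A" for k
    using that by (simp add: u_def A_def field_hom_eq_0[OF field_hom_K_emb] in_keys_iff)
  define e where "e = Min ((\<lambda>k. fls_subdegree (u k)) ` A)"
  have le: "fls_nth (u k) l = 0" if "k \<in> A" "l < e" for k l
  proof -
    have "e \<le> fls_subdegree (u k)" unfolding e_def using A that by (intro Min_le) auto
    with that(2) show ?thesis by simp
  qed
  define B where "B = {k\<in>A. fls_nth (u k) e \<noteq> 0}"
  have "e \<in> (\<lambda>k. fls_subdegree (u k)) ` A" unfolding e_def using A by (intro Min_in) auto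
  then obtain k0 where "k0 \<in> A" "e = fls_subdegree (u k0)" by auto
  then have "k0 \<in> B" using u0[of k0] by (simp add: B_def)
  then have B: "finite B" "B \<noteq> {}" using A by (auto simp: B_def)
  define m where "m = Min B"
  have m: "m \<in> B" unfolding m_def using B by (rule Min_in)
  have m_le: "m \<le> k" if "k \<in> B" for k unfolding m_def using B that by (intro Min_le)
  have prod: "fls_nth (x * y) e = fls_nth x e * fls_nth y 0"
    if x: "\<And>l. l < e \<Longrightarrow> fls_nth x l = 0" and y: "\<And>l. l < 0 \<Longrightarrow> fls_nth y l = 0" for x y :: "F fls"
  proof (cases "x = 0 \<or> y = 0")
    case False
    then have "fls_subdegree x \<ge> e" "fls_subdegree y \<ge> 0"
      using x y by (meson fls_subdegree_geI nth_fls_subdegree_nonzero not_le)+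
    have "fls_nth (x * y) e = (\<Sum>l=fls_subdegree x..e - fls_subdegree y. fls_nth x l * fls_nth y (e - l))"
      by (rule fls_times_nth(2))
    also have "\<dots> = (\<Sum>l\<in>{e}. fls_nth x l * fls_nth y (e - l))"
      using \<open>fls_subdegree x \<ge> e\<close> \<open>fls_subdegree y \<ge> 0\<close>
      by (intro sum.mono_neutral_cong) (auto simp: fls_eq0_below_subdegree)
    finally show ?thesis by simp
  qed auto
  have ij: "i \<le> m" "m \<le> j" using m supp by (auto simp: B_def A_def in_keys_iff supp_def)
  have "0 = functional (\<lambda>x. x) moment (zpow (- m) * f)"
    using orth[OF ij] by (simp add: mult.commute)
  also have "\<dots> = (\<Sum>k\<in>A. lk f k * moment (k - m))"
    by (simp add: A_def linear_fun_mult_expand[OF linear_fun_functional] zpow_mult functional_zpow field_hom_id)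
  finally have "K_emb 0 * wmoment 0 = K_emb (\<Sum>k\<in>A. lk f k * moment (k - m)) * wmoment 0" by simp
  also have "\<dots> = (\<Sum>k\<in>A. u k * wmoment (k - m))"
    by (simp add: K_emb_simps sum_distrib_right u_def wmoment_eq[of "_ - _"] mult.assoc)
  finally have "0 = fls_nth (\<Sum>k\<in>A. u k * wmoment (k - m)) e" by (simp add: K_emb_simps flip: fls_eq_iff)
  also have "\<dots> = (\<Sum>k\<in>A. fls_nth (u k) e * fls_nth (wmoment (k - m)) 0)"
    unfolding fls_nth_sum by (intro sum.cong refl prod) (auto simp: le wmoment_nth)
  also have "\<dots> = (\<Sum>k\<in>A. if k = m then fls_nth (u m) e else 0)"
  proof (rule sum.cong[OF refl])
    fix k assume k: "k \<in> A"
    consider "k = m" | "k < m" | "k > m" by linarith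
    then show "fls_nth (u k) e * fls_nth (wmoment (k - m)) 0 = (if k = m then fls_nth (u m) e else 0)"
    proof cases
      case 2
      then have "k \<notin> B" using m_le by fastforce
      with 2 k show ?thesis by (simp add: B_def)
    qed (simp_all add: wmoment_0_nth_0 wmoment_nth)
  qed
  also have "\<dots> = fls_nth (u m) e" using m A by (simp add: B_def)
  finally show False using m by (simp add: B_def)
qed

definition moment_dual :: "int \<Rightarrow> K" where
  "moment_dual n = K_sq powi n * moment (- n)"

lemma moment_dual_toeplitz:
  assumes supp: "supp f i j"
    and orth: "\<And>n. i \<le> n \<Longrightarrow> n \<le> j \<Longrightarrow> functional (\<lambda>x. x) moment_dual (f * zpow (- n)) = 0"
  shows "f = 0"
proof -
  note sc = functional_scale_rfl[OF K_gen_neq_0(5), of moment_dual moment, OF moment_dual_def]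
  have "scale_rfl K_sq f = 0"
  proof (rule moment_toeplitz)
    show "supp (scale_rfl K_sq f) (- j) (- i)"
      by (rule suppI) (auto simp: lk_scale_rfl K_gen_neq_0 suppD[OF supp])
    show "functional (\<lambda>x. x) moment (scale_rfl K_sq f * zpow (- n)) = 0" if "- j \<le> n" "n \<le> - i" for n
      unfolding sc using orth[of "- n"] that by simp
  qed
  then have "K_sq powi n * lk f n = 0" for n
    using lk_scale_rfl[OF K_gen_neq_0(5), of f "- n"] by simp
  then show ?thesis by (intro laurent_eqI) (simp add: K_gen_neq_0)
qed

interpretation AW: dual_functionals K_a K_b moment K_g K_h moment_dual K_sq
proof
  show "moment (n - 1) - (K_a + K_b) * moment n + K_a * K_b * moment (n + 1) =
      - (moment (- n - 1) - (K_a + K_b) * moment (- n) + K_a * K_b * moment (1 - n))" for n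
    using wmoment_refl[of n] unfolding wmoment_eq[of "_ + _"] wmoment_eq[of "_ - _"] wmoment_eq[of n] wmoment_eq[of "- n"]
    by (intro K_emb_cancel) (simp add: K_emb_simps algebra_simps)
  show "moment_dual (n - 1) - (K_g + K_h) * moment_dual n + K_g * K_h * moment_dual (n + 1) =
      - (moment_dual (- n - 1) - (K_g + K_h) * moment_dual (- n) + K_g * K_h * moment_dual (1 - n))" for n
  proof -
    have "K_emb (K_sq powi k) * wmoment (- k) = K_emb (moment_dual k) * wmoment 0" for k
      by (simp add: moment_dual_def wmoment_eq[of "- k"] K_emb_simps mult.assoc)
    from wmoment_refl_dual[of n, unfolded this] show ?thesis
      by (intro K_emb_cancel) (simp add: K_emb_simps algebra_simps)
  qed
  show "K_a * K_b \<noteq> 1" using K_generic(2)[of 0] by simp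
  show "K_g * K_h \<noteq> 1" using K_generic(5) by (auto simp: K_g_def K_h_def K_q_def power2_eq_square field_simps)
qed (fact moment_toeplitz moment_dual_toeplitz K_gen_neq_0 moment_dual_def K_generic(1))+

section \<open>Askey--Wilson polynomials\<close>

lemma lk_laurent_star: "lk (laurent_star f) n = K_star (lk f (- n))"
proof -
  have "lk (laurent_star f) n = (\<Sum>k\<in>Poly_Mapping.keys f. if k = - n then K_star (lk f k) else 0)"
    unfolding laurent_star_def lookup_sum lookup_single by (intro sum.cong) (auto simp: when_def)
  then show ?thesis by (auto simp: in_keys_iff field_hom_0[OF field_hom_K_star])
qed

lemma laurent_star_zpow: "laurent_star (zpow n) = zpow (- n)"
  by (rule laurent_eqI)
     (auto simp: lk_laurent_star lk_zpow field_hom_0[OF field_hom_K_star] field_hom_1[OF field_hom_K_star])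

lemma laurent_star_zsym: "laurent_star (zsym n) = zsym n"
  by (rule laurent_eqI)
     (auto simp: lk_laurent_star lk_zsym field_hom_0[OF field_hom_K_star] field_hom_1[OF field_hom_K_star]
        field_hom_add[OF field_hom_K_star, of 1 1, simplified])

lemma ct_weight_functional: "ct_weight h f = functional K_emb (\<lambda>n. weight_coeff h (- n)) f"
  by (simp add: ct_weight_def functional_def)

section \<open>Weights with shifted parameters\<close>

lemma ct_weight_if:
  assumes "\<And>n. weight_coeff h (- n) = K_emb (AW.L (g * zpow n)) * wmoment 0"
  shows "ct_weight h f = K_emb (AW.L (g * f)) * wmoment 0"
  unfolding ct_weight_functional functional_def assms
    linear_fun_mult_expand[OF AW.linear_fun_L, of g f]
  by (simp only: K_emb_simps sum_distrib_right mult.assoc)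

text \<open>The monomials u and u v^2 are z and q/z, so each elementary factor of a shifted weight
  becomes a multiplication inside \<open>AW.L\<close>.\<close>

lemma zcoeff_step:
  assumes "\<And>n. zcoeff X (- n) = K_emb (AW.L (g * zpow n)) * wmoment 0" and c: "K_emb c = fls_const c'"
  shows "zcoeff ((1 - mono_uv c' 1 0) * X) (- n) = K_emb (AW.L ((1 - lconst c * zpow 1) * g * zpow n)) * wmoment 0"
    and "zcoeff ((1 - mono_uv c' 1 2) * X) (- n) =
      K_emb (AW.L ((1 - lconst (c * K_q) * zpow (- 1)) * g * zpow n)) * wmoment 0"
proof -
  have i: "- n - int 1 + int 0 = - (1 + n)" "- n - int 1 + int 2 = - (- 1 + n)" by simp_all
  show "zcoeff ((1 - mono_uv c' 1 0) * X) (- n) = K_emb (AW.L ((1 - lconst c * zpow 1) * g * zpow n)) * wmoment 0"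
    unfolding zcoeff_diff_mono_mult i assms(1) AW.L_shift K_emb_simps c
    by (simp only: left_diff_distrib mult.assoc power_0 mult_1_left)
  have q: "K_emb K_q = fls_X ^ 2" by (simp add: K_q_def K_emb_simps K_emb_sq)
  show "zcoeff ((1 - mono_uv c' 1 2) * X) (- n) =
      K_emb (AW.L ((1 - lconst (c * K_q) * zpow (- 1)) * g * zpow n)) * wmoment 0"
    unfolding zcoeff_diff_mono_mult i assms(1) AW.L_shift K_emb_simps c q
    by (simp only: left_diff_distrib mult.assoc)
qed

abbreviation wa :: laurent where "wa \<equiv> 1 - lconst K_a * zpow 1"
abbreviation wb :: laurent where "wb \<equiv> 1 - lconst K_b * zpow 1"
abbreviation wa' :: laurent where "wa' \<equiv> 1 - lconst (K_a * K_q) * zpow (- 1)"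
abbreviation wb' :: laurent where "wb' \<equiv> 1 - lconst (K_b * K_q) * zpow (- 1)"

lemma weight0_moment: "zcoeff weight0 (- n) = K_emb (AW.L (1 * zpow n)) * wmoment 0"
  using wmoment_eq[of n] unfolding wmoment_def[of n] mult_1_left AW.L_zpow .

lemma ct_weight_0: "ct_weight 0 f = K_emb (AW.L f) * wmoment 0"
proof -
  have "weight_uv 0 = weight0" by (simp add: weight_uv_eq_wt)
  then have "weight_coeff 0 (- n) = K_emb (AW.L (1 * zpow n)) * wmoment 0" for n
    unfolding weight_coeff_eq using weight0_moment[of n] by (simp only:)
  from ct_weight_if[of 0 1 f, OF this] show ?thesis by (simp only: mult_1_left)
qed

lemma wt_1:
  "wt a 1 b h c d = (1 - mono_uv a 1 0) * ((1 - mono_uv a 1 2) * wt a 0 b h c d)"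
  using wt_Suc[of a 0 b h c d] unfolding mult_0_right add_0 One_nat_def[symmetric] .

lemma axis_nth:
  "vec_nth (axis 1 1 :: nat ^ 4) 1 = 1" "vec_nth (axis 1 1 :: nat ^ 4) 2 = 0"
  "vec_nth (axis 1 1 :: nat ^ 4) 3 = 0" "vec_nth (axis 1 1 :: nat ^ 4) 4 = 0"
  "vec_nth (axis 2 1 :: nat ^ 4) 1 = 0" "vec_nth (axis 2 1 :: nat ^ 4) 2 = 1"
  "vec_nth (axis 2 1 :: nat ^ 4) 3 = 0" "vec_nth (axis 2 1 :: nat ^ 4) 4 = 0"
  by (simp_all add: axis_def)

lemma weight_uv_axis:
  "weight_uv (axis 1 1) = wt F_a 1 F_b 0 F_gamma F_delta"
  "weight_uv (axis 2 1) = wt F_a 0 F_b 1 F_gamma F_delta"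
  "weight_uv (axis 1 1 + axis 2 1) = wt F_a 1 F_b 1 F_gamma F_delta"
proof -
  show "weight_uv (axis 1 1) = wt F_a 1 F_b 0 F_gamma F_delta"
    "weight_uv (axis 2 1) = wt F_a 0 F_b 1 F_gamma F_delta"
    by (subst weight_uv_eq_wt; simp only: axis_nth)+
  show "weight_uv (axis 1 1 + axis 2 1) = wt F_a 1 F_b 1 F_gamma F_delta"
    by (subst weight_uv_eq_wt) (simp_all only: axis_nth vector_add_component add_0 add_0_right)
qed

lemma ct_weight_1: "ct_weight (axis 1 1) f = K_emb (AW.L (wa * (wa' * 1) * f)) * wmoment 0"
proof (rule ct_weight_if)
  fix n
  note s = zcoeff_step(2)[of weight0 1 K_a F_a, OF weight0_moment K_emb_a]
  show "weight_coeff (axis 1 1) (- n) = K_emb (AW.L (wa * (wa' * 1) * zpow n)) * wmoment 0"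
    unfolding weight_coeff_eq weight_uv_axis wt_1 by (rule zcoeff_step(1)[OF s K_emb_a])
qed

lemma ct_weight_2: "ct_weight (axis 2 1) f = K_emb (AW.L (wb * (wb' * 1) * f)) * wmoment 0"
proof (rule ct_weight_if)
  fix n
  note s = zcoeff_step(2)[of weight0 1 K_b F_b, OF weight0_moment K_emb_b]
  show "weight_coeff (axis 2 1) (- n) = K_emb (AW.L (wb * (wb' * 1) * zpow n)) * wmoment 0"
    unfolding weight_coeff_eq weight_uv_axis wt_commute[of F_a 0 F_b 1] wt_1 wt_commute[of F_b 0 F_a 0] by (rule zcoeff_step(1)[OF s K_emb_b])
qed

lemma ct_weight_12:
  "ct_weight (axis 1 1 + axis 2 1) f = K_emb (AW.L (wa * (wa' * (wb * (wb' * 1))) * f)) * wmoment 0"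
proof (rule ct_weight_if)
  fix n
  have s1: "zcoeff ((1 - mono_uv F_b 1 2) * weight0) (- n) = K_emb (AW.L (wb' * 1 * zpow n)) * wmoment 0" for n
    by (rule zcoeff_step(2)[OF weight0_moment K_emb_b])
  have s2: "zcoeff ((1 - mono_uv F_b 1 0) * ((1 - mono_uv F_b 1 2) * weight0)) (- n) =
      K_emb (AW.L (wb * (wb' * 1) * zpow n)) * wmoment 0" for n
    by (rule zcoeff_step(1)[OF s1 K_emb_b])
  have s3: "zcoeff ((1 - mono_uv F_a 1 2) * ((1 - mono_uv F_b 1 0) * ((1 - mono_uv F_b 1 2) * weight0))) (- n) =
      K_emb (AW.L (wa' * (wb * (wb' * 1)) * zpow n)) * wmoment 0" for n
    by (rule zcoeff_step(2)[OF s2 K_emb_a])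
  have w: "weight_uv (axis 1 1 + axis 2 1) = (1 - mono_uv F_a 1 0) * ((1 - mono_uv F_a 1 2) *
      ((1 - mono_uv F_b 1 0) * ((1 - mono_uv F_b 1 2) * weight0)))"
    unfolding weight_uv_axis wt_1[of F_a F_b 1] wt_commute[of F_a 0 F_b 1] wt_1 wt_commute[of F_b 0 F_a 0] ..
  show "weight_coeff (axis 1 1 + axis 2 1) (- n) =
      K_emb (AW.L (wa * (wa' * (wb * (wb' * 1))) * zpow n)) * wmoment 0"
    unfolding weight_coeff_eq w by (rule zcoeff_step(1)[OF s3 K_emb_a])
qed

text \<open>The shift of a contributes (1 - a z) (1 - a q/z). By \<open>L_wa_refl\<close> at k = 0,
  z^-1 acts as b after multiplication by 1 - a z, so the second factor becomes the scalar 1 - a b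
  q.\<close>

lemma AW_shift1: "f \<in> laurent_sym \<Longrightarrow> AW.L (wa * (wa' * 1) * f) = (1 - K_a * K_b * K_q) * AW.L (wa * f)"
  and AW_shift2: "f \<in> laurent_sym \<Longrightarrow> AW.L (wb * (wb' * 1) * f) = (1 - K_a * K_b * K_q) * AW.L (wb * f)"
proof -
  have *: "refl_functional.L ell (w x * (1 - lconst (x * K_q) * zpow (- 1)) * f) =
      (1 - x * y * K_q) * refl_functional.L ell (w x * f)"
    if "refl_functional x y ell" "f \<in> laurent_sym" "w = (\<lambda>x. 1 - lconst x * zpow 1)" for x y ell f w
  proof -
    interpret R: refl_functional x y ell by (rule that)
    have alg: "A - x * K_q * (y * A) = (1 - x * y * K_q) * A" for A :: K
      by (simp add: algebra_simps)
    have "2 * R.L (R.wa * f * zpow (- 1)) = 2 * (y * R.L (R.wa * f * zpow 0))"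
      using R.L_wa_refl[OF that(2), of 0] by (simp add: algebra_simps)
    then have m1: "R.L (R.wa * f * zpow (- 1)) = y * R.L (R.wa * f)" by (simp add: zpow_0)
    have "w x * (1 - lconst (x * K_q) * zpow (- 1)) * f = (1 - lconst (x * K_q) * zpow (- 1)) * (R.wa * f) * zpow 0"
      by (simp add: that(3) zpow_0 mult_ac)
    then have "R.L (w x * (1 - lconst (x * K_q) * zpow (- 1)) * f) =
        R.L (R.wa * f * zpow 0) - x * K_q * R.L (R.wa * f * zpow (- 1 + 0))"
      by (simp only: R.L_shift[of "x * K_q" "- 1"])
    also have "\<dots> = R.L (R.wa * f) - x * K_q * (y * R.L (R.wa * f))"
      by (simp only: add_0_right zpow_0 mult_1_right m1)
    also have "\<dots> = (1 - x * y * K_q) * R.L (R.wa * f)"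
      by (rule alg)
    finally show ?thesis by (simp only: that(3))
  qed
  show "f \<in> laurent_sym \<Longrightarrow> AW.L (wa * (wa' * 1) * f) = (1 - K_a * K_b * K_q) * AW.L (wa * f)"
    using *[OF AW.refl_functional_axioms, of f] by simp
  show "f \<in> laurent_sym \<Longrightarrow> AW.L (wb * (wb' * 1) * f) = (1 - K_a * K_b * K_q) * AW.L (wb * f)"
    using *[OF AW.swap, of f] by (simp add: mult.commute[of K_b])
qed

text \<open>After multiplication by (1 - a z) (1 - b z) the moments are odd about -1, so z^-1 has
  value 0 and z^-2 acts as -1; thus (1 - a q/z) (1 - b q/z) becomes 1 - a b q^2.\<close>

lemma AW_shift12:
  assumes f: "f \<in> laurent_sym"
  shows "AW.L (wa * (wa' * (wb * (wb' * 1))) * f) = (1 - K_a * K_b * K_q\<^sup>2) * AW.L (wa * wb * f)"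
proof -
  define \<mu> where "\<mu> k = AW.L (wa * (wb * f) * zpow k)" for k
  have r: "\<mu> (k - 1) = - \<mu> (- k - 1)" for k
    unfolding \<mu>_def by (rule AW.L_wab_refl[OF f])
  have m1: "\<mu> (- 1) = 0" using r[of 0] by (simp add: eq_neg_iff_add_eq_0)
  have m2: "\<mu> (- 2) = - \<mu> 0" using r[of 1] by simp
  have e1: "wa * (wa' * (wb * (wb' * 1))) * f = wa' * (wb' * (wa * (wb * f))) * zpow 0"
    by (simp only: zpow_0 mult_ac mult_1_right mult_1_left)
  have e2: "AW.L (wa' * (wb' * (wa * (wb * f))) * zpow 0) =
      AW.L (wb' * (wa * (wb * f)) * zpow 0) - K_a * K_q * AW.L (wb' * (wa * (wb * f)) * zpow (- 1 + 0))"
    by (rule AW.L_shift)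
  have e3: "AW.L (wb' * (wa * (wb * f)) * zpow k) = \<mu> k - K_b * K_q * \<mu> (- 1 + k)" for k
    unfolding \<mu>_def by (rule AW.L_shift)
  have "AW.L (wa * (wa' * (wb * (wb' * 1))) * f) =
      \<mu> 0 - K_b * K_q * \<mu> (- 1) - K_a * K_q * (\<mu> (- 1) - K_b * K_q * \<mu> (- 2))"
    unfolding e1 e2 e3 by simp
  also have "\<dots> = (1 - K_a * K_b * K_q\<^sup>2) * \<mu> 0"
    unfolding m1 m2 by (simp add: algebra_simps power2_eq_square)
  finally show ?thesis unfolding \<mu>_def zpow_0 mult_1_right mult.assoc[of wa wb f] .
qed

text \<open>Products of symmetric polynomials are symmetric, so M may replace the weight;
  \<open>e\<close> and \<open>wmoment 0\<close> are nonzero, so orthogonality means the same.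
  Existence and uniqueness for M then evaluate the description.\<close>

lemma AW_P_monic_orth:
  assumes M: "linear_fun M" "sym_nondegenerate M" and e: "e \<noteq> 0"
    and ct: "\<And>f. f \<in> laurent_sym \<Longrightarrow> ct_weight h f = K_emb (e * M f) * wmoment 0" and n: "n \<ge> 0"
  shows "monic_orth M n (AW_P h n)"
proof (cases "n = 0")
  case True
  then show ?thesis by (simp add: AW_P_def monic_orth_0)
next
  case False
  with n have n: "n \<ge> 1" by simp
  have sym: "P * zsym k \<in> laurent_sym" if "P \<in> laurent_sym" for P k
  proof -
    have "lk (P * zsym k) j = lk P (j - k) + lk P (j + k)" for j
      using lk_zpow_mult[of k P j] lk_zpow_mult[of "- k" P j]
      by (simp add: zsym_def distrib_left lookup_add mult.commute[of P])
    moreover have "lk P (- j - k) = lk P (j + k)" "lk P (- j + k) = lk P (j - k)" for j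
    proof -
      have s: "lk P (- i) = lk P i" for i using that by (simp add: laurent_sym_lk)
      show "lk P (- j - k) = lk P (j + k)" "lk P (- j + k) = lk P (j - k)"
        using s[of "j + k"] s[of "j - k"] by simp_all
    qed
    ultimately show ?thesis
      unfolding laurent_sym_lk by simp
  qed
  have pair: "pairing h P (zsym k) = 0 \<longleftrightarrow> M (P * zsym k) = 0" if "P \<in> laurent_sym" for P k
    using e wmoment_0_neq_0 field_hom_eq_0[OF field_hom_K_emb]
    by (simp add: pairing_def laurent_star_zsym ct[OF sym[OF that]])
  have iff: "P \<in> laurent_sym \<and> (\<exists>c. P = zsym n + (\<Sum>j\<in>{0..<n}. lconst (c j) * zsym j)) \<and>
      (\<forall>m\<in>{0..<n}. pairing h P (zsym m) = 0) \<longleftrightarrow> monic_orth M n P" for P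
  proof
    assume P: "P \<in> laurent_sym \<and> (\<exists>c. P = zsym n + (\<Sum>j\<in>{0..<n}. lconst (c j) * zsym j)) \<and>
      (\<forall>m\<in>{0..<n}. pairing h P (zsym m) = 0)"
    then have "symdeg (n - 1) (P - zsym n)" using symdeg_sum_zsym[of n] by auto
    with P show "monic_orth M n P" unfolding monic_orth_iff[OF n] using pair[of P] by auto
  next
    assume P: "monic_orth M n P"
    then obtain c where "P - zsym n = (\<Sum>j\<in>{0..<n}. lconst (c j) * zsym j)"
      using symdeg_combination[OF _ n] unfolding monic_orth_iff[OF n] by blast
    then have "P = zsym n + (\<Sum>j\<in>{0..<n}. lconst (c j) * zsym j)" by (simp add: algebra_simps)
    with P pair[of P] show "P \<in> laurent_sym \<and> (\<exists>c. P = zsym n + (\<Sum>j\<in>{0..<n}. lconst (c j) * zsym j)) \<and>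
      (\<forall>m\<in>{0..<n}. pairing h P (zsym m) = 0)"
      unfolding monic_orth_def symdeg_def by auto
  qed
  have "AW_P h n = (THE P. monic_orth M n P)" using n by (simp add: AW_P_def iff)
  moreover have "\<exists>!P. monic_orth M n P"
    using monic_orth_exists[OF M, of n] monic_orth_unique[OF M n] n by auto
  ultimately show ?thesis using theI' by metis
qed

lemma AW_P_0: "n \<ge> 0 \<Longrightarrow> monic_orth AW.L n (AW_P 0 n)"
  by (rule AW_P_monic_orth[OF AW.linear_fun_L AW.sym_nondegenerate_1 one_neq_zero]) (simp_all only: ct_weight_0 mult_1_left)

lemma one_minus_ab_neq_0: "1 - K_a * K_b * K_q \<noteq> 0" "1 - K_a * K_b * K_q\<^sup>2 \<noteq> 0"
  using K_generic(2)[of 1] K_generic(2)[of 2] by auto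

lemma AW_P_1: "n \<ge> 0 \<Longrightarrow> monic_orth (\<lambda>f. AW.L (wa * f)) n (AW_P (axis 1 1) n)"
  by (rule AW_P_monic_orth[OF linear_fun_mult[OF AW.linear_fun_L] AW.sym_nondegenerate_wa one_minus_ab_neq_0(1)])
     (simp_all only: ct_weight_1 AW_shift1)

lemma AW_P_2: "n \<ge> 0 \<Longrightarrow> monic_orth (\<lambda>f. AW.L (wb * f)) n (AW_P (axis 2 1) n)"
  by (rule AW_P_monic_orth[OF linear_fun_mult[OF AW.linear_fun_L] refl_functional.sym_nondegenerate_wa[OF AW.swap] one_minus_ab_neq_0(1)])
     (simp_all only: ct_weight_2 AW_shift2)

lemma AW_P_12: "n \<ge> 0 \<Longrightarrow> monic_orth (\<lambda>f. AW.L (wa * wb * f)) n (AW_P (axis 1 1 + axis 2 1) n)"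
  by (rule AW_P_monic_orth[OF linear_fun_mult[OF AW.linear_fun_L] AW.sym_nondegenerate_wab one_minus_ab_neq_0(2)])
     (simp_all only: ct_weight_12 AW_shift12)

text \<open>The predecessors of z^n fill an interval of exponents, so two candidates differ by an
  element supported on that interval and orthogonal to all of it, to which \<open>toeplitz_L\<close>
  applies.\<close>

lemma AW_E_eqI:
  assumes low: "\<And>k. mono_less k n \<longleftrightarrow> i \<le> k \<and> k \<le> j"
    and supp: "supp X i' j'" "\<And>k. i' \<le> k \<Longrightarrow> k \<le> j' \<Longrightarrow> k = n \<or> i \<le> k \<and> k \<le> j" and lead: "lk X n = 1"
    and orth: "\<And>k. i \<le> k \<Longrightarrow> k \<le> j \<Longrightarrow> AW.L (X * zpow (- k)) = 0"
  shows "AW_E n = X"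
proof -
  have set: "{m. mono_less m n} = {i..j}" unfolding low by (rule set_eqI) simp
  have n: "n \<notin> {i..j}" using low[of n] by (simp add: mono_less_def)
  have lks: "lk (\<Sum>m\<in>{i..j}. lconst (c m) * zpow m) k = (if k \<in> {i..j} then c k else 0)" for c k
  proof -
    have "lk (\<Sum>m\<in>{i..j}. lconst (c m) * zpow m) k = (\<Sum>m\<in>{i..j}. if m = k then c m else 0)"
      unfolding lookup_sum lk_simps lk_zpow by (intro sum.cong) auto
    then show ?thesis by simp
  qed
  have pair: "pairing 0 E (zpow m) = 0 \<longleftrightarrow> AW.L (E * zpow (- m)) = 0" for E m
    using wmoment_0_neq_0 field_hom_eq_0[OF field_hom_K_emb]
    by (simp add: pairing_def laurent_star_zpow ct_weight_0)
  have X: "X = zpow n + (\<Sum>m\<in>{i..j}. lconst (lk X m) * zpow m)"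
  proof (rule laurent_eqI)
    fix k
    show "lk X k = lk (zpow n + (\<Sum>m\<in>{i..j}. lconst (lk X m) * zpow m)) k"
      using supp(2)[of k] suppD[OF supp(1), of k] lead n
      by (auto simp: lookup_add lks lk_zpow) force+
  qed
  show ?thesis
    unfolding AW_E_def set pair
  proof (rule the_equality)
    show "(\<exists>c. X = zpow n + (\<Sum>m\<in>{i..j}. lconst (c m) * zpow m)) \<and>
      (\<forall>m. mono_less m n \<longrightarrow> AW.L (X * zpow (- m)) = 0)"
    proof (intro conjI allI impI)
      show "\<exists>c. X = zpow n + (\<Sum>m\<in>{i..j}. lconst (c m) * zpow m)"
        by (rule exI[of _ "lk X"]) (rule X)
      show "AW.L (X * zpow (- m)) = 0" if "mono_less m n" for m
        using that low orth by simp
    qed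
  next
    fix E assume E: "(\<exists>c. E = zpow n + (\<Sum>m\<in>{i..j}. lconst (c m) * zpow m)) \<and>
      (\<forall>m. mono_less m n \<longrightarrow> AW.L (E * zpow (- m)) = 0)"
    then obtain c where c: "E = zpow n + (\<Sum>m\<in>{i..j}. lconst (c m) * zpow m)" by blast
    have d: "E - X = (\<Sum>m\<in>{i..j}. lconst (c m) * zpow m) - (\<Sum>m\<in>{i..j}. lconst (lk X m) * zpow m)"
      using arg_cong2[where f = "(-)", OF c X] by (simp only: add_diff_cancel_left)
    have "supp (E - X) i j" unfolding d by (rule suppI) (auto simp: lookup_minus lks)
    moreover have "AW.L ((E - X) * zpow (- m)) = 0" if "i \<le> m" "m \<le> j" for m
      using E orth[OF that] low that unfolding AW.L_minus by simp
    ultimately have "E - X = 0" by (rule AW.toeplitz_L)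
    then show "E = X" by simp
  qed
qed

lemma mono_less_neg: "mono_less k (- int m) \<longleftrightarrow> 1 - int m \<le> k \<and> k \<le> int m"
  and mono_less_pos: "mono_less k (int m + 1) \<longleftrightarrow> - int m \<le> k \<and> k \<le> int m"
  unfolding mono_less_def mono_pos_def by (simp_all split: if_split) presburger+

section \<open>Steinberg and Koornwinder bases\<close>

lemma zpow_diff_neq_0: "zpow 1 - zpow (- 1) \<noteq> 0"
proof
  assume "zpow 1 - zpow (- 1) = 0"
  then have "lk (zpow 1 - zpow (- 1)) 1 = 0" by simp
  then show False by (simp add: lookup_minus lk_zpow)
qed

text \<open>Such an f is killed by z - 1/z, and Laurent polynomials have no zero divisors.\<close>

lemma step2_periodic_eq_0:
  assumes "\<And>n. lk f (n - 1) = lk f (n + 1)"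
  shows "f = 0"
proof -
  have "(zpow 1 - zpow (- 1)) * f = 0"
    by (rule laurent_eqI) (simp add: left_diff_distrib lookup_minus lk_zpow_mult assms)
  then show ?thesis using zpow_diff_neq_0 by simp
qed

text \<open>Injectivity lets \<open>inv_into\<close> return an exhibited preimage. If f + z g = 0,
  then z g is symmetric along with f, which makes the coefficients of g periodic with step
  2.\<close>

lemma inj_on_B_S: "inj_on B_S sym_pairs"
proof (rule inj_onI)
  fix x y assume xy: "x \<in> sym_pairs" "y \<in> sym_pairs" "B_S x = B_S y"
  define f where "f = x $ 1 - y $ 1"
  define g where "g = x $ 2 - y $ 2"
  have sym: "lk f (- n) = lk f n" "lk g (- n) = lk g n" for n
    using xy(1,2) by (simp_all add: f_def g_def sym_pairs_def laurent_sym_lk lookup_minus)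
  have "f + zpow 1 * g = 0" using xy(3) by (simp add: f_def g_def B_S_def algebra_simps)
  then have e: "lk f n + lk g (n - 1) = 0" for n
    using lk_zpow_mult[of 1 g n] lookup_add[of f "zpow 1 * g" n] by simp
  have "lk g (n - 1) = lk g (n + 1)" for n
  proof -
    have s: "lk g (- n - 1) = lk g (n + 1)" using sym(2)[of "n + 1"] by simp
    have "lk f n + lk g (n - 1) = lk f n + lk g (n + 1)"
      using e[of n] e[of "- n"] unfolding s sym by simp
    then show ?thesis by simp
  qed
  then have g: "g = 0" by (rule step2_periodic_eq_0)
  with e have "f = 0" by (intro laurent_eqI) simp
  with g show "x = y" by (simp add: f_def g_def vec_eq_iff forall_2)
qed

text \<open>The basis factor is z^-1 - (a + b) + a b z. Comparing coefficients at n and -n leaves (1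
  - a b) (g_(n+1) - g_(n-1)) = 0.\<close>

lemma inj_on_B_K: "inj_on B_K sym_pairs"
proof (rule inj_onI)
  fix x y assume xy: "x \<in> sym_pairs" "y \<in> sym_pairs" "B_K x = B_K y"
  define f where "f = x $ 1 - y $ 1"
  define g where "g = x $ 2 - y $ 2"
  have sym: "lk f (- n) = lk f n" "lk g (- n) = lk g n" for n
    using xy(1,2) by (simp_all add: f_def g_def sym_pairs_def laurent_sym_lk lookup_minus)
  have "f + zpow (- 1) * wa * wb * g = 0"
  proof -
    have "f + zpow (- 1) * wa * wb * g = B_K x - B_K y"
      unfolding f_def g_def B_K_def right_diff_distrib[of "zpow (- 1) * wa * wb"]
      by (rule add_diff_add[symmetric])
    then show ?thesis by (simp only: xy(3) diff_self)
  qed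
  then have "f + zpow (- 1) * (wa * (wb * g)) = 0" by (simp only: mult.assoc)
  then have z: "lk (f + zpow (- 1) * (wa * (wb * g))) n = 0" for n by (simp only: lookup_zero)
  have e: "lk f n + (lk g (n + 1) - (K_a + K_b) * lk g n + K_a * K_b * lk g (n - 1)) = 0" for n
  proof -
    have "lk (f + zpow (- 1) * (wa * (wb * g))) n = lk f n + (lk g (n - - 1) - K_b * lk g (n - - 1 - 1) -
        K_a * (lk g (n - - 1 - 1) - K_b * lk g (n - - 1 - 1 - 1)))"
      by (simp only: lk_simps)
    then have "lk f n + (lk g (n - - 1) - K_b * lk g (n - - 1 - 1) -
        K_a * (lk g (n - - 1 - 1) - K_b * lk g (n - - 1 - 1 - 1))) = 0"
      unfolding z by (rule HOL.sym)
    then show ?thesis by (simp add: algebra_simps)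
  qed
  have "lk g (n - 1) = lk g (n + 1)" for n
  proof -
    have s: "lk g (- n + 1) = lk g (n - 1)" "lk g (- n - 1) = lk g (n + 1)"
      using sym(2)[of "n - 1"] sym(2)[of "n + 1"] by simp_all
    have "(1 - K_a * K_b) * (lk g (n + 1) - lk g (n - 1)) = 0"
      using e[of n] e[of "- n"] unfolding s sym by (simp add: algebra_simps)
    then show ?thesis using K_generic(2)[of 0] by simp
  qed
  then have g: "g = 0" by (rule step2_periodic_eq_0)
  with e have "f = 0" by (intro laurent_eqI) simp
  with g show "x = y" by (simp add: f_def g_def vec_eq_iff forall_2)
qed

section \<open>The connection matrices\<close>

lemma rf_value:
  fixes t :: K
  assumes "poly g t \<noteq> 0"
  shows "rf_regular (\<lambda>x. x) t (Fract f g)" "rf_eval (\<lambda>x. x) t (Fract f g) = poly f t / poly g t"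
proof -
  have "poly (map_poly (\<lambda>x. x) g) t \<noteq> 0" using assms by simp
  then show "rf_regular (\<lambda>x. x) t (Fract f g)" unfolding rf_regular_def by blast
  show "rf_eval (\<lambda>x. x) t (Fract f g) = poly f t / poly g t"
    using rf_eval_Fract[OF field_hom_id, of g t f] assms by simp
qed

lemma mat_value:
  fixes t :: K and f11 f12 f21 f22 :: "K poly"
  assumes "poly g11 t \<noteq> 0" "poly g12 t \<noteq> 0" "poly g21 t \<noteq> 0" "poly g22 t \<noteq> 0"
  defines "C \<equiv> vector [vector [Fract f11 g11, Fract f12 g12], vector [Fract f21 g21, Fract f22 g22]]"
  shows "mat_regular t C"
    and "mat_eval t C = vector [vector [poly f11 t / poly g11 t, poly f12 t / poly g12 t],
      vector [poly f21 t / poly g21 t, poly f22 t / poly g22 t]]"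
  using assms by (simp_all add: mat_regular_def mat_eval_def map_matrix_def vec_eq_iff forall_2 rf_value)

lemma mat_of_cols_eqI:
  fixes A :: "'a::zero ^ 2 ^ 2"
  assumes "\<And>i. A $ i $ 1 = x $ i" "\<And>i. A $ i $ 2 = y $ i"
  shows "mat_of_cols x y = A"
  using assms by (simp add: mat_of_cols_def transpose_def vec_eq_iff forall_2)

lemma mat_const_nth: "mat_const M $ i $ j = lconst (M $ i $ j)"
  by (simp add: mat_const_def map_matrix_def)

lemma diag2_nth:
  "diag2 x y $ 1 $ 1 = x" "diag2 x y $ 1 $ 2 = 0" "diag2 x y $ 2 $ 1 = 0" "diag2 x y $ 2 $ 2 = y"
  by (simp_all add: diag2_def)

lemma mat2_mult_nth: "(A ** B) $ i $ j = A $ i $ 1 * B $ 1 $ j + A $ i $ 2 * B $ 2 $ j"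
  for A B :: "'a::semiring_1 ^ 2 ^ 2"
  by (simp add: matrix_matrix_mult_def sum_2)

lemma conj_diag_nth:
  "(mat_const V ** diag2 x y ** mat_const W ** mat_const C) $ i $ j =
    lconst (V $ i $ 1 * (W ** C) $ 1 $ j) * x + lconst (V $ i $ 2 * (W ** C) $ 2 $ j) * y"
  by (simp add: mat2_mult_nth mat_const_nth diag2_nth lconst_add distrib_left distrib_right
      mult_ac flip: lconst_mult)

lemma V_mat_inv: "matrix_inv V_mat ** V_mat = mat 1"
proof -
  have "det V_mat = inverse K_b - inverse K_a" by (simp add: V_mat_def det_2)
  also have "\<dots> \<noteq> 0" using K_generic(1) by simp
  finally have "invertible V_mat" by (simp add: invertible_det_nz)
  then have "\<exists>B. V_mat ** B = mat 1 \<and> B ** V_mat = mat 1" by (simp add: invertible_def)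
  then show ?thesis unfolding matrix_inv_def by (rule someI2_ex) simp
qed

lemma K_c_eq: "K_g * K_sq = K_c" and K_d_eq: "K_h * K_sq = K_d"
  by (simp_all add: K_g_def K_h_def K_gen_neq_0)

text \<open>Its columns list the coefficients of E_-m and E_(m+1) at z^-m and z^(m+1): three are 0
  or 1 by definition, and the fraction is the coefficient of z^-m in E_(m+1). The variable stands
  for q^(m/2), so q^m is its square.\<close>

definition C_Steinberg :: "K poly fract ^ 2 ^ 2" where
  "C_Steinberg = vector [vector [Fract 1 1,
      Fract [:0, 0, - (K_c + K_d), 0, (K_a + K_b) * K_c * K_d:] [:1, 0, 0, 0, - (K_a * K_b * K_c * K_d):]],
    vector [Fract 0 1, Fract 1 1]]"

lemma EE_S_eq:
  defines "t \<equiv> \<lambda>m. K_sq ^ m"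
  shows "mat_regular (t m) C_Steinberg"
    and "EE_S m = mat_const V_mat ** PP_S m ** mat_const (matrix_inv V_mat) ** mat_const (mat_eval (t m) C_Steinberg)"
proof -
  define q where "q = K_sq ^ (2 * m)"
  have q: "q = t m * t m" by (simp add: q_def t_def mult_2 power_add)
  have den: "K_a * K_b * K_c * K_d * q\<^sup>2 \<noteq> 1"
  proof -
    have "q\<^sup>2 = K_q ^ (2 * m)" by (simp add: q_def K_q_def power_mult[symmetric] mult.commute)
    then show ?thesis using K_generic(3)[of "2 * m"] by simp
  qed
  have den': "poly [:1, 0, 0, 0, - (K_a * K_b * K_c * K_d):] (t m) = 1 - K_a * K_b * K_c * K_d * q\<^sup>2"
    by (simp add: q power2_eq_square mult_ac)
  have num': "poly [:0, 0, - (K_c + K_d), 0, (K_a + K_b) * K_c * K_d:] (t m) =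
      - (K_c + K_d) * q + (K_a + K_b) * K_c * K_d * q\<^sup>2"
    by (simp add: q power2_eq_square algebra_simps)
  define r where "r = (- (K_c + K_d) * q + (K_a + K_b) * K_c * K_d * q\<^sup>2) / (1 - K_a * K_b * K_c * K_d * q\<^sup>2)"
  have den_nz: "1 - K_a * K_b * K_c * K_d * q\<^sup>2 \<noteq> 0" using den by simp
  note dn = den_nz[folded den']
  show "mat_regular (t m) C_Steinberg"
    unfolding C_Steinberg_def by (rule mat_value(1)[OF _ dn]) simp_all
  have C: "mat_eval (t m) C_Steinberg = vector [vector [1, r], vector [0, 1]]"
    unfolding C_Steinberg_def r_def den'[symmetric] num'[symmetric]
    by (subst mat_value(2)[OF _ dn]) simp_all
  define P1 where "P1 = AW_P (axis 1 1) (int m)"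
  define P2 where "P2 = AW_P (axis 2 1) (int m)"
  have P1: "monic_orth (\<lambda>f. AW.L (wa * f)) (int m) P1" unfolding P1_def by (rule AW_P_1) simp
  have P2: "monic_orth (\<lambda>f. AW.L (wb * f)) (int m) P2" unfolding P2_def by (rule AW_P_2) simp
  have sym: "P1 \<in> laurent_sym" "P2 \<in> laurent_sym" using monic_orth_lk(3) P1 P2 by blast+
  \<comment> \<open>Steinberg coordinates: (1 - a z) P1 has the pair (P1, -a P1), and likewise for b
    and P2.\<close>
  define v :: "K \<Rightarrow> K \<Rightarrow> laurent ^ 2" where
    "v X Y = vector [lconst X * P1 + lconst Y * P2, lconst (- K_a * X) * P1 + lconst (- K_b * Y) * P2]" for X Y
  have v: "v X Y \<in> sym_pairs" "B_S (v X Y) = lconst X * (wa * P1) + lconst Y * (wb * P2)" for X Y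
  proof -
    show "v X Y \<in> sym_pairs" using sym by (simp add: v_def sym_pairs_def sym_add sym_lconst)
    show "B_S (v X Y) = lconst X * (wa * P1) + lconst Y * (wb * P2)"
      by (simp add: v_def B_S_def lconst_uminus algebra_simps flip: lconst_mult)
  qed
  have inv: "inv_into sym_pairs B_S (lconst X * (wa * P1) + lconst Y * (wb * P2)) = v X Y" for X Y
    using inv_into_f_f[OF inj_on_B_S v(1), of X Y] by (simp only: v(2))
  define X0 where "X0 = K_b / (K_b - K_a)"
  define Y0 where "Y0 = - K_a / (K_b - K_a)"
  note n = AW.E_neg_eq[OF P1 P2 K_generic(1), folded X0_def Y0_def]
  have En: "AW_E (- int m) = lconst X0 * (wa * P1) + lconst Y0 * (wb * P2)"
    by (rule AW_E_eqI[OF mono_less_neg n(1) _ n(2)]) (auto intro: n(3))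
  define \<xi> where "\<xi> = 1 / ((K_b - K_a) * (1 - K_a * K_b * K_c * K_d * q\<^sup>2))"
  define X where "X = \<xi> * ((1 - K_b * K_c * q) * (1 - K_b * K_d * q))"
  define Y where "Y = - (\<xi> * ((1 - K_a * K_c * q) * (1 - K_a * K_d * q)))"
  note p = AW.E_succ_eq[OF P1 P2, unfolded K_c_eq K_d_eq, folded q_def, OF den, folded \<xi>_def, folded X_def Y_def]
  have Ep: "AW_E (int m + 1) = lconst X * (wa * P1) + lconst Y * (wb * P2)"
    by (rule AW_E_eqI[OF mono_less_pos p(1) _ p(2)]) (auto intro: p(3))
  have ba: "K_b - K_a \<noteq> 0" using K_generic(1) by simp
  have XY0: "X0 + Y0 = 1" "- K_a * X0 - K_b * Y0 = 0"
    using ba by (simp_all add: X0_def Y0_def diff_divide_distrib[symmetric] mult.commute)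
  have \<xi>: "\<xi> * (K_b - K_a) = 1 / (1 - K_a * K_b * K_c * K_d * q\<^sup>2)" using ba by (simp add: \<xi>_def)
  have "X + Y = \<xi> * (K_b - K_a) * (- (K_c + K_d) * q + (K_a + K_b) * K_c * K_d * q\<^sup>2)"
    by (simp add: X_def Y_def algebra_simps power2_eq_square)
  then have XY1: "X + Y = r" unfolding \<xi> r_def by simp
  have "- K_a * X - K_b * Y = \<xi> * (K_b - K_a) * (1 - K_a * K_b * K_c * K_d * q\<^sup>2)"
    by (simp add: X_def Y_def algebra_simps power2_eq_square)
  then have XY2: "- K_a * X - K_b * Y = 1" unfolding \<xi> using den_nz by simp
  \<comment> \<open>The columns of \<open>V_mat\<close> are (1, -a) and (1, -b) divided by -a and
    -b; the coordinates are rescaled accordingly.\<close>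
  define D :: "K ^ 2 ^ 2" where
    "D = vector [vector [- K_a * X0, - K_a * X], vector [- K_b * Y0, - K_b * Y]]"
  have V: "inverse K_a * K_a = 1" "inverse K_b * K_b = 1" by (simp_all add: K_a_neq_0 K_gen_neq_0)
  have inv_cancel: "inverse K_a * (K_a * x) = x" "inverse K_b * (K_b * x) = x" for x
    using V by (simp_all flip: mult.assoc)
  have VD: "V_mat ** D = vector [vector [1, r], vector [0, 1]]"
  proof -
    have "V_mat ** D = vector [vector [X0 + Y0, X + Y],
        vector [- K_a * X0 + - K_b * Y0, - K_a * X + - K_b * Y]]"
      by (simp add: vec_eq_iff forall_2 mat2_mult_nth V_mat_def D_def inv_cancel del: mult_minus_left mult_minus_right)
    moreover have "- K_a * X0 + - K_b * Y0 = 0" "- K_a * X + - K_b * Y = 1"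
      using XY0(2) XY2 by simp_all
    ultimately show ?thesis by (simp only: XY0(1) XY1)
  qed
  have WC: "matrix_inv V_mat ** mat_eval (t m) C_Steinberg = D"
    unfolding C VD[symmetric] matrix_mul_assoc V_mat_inv by simp
  show "EE_S m = mat_const V_mat ** PP_S m ** mat_const (matrix_inv V_mat) ** mat_const (mat_eval (t m) C_Steinberg)"
    unfolding EE_S_def En Ep inv PP_S_def P1_def[symmetric] P2_def[symmetric]
  proof (rule mat_of_cols_eqI)
    have i: "i = 1 \<or> i = 2" for i :: 2 by (rule exhaust_2)
    show "(mat_const V_mat ** diag2 P1 P2 ** mat_const (matrix_inv V_mat) **
        mat_const (mat_eval (t m) C_Steinberg)) $ i $ 1 = v X0 Y0 $ i" for i
      using i[of i] unfolding conj_diag_nth WC by (auto simp: D_def V_mat_def v_def inv_cancel simp del: mult_minus_left mult_minus_right)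
    show "(mat_const V_mat ** diag2 P1 P2 ** mat_const (matrix_inv V_mat) **
        mat_const (mat_eval (t m) C_Steinberg)) $ i $ 2 = v X Y $ i" for i
      using i[of i] unfolding conj_diag_nth WC by (auto simp: D_def V_mat_def v_def inv_cancel simp del: mult_minus_left mult_minus_right)
  qed
qed

text \<open>The columns are the coefficients of \<open>E_neg_Koornwinder_eq\<close> and
  \<open>E_pos_eq\<close>, with q^m written as the square of the variable. Here e = a b g h is a b c
  d / q.\<close>

definition C_Koornwinder :: "K poly fract ^ 2 ^ 2" where
  "C_Koornwinder = (let p = \<lambda>x. [:1, 0, - x:]; e = K_a * K_b * K_g * K_h;
      den = [:1 - K_a * K_b:] * [:1, 0, 0, 0, - e:]
    in vector [vector [Fract (p (K_a * K_b) * p e) den, Fract 1 [:1 - K_a * K_b:]],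
      vector [Fract ([:- (K_a * K_b):] * p 1 * p (K_g * K_h)) den, Fract (- 1) [:1 - K_a * K_b:]]])"

lemma EE_K_eq:
  assumes m: "m \<ge> 1"
  defines "t \<equiv> \<lambda>m. K_sq ^ m"
  shows "mat_regular (t m) C_Koornwinder"
    and "EE_K m = PP_K m ** mat_const (mat_eval (t m) C_Koornwinder)"
proof -
  obtain n where n: "m = Suc n" using m by (cases m) auto
  define q where "q = K_sq ^ (2 * (n + 1))"
  have q: "q = t m * t m" by (simp add: q_def t_def n mult_2 flip: power_add)
  define e where "e = K_a * K_b * K_g * K_h"
  \<comment> \<open>As g h = c d / q, the product is a b c d q^(2 m - 1), with 2 m - 1 = 2 n +
    1.\<close>
  have den: "e * q\<^sup>2 \<noteq> 1"
  proof -
    have "q\<^sup>2 = K_sq\<^sup>2 * K_q ^ (2 * n + 1)"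
    proof -
      have "2 * (n + 1) * 2 = 2 + 2 * (2 * n + 1)" by simp
      then show ?thesis unfolding q_def K_q_def by (simp only: power_mult[symmetric] power_add[symmetric])
    qed
    moreover have "K_g * K_h * K_sq\<^sup>2 = K_c * K_d"
      by (simp add: power2_eq_square flip: K_c_eq K_d_eq)
    ultimately have "e * q\<^sup>2 = K_a * K_b * K_c * K_d * K_q ^ (2 * n + 1)"
      by (simp add: e_def mult_ac)
    then show ?thesis using K_generic(3)[of "2 * n + 1"] by simp
  qed
  have ab: "1 - K_a * K_b \<noteq> 0" using K_generic(2)[of 0] by simp
  have den_nz: "(1 - K_a * K_b) * (1 - e * q\<^sup>2) \<noteq> 0" using den ab by simp
  define den_p where "den_p = [:1 - K_a * K_b:] * [:1, 0, 0, 0, - e:]"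
  have den_v: "poly den_p (t m) = (1 - K_a * K_b) * (1 - e * q\<^sup>2)"
    by (simp add: den_p_def q power2_eq_square algebra_simps)
  have p: "poly [:1, 0, - x:] (t m) = 1 - x * q" for x by (simp add: q mult_ac)
  define \<xi> where "\<xi> = 1 / ((1 - K_a * K_b) * (1 - e * q\<^sup>2))"
  define X where "X = \<xi> * ((1 - K_a * K_b * q) * (1 - e * q))"
  define Y where "Y = - (\<xi> * (K_a * K_b * (1 - q) * (1 - K_g * K_h * q)))"
  define u where "u = 1 / (1 - K_a * K_b)"
  define w where "w = - 1 / (1 - K_a * K_b)"
  show "mat_regular (t m) C_Koornwinder"
    unfolding C_Koornwinder_def Let_def e_def[symmetric] den_p_def[symmetric]
    by (rule mat_value(1)) (use den_nz den_v ab in simp_all)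
  have C: "mat_eval (t m) C_Koornwinder = vector [vector [X, u], vector [Y, w]]"
  proof -
    have c1: "poly ([:1, 0, - (K_a * K_b):] * [:1, 0, - e:]) (t m) / poly den_p (t m) = X"
      unfolding poly_mult p den_v X_def \<xi>_def by simp
    have c2: "poly ([:- (K_a * K_b):] * [:1, 0, - 1:] * [:1, 0, - (K_g * K_h):]) (t m) / poly den_p (t m) = Y"
      unfolding poly_mult p den_v Y_def \<xi>_def by simp
    have c3: "poly 1 (t m) / poly [:1 - K_a * K_b:] (t m) = u" "poly (- 1) (t m) / poly [:1 - K_a * K_b:] (t m) = w"
      by (simp_all add: u_def w_def)
    have nz: "poly den_p (t m) \<noteq> 0" "poly [:1 - K_a * K_b:] (t m) \<noteq> 0"
      using den_nz den_v ab by simp_all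
    show ?thesis
      unfolding C_Koornwinder_def Let_def e_def[symmetric] den_p_def[symmetric]
        mat_value(2)[OF nz nz] c1 c2 c3 ..
  qed
  define P where "P = AW_P 0 (int n + 1)"
  define P' where "P' = AW_P (axis 1 1 + axis 2 1) (int n)"
  have P: "monic_orth AW.L (int n + 1) P" unfolding P_def by (rule AW_P_0) simp
  have P': "monic_orth (\<lambda>f. AW.L (wa * wb * f)) (int n) P'" unfolding P'_def by (rule AW_P_12) simp
  have sym: "P \<in> laurent_sym" "P' \<in> laurent_sym" using monic_orth_lk(3) P P' by blast+
  define R where "R = zpow (- 1) * (wa * (wb * P'))"
  define v :: "K \<Rightarrow> K \<Rightarrow> laurent ^ 2" where "v x y = vector [lconst x * P, lconst y * P']" for x y
  have v: "v x y \<in> sym_pairs" "B_K (v x y) = lconst x * P + lconst y * R" for x y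
  proof -
    show "v x y \<in> sym_pairs" using sym by (simp add: v_def sym_pairs_def sym_lconst)
    have "B_K (v x y) = lconst x * P + zpow (- 1) * wa * wb * (lconst y * P')"
      by (simp add: v_def B_K_def)
    also have "\<dots> = lconst x * P + lconst y * R" by (simp only: R_def mult_ac)
    finally show "B_K (v x y) = lconst x * P + lconst y * R" .
  qed
  have inv: "inv_into sym_pairs B_K (lconst x * P + lconst y * R) = v x y" for x y
    using inv_into_f_f[OF inj_on_B_K v(1), of x y] by (simp only: v(2))
  note en = AW.E_neg_Koornwinder_eq[OF P P', folded q_def R_def, folded e_def, OF den, folded \<xi>_def, folded X_def Y_def]
  have low: "mono_less k (- int m) \<longleftrightarrow> - int n \<le> k \<and> k \<le> int n + 1" for k
    unfolding mono_less_neg n by auto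
  have im: "- int m = - (int n + 1)" "int m = int n + 1" "int m - 1 = int n" by (simp_all add: n)
  have En: "AW_E (- int m) = lconst X * P + lconst Y * R"
  proof (rule AW_E_eqI[OF low en(1)])
    show "lk (lconst X * P + lconst Y * R) (- int m) = 1" unfolding im(1) by (rule en(2))
  qed (auto simp: im intro: en(3))
  note ep = AW.E_pos_eq[OF P P', folded R_def, folded u_def w_def]
  have Ep: "AW_E (int m) = lconst u * P + lconst w * R"
    unfolding im by (rule AW_E_eqI[OF mono_less_pos ep(1) _ ep(2)]) (auto intro: ep(3))
  show "EE_K m = PP_K m ** mat_const (mat_eval (t m) C_Koornwinder)"
    unfolding EE_K_def En Ep inv C
  proof (rule mat_of_cols_eqI)
    have i: "i = 1 \<or> i = 2" for i :: 2 by (rule exhaust_2)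
    have PP: "PP_K m = diag2 P P'" unfolding PP_K_def im(3) unfolding im(2) P_def P'_def ..
    show "(PP_K m ** mat_const (vector [vector [X, u], vector [Y, w]])) $ i $ 1 = v X Y $ i"
      "(PP_K m ** mat_const (vector [vector [X, u], vector [Y, w]])) $ i $ 2 = v u w $ i" for i
      using i[of i] unfolding PP by (auto simp: mat2_mult_nth diag2_nth mat_const_nth v_def mult.commute)
  qed
qed

text \<open>P_-1 = 0 annihilates the second row, which frees x and y; both columns are the
  coordinates of E_0 = 1.\<close>

lemma EE_K_0: "EE_K 0 = PP_K 0 ** mat_const (vector [vector [1, 1], vector [x, y]])"
proof -
  have low: "mono_less k 0 \<longleftrightarrow> 1 \<le> k \<and> k \<le> 0" for k
    using mono_less_neg[of k 0] by simp
  have E: "AW_E 0 = 1"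
    by (rule AW_E_eqI[OF low, where i' = 0 and j' = 0]) (auto simp: supp_def lk_1)
  define v :: "laurent ^ 2" where "v = vector [1, 0]"
  have v: "v \<in> sym_pairs" "B_K v = 1" by (simp_all add: v_def sym_pairs_def sym_0 sym_1 B_K_def)
  have inv: "inv_into sym_pairs B_K 1 = v"
    using inv_into_f_f[OF inj_on_B_K v(1)] by (simp only: v(2))
  have PP: "PP_K 0 = diag2 1 0" by (simp add: PP_K_def AW_P_def)
  have i: "i = 1 \<or> i = 2" for i :: 2 by (rule exhaust_2)
  have "mat_of_cols v v = diag2 1 0 ** mat_const (vector [vector [1, 1], vector [x, y]])"
  proof (rule mat_of_cols_eqI)
    show "(diag2 1 0 ** mat_const (vector [vector [1, 1], vector [x, y]])) $ i $ 1 = v $ i"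
      "(diag2 1 0 ** mat_const (vector [vector [1, 1], vector [x, y]])) $ i $ 2 = v $ i" for i
      using i[of i] by (auto simp: mat2_mult_nth diag2_nth mat_const_nth v_def lconst_1)
  qed
  then show ?thesis by (simp add: EE_K_def E inv PP)
qed

theorem proposition4p18:
  shows "(\<exists>C_S C_K :: K poly fract ^ 2 ^ 2.
           (\<forall>m::nat. mat_regular (K_sq ^ m) C_S \<and>
              EE_S m = mat_const V_mat ** PP_S m ** mat_const (matrix_inv V_mat)
                         ** mat_const (mat_eval (K_sq ^ m) C_S)) \<and>
           (\<forall>m::nat. m \<ge> 1 \<longrightarrow> mat_regular (K_sq ^ m) C_K \<and>
              EE_K m = PP_K m ** mat_const (mat_eval (K_sq ^ m) C_K))) \<and>
         (\<forall>x y :: K. EE_K 0 = PP_K 0 ** mat_const (vector [vector [1, 1], vector [x, y]]))"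
  using EE_S_eq EE_K_eq EE_K_0 by blast

end
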